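(* Let $\gamma\in(\tfrac12,1)$ and $\beta=1-\gamma$. For $n\ge1$ and $t\in[0,1]$ let $M_n^{\gamma,\beta}[0,t]=\int_0^t M_n^{\gamma,\beta}(dx)$, where $$M_n^{\gamma,\beta}(dx)=\sum_{|z|=n}e^{-\gamma V(z)+i\beta\sqrt{2\ln 2}\,X(z)}\,\mathbf 1_{]t_z,t_z+2^{-n}]}(x)\,2^n\,dx .$$ Then almost surely the functions $t\mapsto M_n^{\gamma,\beta}[0,t]$ converge, uniformly on $[0,1]$ (i.e. in the space of continuous functions), to a random continuous function $t\mapsto M^{\gamma,\beta}[0,t]$. Moreover, there exists a constant $\xi>0$ such that for every $\epsilon>0$, almost surely there is a random constant $C>0$ with $$|M^{\gamma,\beta}[s,t]|\le \frac{C}{\big(\ln(1+\frac{1}{|t-s|})\big)^{\xi-\epsilon}}\qquad\text{for all } s,t\in[0,1],\ s\neq t,$$ where $M^{\gamma,\beta}[s,t]=M^{\gamma,\beta}[0,t]-M^{\gamma,\beta}[0,s]$.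
   Context: Let $\mathbb{T}=\bigcup_{n\ge0}\{0,1\}^n$ be the binary tree of finite words $u=(u_1,\dots,u_n)$, with $|u|=n$ and root $\emptyset$; for $l\le|u|$ write $u_{|l}=(u_1,\dots,u_l)$. Let $(\Theta_u)_{u\in\mathbb{T}\setminus\{\emptyset\}}$ be i.i.d. complex random variables with $\mathrm{Re}\,\Theta_u=\sqrt{2\ln2}\,N_1+2\ln 2$ and $\mathrm{Im}\,\Theta_u=N_2$, where $N_1,N_2$ are independent standard Gaussians. For $|u|=n$ set $\theta(u)=\sum_{l=1}^n\Theta_{u_{|l}}$, $V(u)=\mathrm{Re}\,\theta(u)$, $X(u)=\mathrm{Im}\,\theta(u)$. For $|z|=n$ set $t_z=\sum_{i=1}^n z_i2^{-i}\in[0,1]$. *)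

theory Defs
  imports "HOL-Probability.Probability"
begin

text \<open>Binary words are encoded as bool lists, True standing for the letter 1.
  The prefix u_{|l} is take l u.\<close>

definition theta :: "(bool list \<Rightarrow> 'a \<Rightarrow> complex) \<Rightarrow> bool list \<Rightarrow> 'a \<Rightarrow> complex" where
  "theta Theta u \<omega> = (\<Sum>l\<in>{1..length u}. Theta (take l u) \<omega>)"

definition Vw :: "(bool list \<Rightarrow> 'a \<Rightarrow> complex) \<Rightarrow> bool list \<Rightarrow> 'a \<Rightarrow> real" where
  "Vw Theta u \<omega> = Re (theta Theta u \<omega>)"

definition Xw :: "(bool list \<Rightarrow> 'a \<Rightarrow> complex) \<Rightarrow> bool list \<Rightarrow> 'a \<Rightarrow> real" where
  "Xw Theta u \<omega> = Im (theta Theta u \<omega>)"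

definition tz :: "bool list \<Rightarrow> real" where
  "tz z = (\<Sum>i<length z. (if z ! i then 1 else 0) / 2 ^ (i + 1))"

definition Mn_density :: "(bool list \<Rightarrow> 'a \<Rightarrow> complex) \<Rightarrow> real \<Rightarrow> real \<Rightarrow> nat \<Rightarrow> 'a \<Rightarrow> real \<Rightarrow> complex" where
  "Mn_density Theta \<gamma> \<beta> n \<omega> x =
     (\<Sum>z\<in>{z::bool list. length z = n}.
        exp (complex_of_real (- \<gamma> * Vw Theta z \<omega>)
             + \<i> * complex_of_real (\<beta> * sqrt (2 * ln 2) * Xw Theta z \<omega>))
        * (if x \<in> {tz z <.. tz z + 1 / 2 ^ n} then 1 else 0) * 2 ^ n)"

definition Mn :: "(bool list \<Rightarrow> 'a \<Rightarrow> complex) \<Rightarrow> real \<Rightarrow> real \<Rightarrow> nat \<Rightarrow> 'a \<Rightarrow> real \<Rightarrow> complex" where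
  "Mn Theta \<gamma> \<beta> n \<omega> t = integral {0..t} (Mn_density Theta \<gamma> \<beta> n \<omega>)"

end

(* The mean of exp(-g V + i (1-g) sqrt(2 ln 2) X) over one step is 1/2, so for fixed t the masses
   M_n[0,t] form a martingale in n. Their second moments are unbounded unless the particles that fall
   below a barrier -A are killed; almost surely no particle falls below -A when A is large.

   Tilting by exp(-V) turns V into a centred Gaussian walk (the critical case), so the killed second
   moments are Green-type sums of exp(-(2g-1) S) for this walk above -A. A Lyapunov function
   C - exp(-eps x) bounds such a sum over times after n by the probability of surviving up to time n,
   which is O(n^(-1/5)).

   Doob's L2 inequality is applied twice: the increments at the vertices, explored in lexicographic
   order, form a martingale whose partial sums are M_m[0,t] - M_n[0,t] up to the contribution of the
   ancestors of t, and the maximum over t is a submartingale in m. Borel-Cantelli along the dyadic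
   blocks [2^k, 2^(k+1)] gives increments O(2^(-k xi)). The ancestors contribute
   the sum of exp(-g V) along the path, bounded uniformly in the path because the exponential of the
   additive functional of exp(-eps V) is dominated by a nonnegative supermartingale; the last power of
   exp(-V) is small by Ville's inequality. As M_n is Lipschitz with constant O(4^n), choosing n of order
   ln(1/|t-s|) yields the modulus of continuity. *)
theory Submission
  imports Defs "HOL-Real_Asymp.Real_Asymp" "HOL-Library.List_Lexorder"
begin

text \<open>The sum of exp(-2g V) over level n has mean 2^(n (2g-1)^2), which is the growth to be
  removed. Above the barrier exp(-2g V) = exp(-V) exp(-(2g-1) V): the first factor is spent on the
  tilt and the second is bounded, because g > 1/2. The decay so obtained is only polynomial in n.
  This rules out a union bound over the 2^n grid points, so the maximum over t has to come from a
  martingale inequality, and it forces the passage to levels 2^k, where powers of n become summable.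
  Lexicographic order fits because it is the left-to-right order of the dyadic intervals except
  along lines of ancestors; an ancestor of t enters M_n[0,t] with a fractional weight depending on
  t. The imaginary part acts only through the mean 1/2 of one step; all moduli see V alone.
  Exponents: Ville's inequality turns survival of order 2^(-k/5) into exp(-V) < 2^(-k/10) beyond
  level 2^k; its power (1-g)/2 is 2^(-k (1-g)/20), the source of xi = (1-g)/20. Chebyshev's
  inequality gives the smaller 2^(-k/20) for the block maxima.\<close>

section \<open>Histories of the increments and independence\<close>

definition words_upto :: "nat \<Rightarrow> bool list set" where
  "words_upto n = {u. u \<noteq> [] \<and> length u \<le> n}"

text \<open>The sigma-algebra generated by the \<open>Theta u\<close> with \<open>u\<close> in
  \<open>A\<close>. Indexing by arbitrary sets of words lets the same lemmas serve the filtration by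
  levels and the one by lexicographic exploration.\<close>

definition history :: "'a measure \<Rightarrow> (bool list \<Rightarrow> 'a \<Rightarrow> complex) \<Rightarrow> bool list set \<Rightarrow> 'a measure" where
  "history M Theta A =
     vimage_algebra (space M) (\<lambda>w. restrict (\<lambda>u. Theta u w) A) (PiM A (\<lambda>_. borel))"

locale cascade = prob_space M for M :: "'a measure" +
  fixes Theta :: "bool list \<Rightarrow> 'a \<Rightarrow> complex"
  assumes indep_Theta: "indep_vars (\<lambda>_. borel) Theta {u. u \<noteq> []}"
    and distributed_Re: "\<And>u. u \<noteq> [] \<Longrightarrow>
      distributed M lborel (\<lambda>w. Re (Theta u w)) (normal_density (2 * ln 2) (sqrt (2 * ln 2)))"
    and distributed_Im: "\<And>u. u \<noteq> [] \<Longrightarrow>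
      distributed M lborel (\<lambda>w. Im (Theta u w)) std_normal_density"
    and indep_Re_Im: "\<And>u. u \<noteq> [] \<Longrightarrow>
      indep_var borel (\<lambda>w. Re (Theta u w)) borel (\<lambda>w. Im (Theta u w))"
begin

abbreviation hist :: "bool list set \<Rightarrow> 'a measure" where
  "hist A \<equiv> history M Theta A"

abbreviation V :: "bool list \<Rightarrow> 'a \<Rightarrow> real" where
  "V \<equiv> Vw Theta"

lemma space_hist [simp]: "space (hist A) = space M"
  by (simp add: history_def)

lemma measurable_Theta: "u \<noteq> [] \<Longrightarrow> Theta u \<in> borel_measurable M"
  using indep_Theta by (auto simp: indep_vars_def)

lemma measurable_restrict_Theta:
  "A \<subseteq> {u. u \<noteq> []} \<Longrightarrow>
    (\<lambda>w. restrict (\<lambda>u. Theta u w) A) \<in> measurable M (PiM A (\<lambda>_. borel))"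
  using measurable_Theta by (intro measurable_restrict) auto

lemma measurable_id_hist:
  assumes "A \<subseteq> {u. u \<noteq> []}"
  shows "(\<lambda>x. x) \<in> measurable M (hist A)"
  unfolding history_def
  by (rule measurable_vimage_algebra2) (use measurable_restrict_Theta[OF assms] in auto)

lemma measurable_from_hist:
  assumes "A \<subseteq> {u. u \<noteq> []}" "f \<in> measurable (hist A) N"
  shows "f \<in> measurable M N"
  using measurable_compose[OF measurable_id_hist[OF assms(1)] assms(2)] by simp

lemma measurable_Theta_hist:
  assumes "u \<in> A"
  shows "Theta u \<in> borel_measurable (hist A)"
proof -
  have "(\<lambda>w. restrict (\<lambda>u. Theta u w) A) \<in> measurable (hist A) (PiM A (\<lambda>_. borel))"
    unfolding history_def by (rule measurable_vimage_algebra1) (auto simp: space_PiM)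
  from measurable_compose[OF this measurable_component_singleton[OF assms]] assms
  show ?thesis by simp
qed

lemma measurable_hist_mono:
  assumes "A \<subseteq> B" "f \<in> measurable (hist A) N"
  shows "f \<in> measurable (hist B) N"
proof -
  have *: "(\<lambda>w. restrict (\<lambda>u. Theta u w) A) \<in> measurable (hist B) (PiM A (\<lambda>_. borel))"
    by (intro measurable_restrict measurable_Theta_hist) (use assms in auto)
  have "(\<lambda>x. x) \<in> measurable (hist B) (hist A)"
    unfolding history_def[of M Theta A]
    by (rule measurable_vimage_algebra2) (use * in auto)
  from measurable_compose[OF this assms(2)] show ?thesis by simp
qed

lemma indep_set_hist_Theta:
  assumes A: "A \<subseteq> {u. u \<noteq> []}" and v: "v \<notin> A" "v \<noteq> []"
  shows "indep_set (sets (hist A)) (sigma_sets (space M) {Theta v -` B \<inter> space M | B. B \<in> sets borel})"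
proof -
  let ?X = "\<lambda>w. restrict (\<lambda>u. Theta u w) A"
  let ?Y = "\<lambda>w. restrict (\<lambda>u. Theta u w) {v}"
  have "indep_var (PiM A (\<lambda>_. borel)) ?X (PiM {v} (\<lambda>_. borel)) ?Y"
    by (rule indep_var_restrict[OF indep_Theta]) (use assms in auto)
  then have i: "indep_set
      (sigma_sets (space M) { ?X -` B \<inter> space M | B. B \<in> sets (PiM A (\<lambda>_. borel))})
      (sigma_sets (space M) { ?Y -` B \<inter> space M | B. B \<in> sets (PiM {v} (\<lambda>_. borel))})"
    unfolding indep_var_eq by auto
  have h: "sets (hist A) = sigma_sets (space M) { ?X -` B \<inter> space M | B. B \<in> sets (PiM A (\<lambda>_. borel))}"
    unfolding history_def vimage_algebra_def by (rule sets_measure_of) auto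
  have "Theta v -` B \<inter> space M \<in> { ?Y -` B \<inter> space M | B. B \<in> sets (PiM {v} (\<lambda>_. borel))}"
    if "B \<in> sets borel" for B
  proof -
    have "(\<lambda>f. f v) -` B \<inter> space (PiM {v} (\<lambda>_. borel)) \<in> sets (PiM {v} (\<lambda>_. borel :: complex measure))"
      using that by (intro measurable_sets[of _ _ borel]) auto
    moreover have "Theta v -` B \<inter> space M = ?Y -` ((\<lambda>f. f v) -` B \<inter> space (PiM {v} (\<lambda>_. borel))) \<inter> space M"
      by (auto simp: space_PiM)
    ultimately show ?thesis by blast
  qed
  then have "sigma_sets (space M) {Theta v -` B \<inter> space M | B. B \<in> sets borel} \<subseteq>
      sigma_sets (space M) { ?Y -` B \<inter> space M | B. B \<in> sets (PiM {v} (\<lambda>_. borel))}"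
    by (intro sigma_sets_mono') auto
  with i show ?thesis unfolding h indep_set_def
    by (rule_tac indep_sets_mono_sets[OF i[unfolded indep_set_def]]) (auto split: bool.splits)
qed

lemma indep_var_hist_Theta:
  assumes A: "A \<subseteq> {u. u \<noteq> []}" and v: "v \<notin> A" "v \<noteq> []"
    and Y: "Y \<in> measurable (hist A) N" and g: "g \<in> measurable borel N'"
  shows "indep_var N Y N' (\<lambda>w. g (Theta v w))"
proof -
  have "{Y -` B \<inter> space M | B. B \<in> sets N} \<subseteq> sets (hist A)"
    using measurable_sets[OF Y] by auto
  then have 1: "sigma_sets (space M) {Y -` B \<inter> space M | B. B \<in> sets N} \<subseteq> sets (hist A)"
    using sets.sigma_sets_subset[of _ "hist A"] by simp
  have "{(\<lambda>w. g (Theta v w)) -` B \<inter> space M | B. B \<in> sets N'} \<subseteq>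
      {Theta v -` B \<inter> space M | B. B \<in> sets borel}"
  proof safe
    fix B assume "B \<in> sets N'"
    then have "g -` B \<in> sets borel" using measurable_sets[OF g] by simp
    then show "\<exists>C. (\<lambda>w. g (Theta v w)) -` B \<inter> space M = Theta v -` C \<inter> space M \<and> C \<in> sets borel"
      by (intro exI[of _ "g -` B"]) auto
  qed
  then have 2: "sigma_sets (space M) {(\<lambda>w. g (Theta v w)) -` B \<inter> space M | B. B \<in> sets N'} \<subseteq>
      sigma_sets (space M) {Theta v -` B \<inter> space M | B. B \<in> sets borel}"
    by (rule sigma_sets_mono')
  have "indep_set (sigma_sets (space M) {Y -` B \<inter> space M | B. B \<in> sets N})
      (sigma_sets (space M) {(\<lambda>w. g (Theta v w)) -` B \<inter> space M | B. B \<in> sets N'})"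
    unfolding indep_set_def
    by (rule indep_sets_mono_sets[OF indep_set_hist_Theta[OF A v, unfolded indep_set_def]])
      (use 1 2 in \<open>auto split: bool.splits\<close>)
  then show ?thesis
    unfolding indep_var_eq
    using measurable_from_hist[OF A Y] measurable_compose[OF measurable_Theta[OF v(2)] g] by auto
qed

text \<open>Freezing: the identity map into \<open>hist A\<close> stands for the whole past, its
  joint law with the new increment is a product (checked on rectangles), and Tonelli integrates out
  the increment with the past fixed.\<close>

lemma nn_integral_indep_Re:
  fixes F :: "'a \<times> real \<Rightarrow> ennreal"
  assumes A: "A \<subseteq> {u. u \<noteq> []}" and v: "v \<notin> A" "v \<noteq> []"
    and F: "F \<in> borel_measurable (hist A \<Otimes>\<^sub>M borel)"
  shows "(\<integral>\<^sup>+w. F (w, Re (Theta v w)) \<partial>M) =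
    (\<integral>\<^sup>+w. (\<integral>\<^sup>+y. normal_density (2 * ln 2) (sqrt (2 * ln 2)) y * F (w, y) \<partial>lborel) \<partial>M)"
proof -
  let ?Y = "\<lambda>w. Re (Theta v w)"
  let ?f = "\<lambda>y. ennreal (normal_density (2 * ln 2) (sqrt (2 * ln 2)) y)"
  have rv: "(\<lambda>x. x) \<in> measurable M (hist A)" "?Y \<in> borel_measurable M"
    using measurable_id_hist[OF A] measurable_Theta[OF v(2)] by auto
  interpret P1: prob_space "distr M (hist A) (\<lambda>x. x)" by (rule prob_space_distr) (rule rv)
  interpret P2: prob_space "distr M borel ?Y" by (rule prob_space_distr) (rule rv)
  have "distr M lborel ?Y = distr M borel ?Y" by (rule distr_cong) auto
  then have law: "distr M borel ?Y = density lborel ?f"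
    using distributed_distr_eq_density[OF distributed_Re[OF v(2)]] by simp
  have "(\<integral>\<^sup>+w. F (w, ?Y w) \<partial>M) =
      (\<integral>\<^sup>+x. F x \<partial>distr M (hist A \<Otimes>\<^sub>M borel) (\<lambda>w. (w, ?Y w)))"
    by (rule nn_integral_distr[symmetric]) (use rv F in auto)
  also have "distr M (hist A \<Otimes>\<^sub>M borel) (\<lambda>w. (w, ?Y w)) =
      distr M (hist A) (\<lambda>x. x) \<Otimes>\<^sub>M distr M borel ?Y"
  proof (rule pair_measure_eqI[symmetric])
    fix B C assume B: "B \<in> sets (distr M (hist A) (\<lambda>x. x))" and C: "C \<in> sets (distr M borel ?Y)"
    have B': "B \<in> sets (hist A)" "B \<inter> space M = B" using B sets.sets_into_space[of B "hist A"] by auto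
    have "Theta v -` (Re -` C) \<inter> space M \<in> sigma_sets (space M) {Theta v -` B \<inter> space M | B. B \<in> sets borel}"
      using C measurable_sets[of Re borel borel C] by (intro sigma_sets.Basic) auto
    with indep_setD[OF indep_set_hist_Theta[OF A v] B'(1)]
    have "prob (B \<inter> (Theta v -` (Re -` C) \<inter> space M)) = prob B * prob (Theta v -` (Re -` C) \<inter> space M)"
      by blast
    then have "emeasure M (B \<inter> (Theta v -` (Re -` C) \<inter> space M)) =
        emeasure M B * emeasure M (Theta v -` (Re -` C) \<inter> space M)"
      by (simp add: emeasure_eq_measure ennreal_mult)
    moreover have "emeasure (distr M borel ?Y) C = emeasure M (Theta v -` (Re -` C) \<inter> space M)"
      using C rv by (subst emeasure_distr) (auto intro!: arg_cong[where f="emeasure M"])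
    moreover have "emeasure (distr M (hist A) (\<lambda>x. x)) B = emeasure M B"
      using B' rv by (subst emeasure_distr) auto
    moreover have "emeasure (distr M (hist A \<Otimes>\<^sub>M borel) (\<lambda>w. (w, ?Y w))) (B \<times> C) =
        emeasure M (B \<inter> (Theta v -` (Re -` C) \<inter> space M))"
      using B' C rv by (subst emeasure_distr) (auto intro!: arg_cong[where f="emeasure M"])
    ultimately show "emeasure (distr M (hist A) (\<lambda>x. x)) B * emeasure (distr M borel ?Y) C =
        emeasure (distr M (hist A \<Otimes>\<^sub>M borel) (\<lambda>w. (w, ?Y w))) (B \<times> C)" by simp
  qed (auto simp: P1.sigma_finite_measure_axioms P2.sigma_finite_measure_axioms cong: sets_pair_measure_cong)
  also have "(\<integral>\<^sup>+x. F x \<partial>(distr M (hist A) (\<lambda>x. x) \<Otimes>\<^sub>M distr M borel ?Y)) =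
      (\<integral>\<^sup>+w. (\<integral>\<^sup>+y. F (w, y) \<partial>distr M borel ?Y) \<partial>distr M (hist A) (\<lambda>x. x))"
    by (rule P2.nn_integral_fst[symmetric])
      (use F in \<open>simp cong: measurable_cong_sets sets_pair_measure_cong\<close>)
  also have "\<dots> = (\<integral>\<^sup>+w. (\<integral>\<^sup>+y. F (w, y) \<partial>distr M borel ?Y) \<partial>M)"
  proof -
    have "(\<lambda>w. \<integral>\<^sup>+y. F (w, y) \<partial>distr M borel ?Y) \<in> borel_measurable (hist A)"
      by (rule P2.borel_measurable_nn_integral_fst)
        (use F in \<open>simp cong: measurable_cong_sets sets_pair_measure_cong\<close>)
    with nn_integral_distr[OF rv(1)] show ?thesis by simp
  qed
  also have "\<dots> = (\<integral>\<^sup>+w. (\<integral>\<^sup>+y. ?f y * F (w, y) \<partial>lborel) \<partial>M)"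
    unfolding law
  proof (intro nn_integral_cong nn_integral_density)
    fix w assume "w \<in> space M"
    then show "(\<lambda>y. F (w, y)) \<in> borel_measurable lborel"
      using measurable_Pair2[OF F, of w] by simp
  qed auto
  finally show ?thesis by simp
qed

text \<open>The martingale difference property, phrased by testing against every integrable variable
  of the past instead of through conditional expectations.\<close>

lemma integral_indep_Theta_mean_zero:
  fixes Y :: "'a \<Rightarrow> complex" and h :: "complex \<Rightarrow> complex"
  assumes A: "A \<subseteq> {u. u \<noteq> []}" and v: "v \<notin> A" "v \<noteq> []"
    and Y: "Y \<in> borel_measurable (hist A)" "integrable M Y"
    and h: "h \<in> borel_measurable borel" "integrable M (\<lambda>w. h (Theta v w))"
      "(\<integral>w. h (Theta v w) \<partial>M) = 0"
  shows "integrable M (\<lambda>w. Y w * h (Theta v w))" "(\<integral>w. Y w * h (Theta v w) \<partial>M) = 0"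
proof -
  have i: "indep_var borel Y borel (\<lambda>w. h (Theta v w))"
    by (rule indep_var_hist_Theta[OF A v]) (use Y h in auto)
  show "integrable M (\<lambda>w. Y w * h (Theta v w))"
    by (rule indep_var_integrable[OF i]) (use Y h in auto)
  show "(\<integral>w. Y w * h (Theta v w) \<partial>M) = 0"
    using indep_var_lebesgue_integral[OF i] Y h by simp
qed

end

section \<open>Exponential tilting and the transition operator of the killed walk\<close>

text \<open>Completing the square. With \<open>m = 2 * ln 2\<close>,
  \<open>s\<^sup>2 = 2 * ln 2\<close> and \<open>c = 1\<close> the new mean is 0 and the factor is
  1/2: the critical case.\<close>

lemma normal_density_exp_tilt:
  fixes m s c y :: real
  assumes "0 < s"
  shows "normal_density m s y * exp (- c * y) =
    exp (c\<^sup>2 * s\<^sup>2 / 2 - c * m) * normal_density (m - c * s\<^sup>2) s y"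
proof -
  have "- (y - m)\<^sup>2 / (2 * s\<^sup>2) + (- c * y) =
      (c\<^sup>2 * s\<^sup>2 / 2 - c * m) + - (y - (m - c * s\<^sup>2))\<^sup>2 / (2 * s\<^sup>2)"
    using assms by (simp add: field_simps power2_eq_square)
  then have "exp (- (y - m)\<^sup>2 / (2 * s\<^sup>2)) * exp (- c * y) =
      exp (c\<^sup>2 * s\<^sup>2 / 2 - c * m) * exp (- (y - (m - c * s\<^sup>2))\<^sup>2 / (2 * s\<^sup>2))"
    by (simp only: exp_add[symmetric])
  then show ?thesis unfolding normal_density_def by simp
qed

lemma nn_integral_normal_exp:
  assumes "0 < s"
  shows "(\<integral>\<^sup>+y. normal_density m s y * ennreal (exp (- c * y)) \<partial>lborel) =
    ennreal (exp (c\<^sup>2 * s\<^sup>2 / 2 - c * m))"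
proof -
  have one: "(\<integral>\<^sup>+y. normal_density a s y \<partial>lborel) = 1" for a
    using assms by (simp add: nn_integral_eq_integral)
  have "(\<integral>\<^sup>+y. normal_density m s y * ennreal (exp (- c * y)) \<partial>lborel) =
     (\<integral>\<^sup>+y. ennreal (exp (c\<^sup>2 * s\<^sup>2 / 2 - c * m)) * normal_density (m - c * s\<^sup>2) s y \<partial>lborel)"
    using normal_density_exp_tilt[OF assms]
    by (intro nn_integral_cong) (simp add: ennreal_mult'[symmetric])
  also have "\<dots> = ennreal (exp (c\<^sup>2 * s\<^sup>2 / 2 - c * m))"
    by (subst nn_integral_cmult) (auto simp: one)
  finally show ?thesis .
qed

abbreviation critical_density :: "real \<Rightarrow> real" where
  "critical_density \<equiv> normal_density 0 (sqrt (2 * ln 2))"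

text \<open>Transition operator of the centred Gaussian walk of variance \<open>2 * ln 2\<close>;
  the killing acts at the new position \<open>x + y\<close>, not at \<open>x\<close>.\<close>

definition Qop :: "real set \<Rightarrow> (real \<Rightarrow> ennreal) \<Rightarrow> real \<Rightarrow> ennreal" where
  "Qop B f x =
     (\<integral>\<^sup>+y. ennreal (critical_density y) * (indicator B (x + y) * f (x + y)) \<partial>lborel)"

lemma borel_measurable_Qop [measurable]:
  assumes [measurable]: "B \<in> sets borel" "f \<in> borel_measurable borel"
  shows "Qop B f \<in> borel_measurable borel"
  unfolding Qop_def by measurable

lemma sum_words_Suc:
  "(\<Sum>v\<in>{v::bool list. length v = Suc n}. g v) =
    (\<Sum>u\<in>{u. length u = n}. \<Sum>b\<in>UNIV. g (u @ [b]))"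
proof -
  have "(\<Sum>u\<in>{u. length u = n}. \<Sum>b\<in>UNIV. g (u @ [b])) =
      (\<Sum>(u, b)\<in>{u. length u = n} \<times> UNIV. g (u @ [b]))"
    by (rule sum.cartesian_product)
  also have "\<dots> = (\<Sum>v\<in>{v::bool list. length v = Suc n}. g v)"
    by (rule sum.reindex_bij_witness[of _ "\<lambda>v. (butlast v, last v)" "\<lambda>(u, b). u @ [b]"])
      (auto intro!: append_butlast_last_id)
  finally show ?thesis by simp
qed

lemma finite_words [simp]: "finite {u::bool list. length u = n}"
  using finite_lists_length_eq[of "UNIV :: bool set" n] by simp

lemma theta_Nil [simp]: "theta Theta [] w = 0"
  by (simp add: theta_def)

lemma theta_snoc: "theta Theta (u @ [b]) w = theta Theta u w + Theta (u @ [b]) w"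
  by (simp add: theta_def)

lemma Vw_Nil [simp]: "Vw Theta [] w = 0"
  by (simp add: Vw_def)

lemma Vw_snoc: "Vw Theta (u @ [b]) w = Vw Theta u w + Re (Theta (u @ [b]) w)"
  by (simp add: Vw_def theta_snoc)

lemma words_upto_mono: "m \<le> n \<Longrightarrow> words_upto m \<subseteq> words_upto n"
  by (auto simp: words_upto_def)

lemma words_upto_nonempty: "words_upto n \<subseteq> {u. u \<noteq> []}"
  by (auto simp: words_upto_def)

section \<open>Killed weights, the many-to-one formula and Ville's inequality\<close>

context cascade
begin

abbreviation hist_upto :: "nat \<Rightarrow> 'a measure" where
  "hist_upto n \<equiv> hist (words_upto n)"

lemma measurable_theta_hist:
  assumes "\<And>l. l \<in> {1..length u} \<Longrightarrow> take l u \<in> A"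
  shows "theta Theta u \<in> borel_measurable (hist A)"
  unfolding theta_def[abs_def]
  by (intro borel_measurable_sum measurable_Theta_hist assms)

lemma measurable_V_hist:
  assumes "\<And>l. l \<in> {1..length u} \<Longrightarrow> take l u \<in> A"
  shows "V u \<in> borel_measurable (hist A)"
  unfolding Vw_def[abs_def] using measurable_theta_hist[OF assms] by auto

lemma measurable_theta_upto:
  "length u \<le> n \<Longrightarrow> theta Theta u \<in> borel_measurable (hist_upto n)"
  by (rule measurable_theta_hist) (auto simp: words_upto_def)

lemma measurable_V_upto: "length u \<le> n \<Longrightarrow> V u \<in> borel_measurable (hist_upto n)"
  by (rule measurable_V_hist) (auto simp: words_upto_def)

lemma measurable_V [measurable]: "V u \<in> borel_measurable M"
  by (rule measurable_from_hist[OF words_upto_nonempty measurable_V_upto[OF order_refl]])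

definition alive :: "real set \<Rightarrow> bool list \<Rightarrow> 'a \<Rightarrow> bool" where
  "alive B u w \<longleftrightarrow> (\<forall>l\<in>{..length u}. V (take l u) w \<in> B)"

lemma alive_Nil [simp]: "alive B [] w \<longleftrightarrow> 0 \<in> B"
  by (simp add: alive_def)

lemma alive_snoc: "alive B (u @ [b]) w \<longleftrightarrow> alive B u w \<and> V (u @ [b]) w \<in> B"
  by (auto simp: alive_def atMost_Suc)

lemma alive_V: "alive B u w \<Longrightarrow> V u w \<in> B"
  by (auto simp: alive_def dest: bspec[of _ _ "length u"])

lemma alive_UNIV [simp]: "alive UNIV u w"
  by (simp add: alive_def)

lemma measurable_alive_hist:
  assumes "\<And>l. l \<in> {1..length u} \<Longrightarrow> take l u \<in> A" and [measurable]: "B \<in> sets borel"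
  shows "Measurable.pred (hist A) (alive B u)"
proof -
  have [measurable]: "V (take l u) \<in> borel_measurable (hist A)" if "l \<le> length u" for l
  proof (rule measurable_V_hist)
    fix k assume "k \<in> {1..length (take l u)}"
    with that show "take k (take l u) \<in> A" using assms(1)[of k] by (simp add: min_absorb1)
  qed
  have "Measurable.pred (hist A) (\<lambda>w. V (take l u) w \<in> B)" if "l \<le> length u" for l
    using that by measurable
  then show ?thesis unfolding alive_def
    by (intro pred_intros_finite) auto
qed

lemma measurable_alive_upto:
  "length u \<le> n \<Longrightarrow> B \<in> sets borel \<Longrightarrow> Measurable.pred (hist_upto n) (alive B u)"
  by (rule measurable_alive_hist) (auto simp: words_upto_def)

definition weight :: "real set \<Rightarrow> bool list \<Rightarrow> 'a \<Rightarrow> ennreal" where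
  "weight B u w = (if alive B u w then ennreal (exp (- V u w)) else 0)"

lemma weight_Nil: "weight B [] w = indicator B 0"
  by (simp add: weight_def)

lemma weight_snoc:
  "weight B (u @ [b]) w =
    weight B u w * (ennreal (exp (- Re (Theta (u @ [b]) w))) *
      indicator B (V u w + Re (Theta (u @ [b]) w)))"
proof -
  have "exp (- V (u @ [b]) w) = exp (- V u w) * exp (- Re (Theta (u @ [b]) w))"
    by (simp add: Vw_snoc exp_add[symmetric])
  then show ?thesis
    by (simp add: weight_def alive_snoc Vw_snoc ennreal_mult indicator_def)
qed

lemma measurable_weight_hist:
  assumes "\<And>l. l \<in> {1..length u} \<Longrightarrow> take l u \<in> A" "B \<in> sets borel"
  shows "weight B u \<in> borel_measurable (hist A)"
proof -
  have [measurable]: "V u \<in> borel_measurable (hist A)" "Measurable.pred (hist A) (alive B u)"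
    using measurable_V_hist measurable_alive_hist assms by auto
  show ?thesis unfolding weight_def by measurable
qed

lemma measurable_weight_upto:
  "length u \<le> n \<Longrightarrow> B \<in> sets borel \<Longrightarrow> weight B u \<in> borel_measurable (hist_upto n)"
  by (rule measurable_weight_hist) (auto simp: words_upto_def)

lemma measurable_weight [measurable]:
  "B \<in> sets borel \<Longrightarrow> weight B u \<in> borel_measurable M"
  by (rule measurable_from_hist[OF words_upto_nonempty measurable_weight_upto[OF order_refl]])

text \<open>Tilting by \<open>exp (- V)\<close> centres the Gaussian increment and costs a factor \<open>1/2\<close>, which the two
  children compensate.\<close>

lemma weight_step_half:
  fixes f :: "real \<Rightarrow> ennreal"
  assumes Y: "Y \<in> borel_measurable (hist_upto (length u))"
    and B [measurable]: "B \<in> sets borel" and f [measurable]: "f \<in> borel_measurable borel"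
  shows "2 * (\<integral>\<^sup>+w. Y w * (weight B (u @ [b]) w * f (V (u @ [b]) w)) \<partial>M) =
    (\<integral>\<^sup>+w. Y w * (weight B u w * Qop B f (V u w)) \<partial>M)"
proof -
  let ?H = "hist_upto (length u)"
  let ?s = "sqrt (2 * ln 2 :: real)"
  note Y [measurable]
  have [measurable]: "weight B u \<in> borel_measurable ?H" "V u \<in> borel_measurable ?H"
    by (auto intro: measurable_weight_upto measurable_V_upto)
  define F :: "'a \<times> real \<Rightarrow> ennreal" where "F = (\<lambda>(w, y). Y w * weight B u w *
     (ennreal (exp (- y)) * (indicator B (V u w + y) * f (V u w + y))))"
  let ?J = "\<lambda>w. \<integral>\<^sup>+y. normal_density (2 * ln 2) ?s y * F (w, y) \<partial>lborel"
  have F: "F \<in> borel_measurable (?H \<Otimes>\<^sub>M borel)"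
    unfolding F_def by measurable
  have "(\<integral>\<^sup>+w. Y w * (weight B (u @ [b]) w * f (V (u @ [b]) w)) \<partial>M) =
      (\<integral>\<^sup>+w. F (w, Re (Theta (u @ [b]) w)) \<partial>M)"
    by (intro nn_integral_cong) (simp add: F_def weight_snoc Vw_snoc mult_ac)
  also have "\<dots> = (\<integral>\<^sup>+w. ?J w \<partial>M)"
    by (rule nn_integral_indep_Re[OF words_upto_nonempty _ _ F]) (auto simp: words_upto_def)
  finally have "2 * (\<integral>\<^sup>+w. Y w * (weight B (u @ [b]) w * f (V (u @ [b]) w)) \<partial>M) =
     2 * (\<integral>\<^sup>+w. ?J w \<partial>M)" by simp
  also have "\<dots> = (\<integral>\<^sup>+w. 2 * ?J w \<partial>M)"
  proof (rule nn_integral_cmult[symmetric])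
    note F [measurable]
    have "?J \<in> borel_measurable ?H"
      by measurable
    then show "?J \<in> borel_measurable M"
      by (rule measurable_from_hist[OF words_upto_nonempty])
  qed
  also have "\<dots> = (\<integral>\<^sup>+w. Y w * (weight B u w * Qop B f (V u w)) \<partial>M)"
  proof (rule nn_integral_cong)
    fix w assume "w \<in> space M"
    have tilt: "2 * (ennreal (normal_density (2 * ln 2) ?s y) * ennreal (exp (- y))) =
        ennreal (normal_density 0 ?s y)" for y
    proof -
      have "normal_density (2 * ln 2) ?s y * exp (- 1 * y) = exp (- ln 2) * normal_density 0 ?s y"
        by (subst normal_density_exp_tilt) auto
      also have "exp (- ln 2 :: real) = 1 / 2" by (simp add: exp_minus)
      finally have e: "2 * (normal_density (2 * ln 2) ?s y * exp (- y)) = normal_density 0 ?s y"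
        by simp
      have "2 * (ennreal (normal_density (2 * ln 2) ?s y) * ennreal (exp (- y))) =
          ennreal 2 * ennreal (normal_density (2 * ln 2) ?s y * exp (- y))"
        by (subst ennreal_mult) auto
      also have "\<dots> = ennreal (2 * (normal_density (2 * ln 2) ?s y * exp (- y)))"
        by (subst ennreal_mult[symmetric]) auto
      finally show ?thesis using e by simp
    qed
    have "2 * ?J w =
        (\<integral>\<^sup>+y. 2 * (normal_density (2 * ln 2) ?s y * F (w, y)) \<partial>lborel)"
      by (rule nn_integral_cmult[symmetric]) (simp add: F_def)
    also have "\<dots> = (\<integral>\<^sup>+y. (Y w * weight B u w) * (ennreal (normal_density 0 ?s y) *
        (indicator B (V u w + y) * f (V u w + y))) \<partial>lborel)"
      unfolding F_def tilt[symmetric] by (intro nn_integral_cong) (simp add: mult_ac)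
    also have "\<dots> = (Y w * weight B u w) * Qop B f (V u w)"
      unfolding Qop_def by (rule nn_integral_cmult) simp
    finally show "2 * ?J w =
        Y w * (weight B u w * Qop B f (V u w))" by (simp add: mult_ac)
  qed
  finally show ?thesis .
qed

text \<open>One step of the many-to-one formula. The arbitrary factor \<open>Y\<close> from the past
  makes it a statement about conditional expectations, as the supermartingale arguments
  require.\<close>

lemma weight_step:
  fixes f :: "real \<Rightarrow> ennreal"
  assumes "Y \<in> borel_measurable (hist_upto (length u))"
    and "B \<in> sets borel" "f \<in> borel_measurable borel"
  shows "(\<Sum>b\<in>UNIV. \<integral>\<^sup>+w. Y w * (weight B (u @ [b]) w * f (V (u @ [b]) w)) \<partial>M) =
    (\<integral>\<^sup>+w. Y w * (weight B u w * Qop B f (V u w)) \<partial>M)"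
proof -
  let ?I = "\<lambda>b. \<integral>\<^sup>+w. Y w * (weight B (u @ [b]) w * f (V (u @ [b]) w)) \<partial>M"
  have "2 * ?I True = 2 * ?I False"
    using weight_step_half[OF assms] by simp
  then have "?I True = ?I False" by (simp add: ennreal_mult_cancel_left)
  then have "(\<Sum>b\<in>UNIV. ?I b) = 2 * ?I True" by (simp add: UNIV_bool mult_2)
  then show ?thesis using weight_step_half[OF assms] by simp
qed

text \<open>Iterating \<open>weight_step\<close> shows this to be the mean of \<open>f\<close> at
  time \<open>n\<close> for the centred walk started at 0 and killed outside \<open>B\<close>; the
  walk itself is never constructed.\<close>

definition level_mean :: "real set \<Rightarrow> nat \<Rightarrow> (real \<Rightarrow> ennreal) \<Rightarrow> ennreal" where
  "level_mean B n f = (\<Sum>u\<in>{u. length u = n}. \<integral>\<^sup>+w. weight B u w * f (V u w) \<partial>M)"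

lemma level_mean_0: "level_mean B 0 f = indicator B 0 * f 0"
  by (simp add: level_mean_def weight_Nil emeasure_space_1)

lemma level_mean_Suc:
  assumes "B \<in> sets borel" "f \<in> borel_measurable borel"
  shows "level_mean B (Suc n) f = level_mean B n (Qop B f)"
  unfolding level_mean_def sum_words_Suc
  using weight_step[OF borel_measurable_const[of 1] assms] by (intro sum.cong) auto

lemma level_mean_mono:
  assumes "\<And>x. x \<in> B \<Longrightarrow> f x \<le> g x"
  shows "level_mean B n f \<le> level_mean B n g"
  unfolding level_mean_def
proof (intro sum_mono nn_integral_mono)
  fix u :: "bool list" and w
  show "weight B u w * f (V u w) \<le> weight B u w * g (V u w)"
    using assms[OF alive_V] by (cases "alive B u w") (auto simp: weight_def intro: mult_left_mono)
qed

lemma level_mean_add: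
  assumes [measurable]: "B \<in> sets borel" "f \<in> borel_measurable borel" "g \<in> borel_measurable borel"
  shows "level_mean B n (\<lambda>x. f x + g x) = level_mean B n f + level_mean B n g"
  unfolding level_mean_def sum.distrib[symmetric] distrib_left
  by (intro sum.cong refl nn_integral_add) measurable

lemma measurable_weight_mult:
  assumes "B \<in> sets borel" "f \<in> borel_measurable borel"
  shows "(\<lambda>w. weight B u w * f (V u w)) \<in> borel_measurable M"
  by (rule borel_measurable_times_ennreal[OF measurable_weight[OF assms(1)]
        measurable_compose[OF measurable_V assms(2)]])

lemma level_mean_cmult:
  assumes "B \<in> sets borel" "f \<in> borel_measurable borel"
  shows "level_mean B n (\<lambda>x. c * f x) = c * level_mean B n f"
proof -
  have "(\<integral>\<^sup>+w. weight B u w * (c * f (V u w)) \<partial>M) = c * (\<integral>\<^sup>+w. weight B u w * f (V u w) \<partial>M)"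
    for u
    using nn_integral_cmult[OF measurable_weight_mult[OF assms], of c u]
    by (simp only: mult.left_commute[of c] mult.assoc)
  then show ?thesis by (simp add: level_mean_def sum_distrib_left)
qed

text \<open>The supermartingale is the sum of \<open>G u\<close> over the words \<open>u\<close> of length \<open>m\<close>.\<close>

lemma ville:
  fixes G :: "bool list \<Rightarrow> 'a \<Rightarrow> ennreal"
  assumes G: "\<And>u. G u \<in> borel_measurable (hist_upto (length u))"
    and super: "\<And>u Y. Y \<in> borel_measurable (hist_upto (length u)) \<Longrightarrow>
      (\<Sum>b\<in>UNIV. \<integral>\<^sup>+w. Y w * G (u @ [b]) w \<partial>M) \<le> (\<integral>\<^sup>+w. Y w * G u w \<partial>M)"
  shows "emeasure M {w\<in>space M. \<exists>u. n \<le> length u \<and> 1 \<le> G u w} \<le>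
    (\<Sum>u\<in>{u. length u = n}. \<integral>\<^sup>+w. G u w \<partial>M)"
proof -
  define Z where "Z m w = (\<Sum>u\<in>{u. length u = m}. G u w)" for m w
  \<comment> \<open>Only levels below \<open>k\<close> are inspected, so \<open>hit (Suc k)\<close>
    is known at level \<open>k\<close> and may serve as a test variable in
    \<open>step\<close>.\<close>
  define hit where "hit k w \<longleftrightarrow> (\<exists>m\<in>{n..<k}. 1 \<le> Z m w)" for k w
  have G_M [measurable]: "G u \<in> borel_measurable M" for u
    by (rule measurable_from_hist[OF words_upto_nonempty G])
  have Z_upto: "Z m \<in> borel_measurable (hist_upto k)" if "m \<le> k" for m k
    unfolding Z_def
  proof (intro borel_measurable_sum)
    fix u :: "bool list" assume "u \<in> {u. length u = m}"
    with that show "G u \<in> borel_measurable (hist_upto k)"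
      by (intro measurable_hist_mono[OF words_upto_mono G]) simp
  qed
  have [measurable]: "Z m \<in> borel_measurable M" for m
    by (rule measurable_from_hist[OF words_upto_nonempty Z_upto[OF order_refl]])
  have hit_upto: "Measurable.pred (hist_upto k) (hit (Suc k))" for k
    unfolding hit_def
  proof (intro pred_intros_finite)
    fix m assume "m \<in> {n..<Suc k}"
    then have [measurable]: "Z m \<in> borel_measurable (hist_upto k)" by (intro Z_upto) auto
    show "Measurable.pred (hist_upto k) (\<lambda>w. 1 \<le> Z m w)" by measurable
  qed auto
  have hit_M [measurable]: "Measurable.pred M (hit k)" for k
    unfolding hit_def by measurable
  have Z_int: "(\<integral>\<^sup>+w. Y w * Z m w \<partial>M) = (\<Sum>u\<in>{u. length u = m}. \<integral>\<^sup>+w. Y w * G u w \<partial>M)"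
    if [measurable]: "Y \<in> borel_measurable M" for Y m
    unfolding Z_def by (simp add: sum_distrib_left nn_integral_sum)
  have step: "(\<integral>\<^sup>+w. Y w * Z (Suc m) w \<partial>M) \<le> (\<integral>\<^sup>+w. Y w * Z m w \<partial>M)"
    if Y: "Y \<in> borel_measurable (hist_upto m)" for Y m
    unfolding Z_int[OF measurable_from_hist[OF words_upto_nonempty Y]] sum_words_Suc
  proof (intro sum_mono)
    fix u :: "bool list" assume "u \<in> {u. length u = m}"
    with Y have "Y \<in> borel_measurable (hist_upto (length u))" by simp
    then show "(\<Sum>b\<in>UNIV. \<integral>\<^sup>+w. Y w * G (u @ [b]) w \<partial>M) \<le> (\<integral>\<^sup>+w. Y w * G u w \<partial>M)"
      by (rule super)
  qed
  \<comment> \<open>The stopped process: a path that has hit keeps the value 1, the others carry the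
    current \<open>Z\<close>.\<close>
  have key: "emeasure M {w\<in>space M. hit (n + k) w} +
      (\<integral>\<^sup>+w. (if hit (n + k) w then 0 else 1) * Z (n + k) w \<partial>M) \<le> (\<integral>\<^sup>+w. Z n w \<partial>M)" for k
  proof (induction k)
    case 0
    then show ?case by (simp add: hit_def)
  next
    case (Suc k)
    let ?m = "n + k"
    have hs: "hit (Suc ?m) w \<longleftrightarrow> hit ?m w \<or> 1 \<le> Z ?m w" for w
      unfolding hit_def by (auto simp: less_Suc_eq)
    have "(\<integral>\<^sup>+w. (if hit (Suc ?m) w then 0 else 1) * Z (Suc ?m) w \<partial>M) \<le>
        (\<integral>\<^sup>+w. (if hit (Suc ?m) w then 0 else 1) * Z ?m w \<partial>M)"
      by (rule step) (use hit_upto in measurable)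
    then have "emeasure M {w\<in>space M. hit (Suc ?m) w} +
        (\<integral>\<^sup>+w. (if hit (Suc ?m) w then 0 else 1) * Z (Suc ?m) w \<partial>M) \<le>
        (\<integral>\<^sup>+w. indicator {w\<in>space M. hit (Suc ?m) w} w +
          (if hit (Suc ?m) w then 0 else 1) * Z ?m w \<partial>M)"
      by (subst nn_integral_add) (auto intro: add_left_mono)
    \<comment> \<open>Where the hit occurs exactly at this level, \<open>Z\<close> is at least 1 and
      pays for the indicator.\<close>
    also have "\<dots> \<le> (\<integral>\<^sup>+w. indicator {w\<in>space M. hit ?m w} w +
          (if hit ?m w then 0 else 1) * Z ?m w \<partial>M)"
      by (rule nn_integral_mono) (auto simp: hs indicator_def)
    also have "\<dots> = emeasure M {w\<in>space M. hit ?m w} +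
        (\<integral>\<^sup>+w. (if hit ?m w then 0 else 1) * Z ?m w \<partial>M)"
      by (subst nn_integral_add) auto
    finally show ?case using Suc.IH by (simp add: order_trans)
  qed
  have "emeasure M {w\<in>space M. \<exists>u. n \<le> length u \<and> 1 \<le> G u w} \<le>
      emeasure M (\<Union>k. {w\<in>space M. hit (n + k) w})"
  proof (intro emeasure_mono)
    show "{w\<in>space M. \<exists>u. n \<le> length u \<and> 1 \<le> G u w} \<subseteq> (\<Union>k. {w\<in>space M. hit (n + k) w})"
    proof safe
      fix w u assume u: "w \<in> space M" "n \<le> length u" "1 \<le> G u w"
      \<comment> \<open>The sum over a level dominates each of its words, so one maximal inequality
        treats all words at once.\<close>
      have "G u w \<le> Z (length u) w" unfolding Z_def by (rule member_le_sum) auto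
      with u have "\<exists>m\<in>{n..<Suc (length u)}. 1 \<le> Z m w"
        by (intro bexI[of _ "length u"]) auto
      with u have "hit (n + (Suc (length u) - n)) w" by (simp add: hit_def)
      with u show "w \<in> (\<Union>k. {w\<in>space M. hit (n + k) w})" by blast
    qed
  qed measurable
  also have "\<dots> = (SUP k. emeasure M {w\<in>space M. hit (n + k) w})"
  proof (rule SUP_emeasure_incseq[symmetric])
    show "incseq (\<lambda>k. {w\<in>space M. hit (n + k) w})"
      by (rule incseq_SucI) (auto simp: hit_def)
  qed auto
  also have "\<dots> \<le> (\<integral>\<^sup>+w. Z n w \<partial>M)"
    by (rule SUP_least) (rule order_trans[OF le_iff_add[THEN iffD2, OF exI, OF refl] key])
  also have "\<dots> = (\<Sum>u\<in>{u. length u = n}. \<integral>\<^sup>+w. G u w \<partial>M)"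
    using Z_int[of "\<lambda>_. 1"] by simp
  finally show ?thesis .
qed

end

subsection \<open>The one-dimensional walk killed below a barrier\<close>

lemma nn_integral_critical_exp:
  "(\<integral>\<^sup>+y. ennreal (critical_density y) * ennreal (exp (- c * (x + y))) \<partial>lborel) =
    ennreal (exp (c\<^sup>2 * ln 2) * exp (- c * x))"
proof -
  have "(\<integral>\<^sup>+y. ennreal (critical_density y) * ennreal (exp (- c * (x + y))) \<partial>lborel) =
     (\<integral>\<^sup>+y. ennreal (exp (- c * x)) *
        (ennreal (critical_density y) * ennreal (exp (- c * y))) \<partial>lborel)"
    by (intro nn_integral_cong)
      (simp add: ennreal_mult'[symmetric] exp_add[symmetric] algebra_simps)
  also have "\<dots> = ennreal (exp (- c * x)) *
      (\<integral>\<^sup>+y. ennreal (critical_density y) * ennreal (exp (- c * y)) \<partial>lborel)"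
    by (rule nn_integral_cmult) simp
  also have "\<dots> = ennreal (exp (- c * x)) * ennreal (exp (c\<^sup>2 * ln 2))"
    by (subst nn_integral_normal_exp) auto
  finally show ?thesis by (simp add: ennreal_mult'[symmetric] mult.commute)
qed

lemma nn_integral_critical_const:
  "(\<integral>\<^sup>+y. ennreal (critical_density y) * c \<partial>lborel) = c"
  using nn_integral_critical_exp[of 0 0] by (simp add: nn_integral_multc)

lemma Qop_le_nn_integral:
  "Qop B f x \<le> (\<integral>\<^sup>+y. ennreal (critical_density y) * f (x + y) \<partial>lborel)"
  unfolding Qop_def by (intro nn_integral_mono mult_left_mono) (auto simp: indicator_def)

lemma Qop_one_le: "Qop B (\<lambda>_. 1) x \<le> 1"
  using Qop_le_nn_integral[of B "\<lambda>_. 1" x] nn_integral_critical_const[of 1] by simp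

text \<open>The factor by which one step of the centred walk multiplies the mean of
  \<open>exp (- eps * x)\<close>.\<close>

definition growth :: "real \<Rightarrow> real" where
  "growth eps = exp (eps\<^sup>2 * ln 2)"

text \<open>Large enough for both parts of \<open>exp_le_cap\<close>: the second order error of the
  truncation stays below half the convexity gain, and the Lyapunov function stays above half its
  supremum, for all \<open>x\<close> above the barrier.\<close>

definition cap :: "real \<Rightarrow> real \<Rightarrow> real" where
  "cap eps A = 2 * exp (eps * A) * growth eps ^ 4 / (growth eps - 1)"

text \<open>Half of the convexity gain \<open>growth eps - 1\<close>; the other half pays for the
  truncation in \<open>lyap\<close>.\<close>

definition drift :: "real \<Rightarrow> real" where
  "drift eps = (growth eps - 1) / 2"

definition lyap :: "real \<Rightarrow> real \<Rightarrow> real \<Rightarrow> real" where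
  "lyap eps A x = max 0 (cap eps A - exp (- eps * x))"

lemma growth_gt_1: "0 < eps \<Longrightarrow> 1 < growth eps"
  by (simp add: growth_def)

lemma drift_pos: "0 < eps \<Longrightarrow> 0 < drift eps"
  using growth_gt_1[of eps] by (simp add: drift_def)

lemma cap_pos: "0 < eps \<Longrightarrow> 0 < cap eps A"
  using growth_gt_1[of eps] by (simp add: cap_def)

lemma exp_le_cap:
  assumes "0 < eps" "- A \<le> x"
  shows "growth eps ^ 4 * exp (- eps * x) \<le> cap eps A * drift eps" "exp (- eps * x) \<le> cap eps A / 2"
proof -
  let ?q = "growth eps"
  have q: "1 < ?q" using growth_gt_1[OF assms(1)] .
  have e: "exp (- eps * x) \<le> exp (eps * A)"
    using mult_left_mono[of "- A" x eps] assms by simp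
  have "cap eps A * drift eps = ?q ^ 4 * exp (eps * A)"
    using q by (simp add: cap_def drift_def)
  then show "?q ^ 4 * exp (- eps * x) \<le> cap eps A * drift eps"
    using q e by (simp add: mult_left_mono)
  have "?q - 1 \<le> ?q ^ 4" using power_increasing[of 1 4 ?q] q by simp
  then have "1 \<le> ?q ^ 4 / (?q - 1)" using q by simp
  then have "exp (eps * A) * 1 \<le> exp (eps * A) * (?q ^ 4 / (?q - 1))"
    by (intro mult_left_mono) auto
  moreover have "2 * a * b / c / 2 = a * (b / c)" for a b c :: real by simp
  ultimately show "exp (- eps * x) \<le> cap eps A / 2" using e by (simp only: cap_def)
qed

lemma lyap_bounds:
  assumes "0 < eps" "- A \<le> x"
  shows "lyap eps A x = cap eps A - exp (- eps * x)" "cap eps A / 2 \<le> lyap eps A x"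
  using exp_le_cap(2)[OF assms] cap_pos[OF assms(1), of A] by (auto simp: lyap_def)

lemma lyap_le: "0 < eps \<Longrightarrow> lyap eps A x \<le> cap eps A"
  using cap_pos[of eps A] by (auto simp: lyap_def)

lemma lyap_nonneg: "0 \<le> lyap eps A x"
  by (simp add: lyap_def)

lemma borel_measurable_lyap [measurable]: "lyap eps A \<in> borel_measurable borel"
  unfolding lyap_def[abs_def] by measurable

text \<open>The truncation costs only a second order term: \<open>(C - a)\<^sup>+ \<le> C - a + a\<^sup>2/C\<close>, and on the
  half-line this is beaten by the convexity gain \<open>E a - a\<close>.\<close>

lemma Qop_lyap:
  assumes eps: "0 < eps" and x: "- A \<le> x"
  shows "Qop B (\<lambda>z. ennreal (lyap eps A z)) x + ennreal (drift eps * exp (- eps * x)) \<le>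
    ennreal (lyap eps A x)"
proof -
  let ?N = "\<lambda>y. ennreal (critical_density y)"
  let ?C = "cap eps A" and ?q = "growth eps"
  let ?a = "exp (- eps * x)"
  let ?Q = "Qop B (\<lambda>z. ennreal (lyap eps A z)) x"
  have C: "0 < ?C" using cap_pos[OF eps] .
  have trunc: "max 0 (?C - a) + a \<le> ?C + a\<^sup>2 / ?C" if "0 < a" for a
  proof (cases "a \<le> ?C")
    case True then show ?thesis using C by simp
  next
    case False
    then have "?C * a \<le> a * a" using that by (intro mult_right_mono) auto
    then have "a \<le> a\<^sup>2 / ?C" using C by (simp add: field_simps power2_eq_square)
    with False C show ?thesis by simp
  qed
  have m1: "(\<integral>\<^sup>+y. ?N y * ennreal (exp (- eps * (x + y))) \<partial>lborel) = ennreal (?q * ?a)"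
    using nn_integral_critical_exp[of eps x] by (simp add: growth_def)
  \<comment> \<open>Doubling \<open>eps\<close> raises the growth factor to its fourth power; hence
    the \<open>growth eps ^ 4\<close> in \<open>cap\<close>.\<close>
  have m2: "(\<integral>\<^sup>+y. ?N y * ennreal (exp (- (2 * eps) * (x + y))) \<partial>lborel) = ennreal (?q ^ 4 * ?a\<^sup>2)"
  proof -
    have "exp ((2 * eps)\<^sup>2 * ln 2) = ?q ^ 4"
      by (simp add: growth_def exp_of_nat_mult[symmetric] power2_eq_square mult_ac)
    moreover have "exp (- (2 * eps) * x) = ?a\<^sup>2"
      by (simp add: power2_eq_square exp_add[symmetric])
    ultimately show ?thesis by (subst nn_integral_critical_exp) simp
  qed
  \<comment> \<open>The mean of the subtracted exponential is kept on the left, because subtraction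
    in \<open>ennreal\<close> is truncated.\<close>
  have "?Q + ennreal (?q * ?a) \<le>
      (\<integral>\<^sup>+y. ?N y * ennreal (lyap eps A (x + y)) \<partial>lborel) + (\<integral>\<^sup>+y. ?N y * ennreal (exp (- eps * (x + y))) \<partial>lborel)"
    unfolding m1 by (intro add_right_mono Qop_le_nn_integral)
  also have "\<dots> = (\<integral>\<^sup>+y. ?N y * ennreal (lyap eps A (x + y)) + ?N y * ennreal (exp (- eps * (x + y))) \<partial>lborel)"
    by (rule nn_integral_add[symmetric]) measurable
  also have "\<dots> \<le> (\<integral>\<^sup>+y. ?N y * ennreal ?C + ennreal (1 / ?C) * (?N y * ennreal (exp (- (2 * eps) * (x + y)))) \<partial>lborel)"
  proof (rule nn_integral_mono)
    fix y
    let ?b = "exp (- eps * (x + y))"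
    have b2: "exp (- (2 * eps) * (x + y)) = ?b\<^sup>2"
      by (simp add: power2_eq_square exp_add[symmetric] algebra_simps)
    have "ennreal (lyap eps A (x + y)) + ennreal ?b = ennreal (lyap eps A (x + y) + ?b)"
      by (rule ennreal_plus[symmetric]) (auto simp: lyap_nonneg)
    also have "\<dots> \<le> ennreal (?C + ?b\<^sup>2 / ?C)"
      using trunc[of ?b] by (intro ennreal_leI) (simp add: lyap_def)
    also have "\<dots> = ennreal ?C + ennreal (1 / ?C) * ennreal (?b\<^sup>2)"
      using C by (subst ennreal_plus) (auto simp: ennreal_mult[symmetric])
    finally have "?N y * (ennreal (lyap eps A (x + y)) + ennreal ?b) \<le> ?N y * (ennreal ?C + ennreal (1 / ?C) * ennreal (?b\<^sup>2))"
      by (rule mult_left_mono) simp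
    then show "?N y * ennreal (lyap eps A (x + y)) + ?N y * ennreal ?b \<le>
        ?N y * ennreal ?C + ennreal (1 / ?C) * (?N y * ennreal (exp (- (2 * eps) * (x + y))))"
      unfolding b2 by (simp only: distrib_left mult.left_commute[of "?N y"])
  qed
  also have "\<dots> = (\<integral>\<^sup>+y. ?N y * ennreal ?C \<partial>lborel) +
      ennreal (1 / ?C) * (\<integral>\<^sup>+y. ?N y * ennreal (exp (- (2 * eps) * (x + y))) \<partial>lborel)"
    by (subst nn_integral_add) (auto simp: nn_integral_cmult)
  also have "\<dots> = ennreal (?C + ?q ^ 4 * ?a\<^sup>2 / ?C)"
    unfolding m2 nn_integral_critical_const
    using C growth_gt_1[OF eps] by (subst ennreal_plus) (auto simp: ennreal_mult[symmetric])
  \<comment> \<open>The gain is \<open>2 * drift eps * ?a\<close>; the truncation error uses at most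
    half of it, and the rest is the surplus in the statement.\<close>
  also have "?C + ?q ^ 4 * ?a\<^sup>2 / ?C \<le> lyap eps A x - drift eps * ?a + ?q * ?a"
  proof -
    have "?q ^ 4 * ?a * ?a \<le> ?C * drift eps * ?a"
      using exp_le_cap(1)[OF assms] by (intro mult_right_mono) auto
    then have "?q ^ 4 * ?a\<^sup>2 / ?C \<le> drift eps * ?a"
      using C by (simp add: field_simps power2_eq_square)
    moreover have "?q = 1 + 2 * drift eps" by (simp add: drift_def field_simps)
    then have "?q * ?a = ?a + 2 * (drift eps * ?a)" by (simp add: distrib_right)
    ultimately show ?thesis using lyap_bounds(1)[OF assms] by linarith
  qed
  finally have *: "?Q + ennreal (?q * ?a) \<le> ennreal (lyap eps A x - drift eps * ?a + ?q * ?a)"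
    by (simp add: ennreal_leI)
  have "?Q + ennreal (drift eps * ?a) + ennreal (?q * ?a) =
      (?Q + ennreal (?q * ?a)) + ennreal (drift eps * ?a)" by (simp add: add_ac)
  also have "\<dots> \<le> ennreal (lyap eps A x - drift eps * ?a + ?q * ?a) + ennreal (drift eps * ?a)"
    using * by (rule add_right_mono)
  also have "\<dots> = ennreal (lyap eps A x) + ennreal (?q * ?a)"
  proof -
    have "0 < drift eps * ?a" "0 < ?q * ?a" using drift_pos[OF eps] growth_gt_1[OF eps] by auto
    moreover have "0 \<le> lyap eps A x - drift eps * ?a + ?q * ?a"
      using \<open>?C + ?q ^ 4 * ?a\<^sup>2 / ?C \<le> _\<close> C growth_gt_1[OF eps]
      by (rule_tac order_trans[of _ "?C + ?q ^ 4 * ?a\<^sup>2 / ?C"]) auto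
    ultimately show ?thesis
      using lyap_nonneg[of eps A x] by (simp add: ennreal_plus[symmetric] del: ennreal_plus)
  qed
  finally show ?thesis
    by (simp add: add.commute[of _ "ennreal (?q * ?a)"] ennreal_add_left_cancel_le)
qed

text \<open>Here \<open>z\<^sup>+ \<le> z + e\<^sup>-\<^sup>z\<close>, and the increment of the walk is centred.\<close>

lemma Qop_linear:
  "Qop {- A..} (\<lambda>z. ennreal (z + A)) x \<le> ennreal (x + A + 2 * exp (- A) * exp (- x))"
proof -
  let ?N = "critical_density"
  let ?w = "x + A"
  have tilt: "?N y * exp (- y) = 2 * normal_density (- (2 * ln 2)) (sqrt (2 * ln 2)) y" for y
    using normal_density_exp_tilt[of "sqrt (2 * ln 2)" 0 y 1] by simp
  have "integrable lborel (\<lambda>y. 2 * normal_density (- (2 * ln 2)) (sqrt (2 * ln 2)) y)" by simp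
  then have i3: "integrable lborel (\<lambda>y. ?N y * exp (- y))" by (simp add: tilt)
  have e3: "(\<integral>y. ?N y * exp (- y) \<partial>lborel) = 2" by (simp add: tilt)
  have i2: "integrable lborel (\<lambda>y. ?N y * y)" and e2: "(\<integral>y. ?N y * y \<partial>lborel) = 0"
    by (simp_all add: integrable_normal_moment_nz_1 integral_normal_moment_nz_1)
  let ?g = "\<lambda>y. ?w * ?N y + ?N y * y + exp (- ?w) * (?N y * exp (- y))"
  have i: "integrable lborel ?g" using i2 i3 by simp
  have e: "(\<integral>y. ?g y \<partial>lborel) = ?w + 2 * exp (- ?w)"
    using i2 i3 e2 e3 by simp
  have g: "?g y = ?N y * ((?w + y) + exp (- (?w + y)))" for y
  proof -
    have "exp (- (?w + y)) = exp (- ?w) * exp (- y)" by (simp add: exp_add[symmetric])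
    then show ?thesis by (simp only:) (simp add: algebra_simps)
  qed
  have pos: "0 \<le> z + exp (- z)" for z :: real
    using exp_ge_add_one_self[of "- z"] by linarith
  have "Qop {- A..} (\<lambda>z. ennreal (z + A)) x \<le> (\<integral>\<^sup>+y. ennreal (?g y) \<partial>lborel)"
    unfolding Qop_def
  proof (rule nn_integral_mono)
    fix y
    have "indicator {- A..} (x + y) * ennreal (x + y + A) \<le> ennreal ((?w + y) + exp (- (?w + y)))"
      by (auto simp: indicator_def simp del: ennreal_plus intro!: ennreal_leI)
    then have "ennreal (?N y) * (indicator {- A..} (x + y) * ennreal (x + y + A)) \<le>
        ennreal (?N y) * ennreal ((?w + y) + exp (- (?w + y)))"
      by (rule mult_left_mono) simp
    also have "\<dots> = ennreal (?g y)" unfolding g by (rule ennreal_mult'[symmetric]) simp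
    finally show "ennreal (?N y) * (indicator {- A..} (x + y) * ennreal (x + y + A)) \<le> ennreal (?g y)" .
  qed
  also have "\<dots> = ennreal (\<integral>y. ?g y \<partial>lborel)"
    by (rule nn_integral_eq_integral[OF i], rule AE_I2, unfold g) (intro mult_nonneg_nonneg pos normal_density_nonneg)
  also have "\<dots> = ennreal (x + A + 2 * exp (- A) * exp (- x))"
    unfolding e by (simp add: exp_add[symmetric] algebra_simps)
  finally show ?thesis .
qed

lemma ennreal_le_divide_of_mult_le:
  assumes "ennreal l * S \<le> ennreal c" "0 < l" "0 \<le> c"
  shows "S \<le> ennreal (c / l)"
proof (cases S)
  case (real r)
  with assms show ?thesis
    by (auto simp: ennreal_mult[symmetric] field_simps intro!: ennreal_leI)
next
  case top
  with assms show ?thesis by (simp add: ennreal_mult_top top_unique)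
qed

text \<open>Cut at height \<open>1 / eps\<close>: below it the exponential is at least
  \<open>exp (- 1)\<close>, above it the linear term exceeds 1. The constant 1 is thus dominated by
  two functions whose level means are controlled.\<close>

lemma one_le_exp_plus_linear:
  fixes eps A x :: real
  assumes "0 < eps" "0 \<le> A" "- A \<le> x"
  shows "1 \<le> exp 1 * exp (- eps * x) + eps * (x + A)"
proof (cases "eps * x \<le> 1")
  case True
  then have "1 \<le> exp 1 * exp (- eps * x)" by (simp add: exp_add[symmetric])
  then show ?thesis using assms by (simp add: add_increasing2)
next
  case False
  have "0 \<le> eps * A" "0 \<le> exp 1 * exp (- eps * x)" using assms by auto
  then show ?thesis using False unfolding distrib_left by linarith
qed

text \<open>\<open>growth eps - 1\<close> is at least \<open>eps\<^sup>2 * ln 2\<close> and occurs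
  twice in the denominator, hence the fourth power of \<open>eps\<close>; 64 is 4 times
  \<open>2 ^ 4\<close>, from \<open>growth eps <= 2\<close>.\<close>

lemma cap_div_drift_le:
  assumes "0 < eps" "eps \<le> 1" "0 \<le> A"
  shows "cap eps A / drift eps \<le> 64 * exp A / (ln 2)\<^sup>2 / eps ^ 4"
proof -
  let ?q = "growth eps"
  have e1: "eps\<^sup>2 \<le> 1" using assms power_le_one[of eps 2] by simp
  have "eps\<^sup>2 * ln 2 \<le> ln 2" using mult_right_mono[OF e1, of "ln 2"] by simp
  then have "?q \<le> exp (ln 2)" unfolding growth_def by (simp only: exp_le_cancel_iff)
  then have q2: "?q \<le> 2" by simp
  have q1: "eps\<^sup>2 * ln 2 \<le> ?q - 1"
    unfolding growth_def using exp_ge_add_one_self[of "eps\<^sup>2 * ln 2"] by linarith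
  have "?q ^ 4 \<le> 2 ^ 4" using q2 growth_gt_1[OF assms(1)] by (intro power_mono) auto
  moreover have "exp (eps * A) \<le> exp A" using assms mult_right_mono[of eps 1 A] by simp
  ultimately have n: "4 * (exp (eps * A) * ?q ^ 4) \<le> 4 * (exp A * 2 ^ 4)"
    by (intro mult_left_mono mult_mono) (auto simp: growth_def)
  have d: "(eps\<^sup>2 * ln 2)\<^sup>2 \<le> (?q - 1)\<^sup>2"
    using q1 assms by (intro power_mono) auto
  have "cap eps A / drift eps = 4 * (exp (eps * A) * ?q ^ 4) / (?q - 1)\<^sup>2"
    using growth_gt_1[OF assms(1)] by (simp add: cap_def drift_def power2_eq_square)
  also have "\<dots> \<le> 4 * (exp A * 2 ^ 4) / (eps\<^sup>2 * ln 2)\<^sup>2"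
    using n d assms by (intro frac_le) auto
  also have "\<dots> = 64 * exp A / (ln 2)\<^sup>2 / eps ^ 4"
    by (simp add: power_mult_distrib power_mult[symmetric])
  finally show ?thesis .
qed

section \<open>Green sums and the decay of the survival probability\<close>

context cascade
begin

text \<open>The surplus in \<open>Qop_lyap\<close>, averaged over a level and telescoped over the
  levels: a discrete Dynkin formula.\<close>

lemma level_mean_lyap_decrease:
  assumes "0 < eps"
  shows "ennreal (drift eps) * (\<Sum>k\<in>{n..<n + j}. level_mean {- A..} k (\<lambda>x. ennreal (exp (- eps * x)))) +
     level_mean {- A..} (n + j) (\<lambda>x. ennreal (lyap eps A x)) \<le>
    level_mean {- A..} n (\<lambda>x. ennreal (lyap eps A x))"
proof (induction j)
  case 0
  show ?case by simp
next
  case (Suc j)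
  let ?L = "level_mean {- A..}"
  let ?e = "\<lambda>x. ennreal (exp (- eps * x))" and ?h = "\<lambda>x. ennreal (lyap eps A x)"
  have "ennreal (drift eps) * ?L (n + j) ?e + ?L (Suc (n + j)) ?h =
      ?L (n + j) (\<lambda>x. Qop {- A..} ?h x + ennreal (drift eps) * ?e x)"
    by (subst level_mean_add, simp, measurable)
      (simp add: level_mean_Suc level_mean_cmult add.commute)
  also have "\<dots> \<le> ?L (n + j) ?h"
    using Qop_lyap[OF assms, of A] drift_pos[OF assms]
    by (intro level_mean_mono) (simp add: ennreal_mult[symmetric])
  finally have "ennreal (drift eps) * ?L (n + j) ?e + ?L (Suc (n + j)) ?h \<le> ?L (n + j) ?h" .
  then have "ennreal (drift eps) * (\<Sum>k\<in>{n..<n + j}. ?L k ?e) +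
      (ennreal (drift eps) * ?L (n + j) ?e + ?L (Suc (n + j)) ?h) \<le>
      ennreal (drift eps) * (\<Sum>k\<in>{n..<n + j}. ?L k ?e) + ?L (n + j) ?h"
    by (rule add_left_mono)
  also note Suc.IH
  finally show ?case by (simp add: distrib_left add.assoc)
qed

definition survival :: "real \<Rightarrow> nat \<Rightarrow> ennreal" where
  "survival A n = level_mean {- A..} n (\<lambda>_. 1)"

text \<open>Starting the telescoping at level \<open>n\<close> leaves the mean of a function bounded
  by \<open>cap eps A\<close> over the particles alive there. The tail of the Green sum thus
  inherits the decay of \<open>survival A n\<close>.\<close>

lemma level_mean_green:
  assumes "0 < eps"
  shows "ennreal (drift eps) * (\<Sum>k\<in>{n..<m}. level_mean {- A..} k (\<lambda>x. ennreal (exp (- eps * x)))) \<le>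
    ennreal (cap eps A) * survival A n"
proof (cases "n \<le> m")
  case True
  then obtain j where m: "m = n + j" by (auto simp: le_iff_add)
  have "ennreal (drift eps) * (\<Sum>k\<in>{n..<m}. level_mean {- A..} k (\<lambda>x. ennreal (exp (- eps * x)))) \<le>
      level_mean {- A..} n (\<lambda>x. ennreal (lyap eps A x))"
    using level_mean_lyap_decrease[OF assms, where n=n and j=j and A=A] unfolding m
    by (rule order_trans[OF le_iff_add[THEN iffD2, OF exI, OF refl]])
  also have "\<dots> \<le> level_mean {- A..} n (\<lambda>x. ennreal (cap eps A) * 1)"
    using lyap_le[OF assms] by (intro level_mean_mono) (simp add: ennreal_leI)
  also have "\<dots> = ennreal (cap eps A) * survival A n"
    unfolding survival_def by (rule level_mean_cmult) auto
  finally show ?thesis .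
qed simp

lemma survival_0: "0 \<le> A \<Longrightarrow> survival A 0 = 1"
  by (simp add: survival_def level_mean_0)

lemma survival_antimono: "decseq (survival A)"
proof (rule decseq_SucI)
  fix n
  have "survival A (Suc n) = level_mean {- A..} n (Qop {- A..} (\<lambda>_. 1))"
    unfolding survival_def by (rule level_mean_Suc) auto
  also have "\<dots> \<le> survival A n"
    unfolding survival_def by (intro level_mean_mono Qop_one_le)
  finally show "survival A (Suc n) \<le> survival A n" .
qed

text \<open>The distance to the barrier is a martingale up to the overshoot at killing. Each step
  adds at most a multiple of \<open>exp (- x)\<close>, and the Green bound with
  \<open>eps = 1\<close> keeps the total finite.\<close>

lemma level_mean_linear_bound:
  assumes "0 \<le> A"
  shows "level_mean {- A..} n (\<lambda>x. ennreal (x + A)) \<le>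
    ennreal (A + 2 * exp (- A) * (cap 1 A / drift 1))"
proof -
  let ?L = "level_mean {- A..}"
  let ?e = "\<lambda>x. ennreal (exp (- 1 * x))"
  have "?L n (\<lambda>x. ennreal (x + A)) \<le> ennreal A + ennreal (2 * exp (- A)) * (\<Sum>k\<in>{0..<n}. ?L k ?e)"
  proof (induction n)
    case 0
    then show ?case using assms by (simp add: level_mean_0)
  next
    case (Suc n)
    have "?L (Suc n) (\<lambda>x. ennreal (x + A)) = ?L n (Qop {- A..} (\<lambda>x. ennreal (x + A)))"
      by (rule level_mean_Suc) auto
    also have "\<dots> \<le> ?L n (\<lambda>x. ennreal (x + A) + ennreal (2 * exp (- A)) * ?e x)"
    proof (rule level_mean_mono)
      fix x assume "x \<in> {- A..}"
      then have "ennreal (x + A + 2 * exp (- A) * exp (- x)) = ennreal (x + A) + ennreal (2 * exp (- A)) * ?e x"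
        by (subst ennreal_plus) (auto simp: ennreal_mult[symmetric])
      with Qop_linear[of A x]
      show "Qop {- A..} (\<lambda>x. ennreal (x + A)) x \<le> ennreal (x + A) + ennreal (2 * exp (- A)) * ?e x"
        by simp
    qed
    also have "\<dots> = ?L n (\<lambda>x. ennreal (x + A)) + ?L n (\<lambda>x. ennreal (2 * exp (- A)) * ?e x)"
      by (rule level_mean_add) auto
    also have "?L n (\<lambda>x. ennreal (2 * exp (- A)) * ?e x) = ennreal (2 * exp (- A)) * ?L n ?e"
      by (rule level_mean_cmult) auto
    also have "?L n (\<lambda>x. ennreal (x + A)) + ennreal (2 * exp (- A)) * ?L n ?e \<le>
        ennreal A + ennreal (2 * exp (- A)) * (\<Sum>k\<in>{0..<n}. ?L k ?e) + ennreal (2 * exp (- A)) * ?L n ?e"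
      using Suc.IH by (rule add_right_mono)
    finally show ?case by (simp add: distrib_left add.assoc)
  qed
  also have "(\<Sum>k\<in>{0..<n}. ?L k ?e) \<le> ennreal (cap 1 A / drift 1)"
  proof (rule ennreal_le_divide_of_mult_le)
    show "ennreal (drift 1) * (\<Sum>k\<in>{0..<n}. ?L k ?e) \<le> ennreal (cap 1 A)"
      using level_mean_green[where eps=1 and n=0 and m=n and A=A] survival_0[OF assms] by simp
  qed (use drift_pos[of 1] cap_pos[of 1 A] in auto)
  finally have "?L n (\<lambda>x. ennreal (x + A)) \<le> ennreal A + ennreal (2 * exp (- A)) * ennreal (cap 1 A / drift 1)"
    by (simp add: mult_left_mono add_left_mono)
  also have "\<dots> = ennreal (A + 2 * exp (- A) * (cap 1 A / drift 1))"
    using assms drift_pos[of 1] cap_pos[of 1 A]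
    by (subst ennreal_plus) (auto simp: ennreal_mult[symmetric])
  finally show ?thesis .
qed

text \<open>The exponent \<open>1/5\<close> balances \<open>eps\<^sup>-\<^sup>4 / n\<close> against \<open>eps\<close>.\<close>

lemma survival_le:
  assumes A: "0 \<le> A"
  shows "\<exists>K>0. \<forall>n\<ge>1. survival A n \<le> ennreal (K * real n powr (- 1 / 5))"
proof -
  define D where "D = A + 2 * exp (- A) * (cap 1 A / drift 1)"
  define E where "E = exp 1 * (64 * exp A / (ln 2)\<^sup>2)"
  have D: "0 \<le> D" using A drift_pos[of 1] cap_pos[of 1 A] by (simp add: D_def)
  have E: "0 < E" by (simp add: E_def)
  let ?L = "level_mean {- A..}"
  have "survival A n \<le> ennreal ((E + D) * real n powr (- 1 / 5))" if n: "n \<ge> 1" for n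
  proof -
    define eps where "eps = real n powr (- 1 / 5)"
    have eps: "0 < eps" "eps \<le> 1" using n powr_mono[of "- 1 / 5" 0 "real n"] by (auto simp: eps_def)
    have eps4: "1 / eps ^ 4 = real n * eps"
    proof -
      have "eps ^ 5 = real n powr (real 5 * (- 1 / 5))"
        unfolding eps_def by (rule powr_power) (use n in auto)
      then have "eps ^ 5 = 1 / real n" using n by (simp add: powr_minus_divide)
      moreover have "eps ^ 5 = eps ^ 4 * eps" by (simp add: eval_nat_numeral)
      ultimately show ?thesis using eps n by (simp add: field_simps)
    qed
    let ?e = "\<lambda>x. ennreal (exp (- eps * x))" and ?l = "\<lambda>x. ennreal (x + A)"
    \<comment> \<open>Monotonicity replaces the survival at time \<open>n\<close> by an average over
      earlier times, to which the Green sums apply.\<close>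
    have "of_nat n * survival A n = (\<Sum>k\<in>{0..<n}. survival A n)" by simp
    also have "\<dots> \<le> (\<Sum>k\<in>{0..<n}. survival A k)"
      using survival_antimono by (intro sum_mono) (auto simp: decseq_def)
    also have "\<dots> \<le> (\<Sum>k\<in>{0..<n}. ennreal (exp 1) * ?L k ?e + ennreal eps * ?L k ?l)"
    proof (rule sum_mono)
      fix k
      have "survival A k \<le> ?L k (\<lambda>x. ennreal (exp 1) * ?e x + ennreal eps * ?l x)"
        unfolding survival_def
      proof (rule level_mean_mono)
        fix x assume x: "x \<in> {- A..}"
        have "ennreal (exp 1) * ?e x + ennreal eps * ?l x = ennreal (exp 1 * exp (- eps * x) + eps * (x + A))"
          using x eps by (subst ennreal_plus) (auto simp: ennreal_mult[symmetric])
        then show "1 \<le> ennreal (exp 1) * ?e x + ennreal eps * ?l x"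
          using one_le_exp_plus_linear[OF eps(1) A, of x] x by (simp add: ennreal_leI)
      qed
      also have "\<dots> = ?L k (\<lambda>x. ennreal (exp 1) * ?e x) + ?L k (\<lambda>x. ennreal eps * ?l x)"
        by (rule level_mean_add) auto
      also have "?L k (\<lambda>x. ennreal (exp 1) * ?e x) = ennreal (exp 1) * ?L k ?e"
        by (rule level_mean_cmult) auto
      also have "?L k (\<lambda>x. ennreal eps * ?l x) = ennreal eps * ?L k ?l"
        by (rule level_mean_cmult) auto
      finally show "survival A k \<le> ennreal (exp 1) * ?L k ?e + ennreal eps * ?L k ?l" .
    qed
    also have "\<dots> = ennreal (exp 1) * (\<Sum>k\<in>{0..<n}. ?L k ?e) + ennreal eps * (\<Sum>k\<in>{0..<n}. ?L k ?l)"
      by (simp add: sum.distrib sum_distrib_left)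
    also have "\<dots> \<le> ennreal (exp 1) * ennreal (cap eps A / drift eps) + ennreal eps * (of_nat n * ennreal D)"
    proof (intro add_mono mult_left_mono)
      show "(\<Sum>k\<in>{0..<n}. ?L k ?e) \<le> ennreal (cap eps A / drift eps)"
      proof (rule ennreal_le_divide_of_mult_le)
        show "ennreal (drift eps) * (\<Sum>k\<in>{0..<n}. ?L k ?e) \<le> ennreal (cap eps A)"
          using level_mean_green[OF eps(1), where n=0 and m=n and A=A] survival_0[OF A] by simp
      qed (use drift_pos[OF eps(1)] cap_pos[OF eps(1), of A] in auto)
      show "(\<Sum>k\<in>{0..<n}. ?L k ?l) \<le> of_nat n * ennreal D"
        using sum_bounded_above[of "{0..<n}" "\<lambda>k. ?L k ?l" "ennreal D"]
          level_mean_linear_bound[OF A] by (simp add: D_def)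
    qed auto
    also have "\<dots> = ennreal (exp 1 * (cap eps A / drift eps) + eps * (real n * D))"
      using eps D drift_pos[OF eps(1)] cap_pos[OF eps(1), of A]
      by (simp add: ennreal_of_nat_eq_real_of_nat ennreal_mult[symmetric] ennreal_plus[symmetric]
          del: ennreal_plus)
    also have "\<dots> \<le> ennreal (real n * ((E + D) * eps))"
    proof (rule ennreal_leI)
      have "exp 1 * (cap eps A / drift eps) \<le> exp 1 * (64 * exp A / (ln 2)\<^sup>2 / eps ^ 4)"
        using cap_div_drift_le[OF eps A] by (intro mult_left_mono) auto
      also have "\<dots> = E * (1 / eps ^ 4)" by (simp add: E_def)
      finally show "exp 1 * (cap eps A / drift eps) + eps * (real n * D) \<le> real n * ((E + D) * eps)"
        unfolding eps4 by (simp add: algebra_simps)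
    qed
    finally have "ennreal (real n) * survival A n \<le> ennreal (real n * ((E + D) * eps))"
      by (simp add: ennreal_of_nat_eq_real_of_nat)
    then have "survival A n \<le> ennreal (real n * ((E + D) * eps) / real n)"
      by (rule ennreal_le_divide_of_mult_le) (use n D E eps in auto)
    then show ?thesis using n by (simp add: eps_def)
  qed
  then show ?thesis using D E by (intro exI[of _ "E + D"]) auto
qed

lemma level_mean_tail_le:
  assumes A: "0 \<le> A" and \<kappa>: "0 < \<kappa>"
  shows "\<exists>K>0. \<forall>n\<ge>1. \<forall>m. (\<Sum>k\<in>{n..<m}. level_mean {- A..} k (\<lambda>x. ennreal (exp (- \<kappa> * x)))) \<le>
    ennreal (K * real n powr (- 1 / 5))"
proof -
  from survival_le[OF A] obtain K where K: "K > 0"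
    "\<And>n. n \<ge> 1 \<Longrightarrow> survival A n \<le> ennreal (K * real n powr (- 1 / 5))" by blast
  have d: "0 < drift \<kappa>" "0 < cap \<kappa> A" using drift_pos cap_pos \<kappa> by auto
  have "(\<Sum>k\<in>{n..<m}. level_mean {- A..} k (\<lambda>x. ennreal (exp (- \<kappa> * x)))) \<le>
      ennreal (cap \<kappa> A * (K * real n powr (- 1 / 5)) / drift \<kappa>)" if "n \<ge> 1" for n m
  proof (rule ennreal_le_divide_of_mult_le)
    have "ennreal (drift \<kappa>) * (\<Sum>k\<in>{n..<m}. level_mean {- A..} k (\<lambda>x. ennreal (exp (- \<kappa> * x)))) \<le>
        ennreal (cap \<kappa> A) * survival A n"
      by (rule level_mean_green[OF \<kappa>])
    also have "\<dots> \<le> ennreal (cap \<kappa> A) * ennreal (K * real n powr (- 1 / 5))"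
      by (intro mult_left_mono K that) simp
    finally show "ennreal (drift \<kappa>) * (\<Sum>k\<in>{n..<m}. level_mean {- A..} k (\<lambda>x. ennreal (exp (- \<kappa> * x)))) \<le>
        ennreal (cap \<kappa> A * (K * real n powr (- 1 / 5)))"
      using d K(1) by (simp add: ennreal_mult)
  qed (use d K in auto)
  then show ?thesis using K d by (intro exI[of _ "cap \<kappa> A * K / drift \<kappa>"]) (auto simp: mult.assoc)
qed

end

subsection \<open>Almost sure bounds along the tree\<close>

text \<open>A left-endpoint Riemann sum for the integral of \<open>exp (- c * G)\<close> with
  respect to \<open>G\<close>, which is at most \<open>1 / c\<close>; moving from left to right
  endpoints costs the factor \<open>exp (c * b)\<close>.\<close>

lemma telescoping_exp_sum:
  fixes x :: "nat \<Rightarrow> real"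
  assumes "0 < c" and x: "\<And>j. j \<le> n \<Longrightarrow> 0 \<le> x j \<and> x j \<le> b"
  shows "(\<Sum>j\<le>n. x j * exp (- c * (\<Sum>i<j. x i))) \<le> exp (c * b) / c"
proof -
  let ?G = "\<lambda>j. \<Sum>i<j. x i"
  have "x j * exp (- c * ?G j) \<le> exp (c * b) / c * (exp (- c * ?G j) - exp (- c * ?G (Suc j)))"
    if "j \<le> n" for j
  proof -
    have xj: "0 \<le> x j" "x j \<le> b" using x[OF that] by auto
    have "exp (- c * ?G j) = exp (c * x j) * exp (- c * ?G (Suc j))"
      by (simp add: exp_add[symmetric] algebra_simps)
    then have e: "exp (- c * ?G j) - exp (- c * ?G (Suc j)) = (exp (c * x j) - 1) * exp (- c * ?G (Suc j))"
      by (simp add: algebra_simps)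
    have "c * x j \<le> exp (c * x j) - 1" using exp_ge_add_one_self[of "c * x j"] by linarith
    then have "c * x j * exp (- c * ?G (Suc j)) \<le> (exp (c * x j) - 1) * exp (- c * ?G (Suc j))"
      by (rule mult_right_mono) simp
    then have 1: "x j * exp (- c * ?G (Suc j)) \<le> (exp (- c * ?G j) - exp (- c * ?G (Suc j))) / c"
      unfolding e using assms(1) by (simp add: field_simps)
    have "x j * exp (- c * ?G j) = exp (c * x j) * (x j * exp (- c * ?G (Suc j)))"
      by (simp add: exp_add[symmetric] algebra_simps)
    also have "\<dots> \<le> exp (c * b) * (x j * exp (- c * ?G (Suc j)))"
      using xj assms(1) by (intro mult_right_mono) auto
    also have "\<dots> \<le> exp (c * b) * ((exp (- c * ?G j) - exp (- c * ?G (Suc j))) / c)"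
      using 1 by (intro mult_left_mono) auto
    finally show ?thesis by simp
  qed
  then have "(\<Sum>j\<le>n. x j * exp (- c * ?G j)) \<le>
      (\<Sum>j\<le>n. exp (c * b) / c * (exp (- c * ?G j) - exp (- c * ?G (Suc j))))"
    by (intro sum_mono) auto
  also have "\<dots> = exp (c * b) / c * (\<Sum>j<Suc n. exp (- c * ?G j) - exp (- c * ?G (Suc j)))"
    by (simp only: sum_distrib_left lessThan_Suc_atMost)
  also have "(\<Sum>j<Suc n. exp (- c * ?G j) - exp (- c * ?G (Suc j))) = 1 - exp (- c * ?G (Suc n))"
    by (subst sum_lessThan_telescope') simp
  also have "exp (c * b) / c * (1 - exp (- c * ?G (Suc n))) \<le> exp (c * b) / c * 1"
    using assms(1) by (intro mult_left_mono) auto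
  finally show ?thesis by simp
qed

context cascade
begin

text \<open>The last position is left out, so the product at a child is determined by the past of
  that child.\<close>

definition path_prod :: "(real \<Rightarrow> ennreal) \<Rightarrow> bool list \<Rightarrow> 'a \<Rightarrow> ennreal" where
  "path_prod r u w = (\<Prod>j<length u. r (V (take j u) w))"

lemma path_prod_snoc: "path_prod r (u @ [b]) w = path_prod r u w * r (V u w)"
  by (simp add: path_prod_def)

lemma measurable_path_prod_upto:
  assumes [measurable]: "r \<in> borel_measurable borel"
  shows "path_prod r u \<in> borel_measurable (hist_upto (length u))"
  unfolding path_prod_def
proof (intro borel_measurable_prod_ennreal)
  fix j
  have [measurable]: "V (take j u) \<in> borel_measurable (hist_upto (length u))"
    by (rule measurable_V_upto) simp
  show "(\<lambda>w. r (V (take j u) w)) \<in> borel_measurable (hist_upto (length u))" by measurable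
qed

lemma sets_weight_event:
  assumes "B \<in> sets borel" "f \<in> borel_measurable borel" "r \<in> borel_measurable borel"
  shows "{w\<in>space M. \<exists>u. n \<le> length u \<and> 1 \<le> weight B u w * (path_prod r u w * f (V u w))} \<in> sets M"
proof -
  have "(\<lambda>w. weight B u w * (path_prod r u w * f (V u w))) \<in> borel_measurable M" for u
    by (intro borel_measurable_times_ennreal measurable_weight assms
        measurable_from_hist[OF words_upto_nonempty measurable_path_prod_upto]
        measurable_compose[OF measurable_V])
  note [measurable] = this
  show ?thesis by measurable
qed

text \<open>\<open>r\<close> is a Feynman-Kac potential: the condition \<open>super\<close> says
  that \<open>f\<close> is excessive for the killed walk reweighted by \<open>r\<close>, which makes
  the level sums a supermartingale. The product along the path is absorbed into the test
  variable.\<close>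

lemma ville_weight:
  fixes f r :: "real \<Rightarrow> ennreal"
  assumes B: "B \<in> sets borel" and f: "f \<in> borel_measurable borel" and r: "r \<in> borel_measurable borel"
    and super: "\<And>x. x \<in> B \<Longrightarrow> r x * Qop B f x \<le> f x"
  shows "emeasure M {w\<in>space M. \<exists>u. n \<le> length u \<and> 1 \<le> weight B u w * (path_prod r u w * f (V u w))} \<le>
    (\<Sum>u\<in>{u. length u = n}. \<integral>\<^sup>+w. weight B u w * (path_prod r u w * f (V u w)) \<partial>M)"
proof (rule ville)
  fix u :: "bool list"
  note f [measurable] r [measurable]
  note [measurable] = measurable_weight_upto[OF order_refl B] measurable_V_upto[OF order_refl]
    measurable_path_prod_upto[OF r]
  show "(\<lambda>w. weight B u w * (path_prod r u w * f (V u w))) \<in> borel_measurable (hist_upto (length u))"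
    by measurable
  fix Y :: "'a \<Rightarrow> ennreal" assume Y [measurable]: "Y \<in> borel_measurable (hist_upto (length u))"
  let ?Y = "\<lambda>w. Y w * (path_prod r u w * r (V u w))"
  have Ym: "?Y \<in> borel_measurable (hist_upto (length u))" by measurable
  have "(\<Sum>b\<in>UNIV. \<integral>\<^sup>+w. Y w * (weight B (u @ [b]) w * (path_prod r (u @ [b]) w * f (V (u @ [b]) w))) \<partial>M) =
      (\<Sum>b\<in>UNIV. \<integral>\<^sup>+w. ?Y w * (weight B (u @ [b]) w * f (V (u @ [b]) w)) \<partial>M)"
    by (intro sum.cong nn_integral_cong refl) (simp add: path_prod_snoc mult_ac)
  also have "\<dots> = (\<integral>\<^sup>+w. ?Y w * (weight B u w * Qop B f (V u w)) \<partial>M)"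
    by (rule weight_step[OF Ym B f])
  also have "\<dots> \<le> (\<integral>\<^sup>+w. Y w * (weight B u w * (path_prod r u w * f (V u w))) \<partial>M)"
  proof (rule nn_integral_mono)
    fix w
    show "?Y w * (weight B u w * Qop B f (V u w)) \<le>
        Y w * (weight B u w * (path_prod r u w * f (V u w)))"
    proof (cases "alive B u w")
      case True
      have "?Y w * (weight B u w * Qop B f (V u w)) =
          Y w * weight B u w * path_prod r u w * (r (V u w) * Qop B f (V u w))"
        by (simp add: mult_ac)
      also have "\<dots> \<le> Y w * weight B u w * path_prod r u w * f (V u w)"
        by (rule mult_left_mono[OF super[OF alive_V[OF True]]]) simp
      finally show ?thesis by (simp add: mult_ac)
    next
      case False
      then show ?thesis by (simp add: weight_def)
    qed
  qed
  finally show "(\<Sum>b\<in>UNIV. \<integral>\<^sup>+w. Y w * (weight B (u @ [b]) w * (path_prod r (u @ [b]) w * f (V (u @ [b]) w))) \<partial>M) \<le>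
      (\<integral>\<^sup>+w. Y w * (weight B u w * (path_prod r u w * f (V u w))) \<partial>M)" .
qed

lemma path_prod_one [simp]: "path_prod (\<lambda>_. 1) u w = 1"
  by (simp add: path_prod_def)

lemma AE_exists_not_in:
  fixes E :: "nat \<Rightarrow> 'a set"
  assumes E: "\<And>k. E k \<in> sets M" and le: "\<And>k. emeasure M (E k) \<le> ennreal (e k)"
    and lim: "e \<longlonglongrightarrow> 0"
  shows "AE w in M. \<exists>k. w \<notin> E k"
proof (rule AE_I)
  show "{w \<in> space M. \<not> (\<exists>k. w \<notin> E k)} \<subseteq> (\<Inter>k. E k)" by auto
  show "(\<Inter>k. E k) \<in> sets M" using E by auto
  have "emeasure M (\<Inter>k. E k) \<le> ennreal (e k)" for k
    using emeasure_mono[of "\<Inter>k. E k" "E k" M] E le[of k] by (meson INT_lower UNIV_I order_trans)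
  moreover have "(\<lambda>k. ennreal (e k)) \<longlonglongrightarrow> ennreal 0" using lim by (rule tendsto_ennrealI)
  ultimately have "emeasure M (\<Inter>k. E k) \<le> ennreal 0"
    by (intro tendsto_lowerbound[where f="\<lambda>k. ennreal (e k)"]) auto
  then show "emeasure M (\<Inter>k. E k) = 0" by simp
qed

text \<open>With no killing and constant \<open>f\<close> the level sums form the critical additive
  martingale, of mean 1. Ville's inequality at height \<open>exp A\<close> bounds by
  \<open>exp (- A)\<close> the probability that some particle falls to \<open>- A\<close>.\<close>

lemma AE_barrier: "AE w in M. \<exists>A::nat. \<forall>u. alive {- real A..} u w"
proof -
  define E where "E A = {w\<in>space M. \<exists>u. 0 \<le> length u \<and>
     1 \<le> weight UNIV u w * (path_prod (\<lambda>_. 1) u w * ennreal (exp (- real A)))}" for A :: nat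
  have "AE w in M. \<exists>A. w \<notin> E A"
  proof (rule AE_exists_not_in)
    show "E A \<in> sets M" for A unfolding E_def by (rule sets_weight_event) auto
    show "emeasure M (E A) \<le> ennreal (exp (- real A))" for A
    proof -
      have "emeasure M (E A) \<le> (\<Sum>u\<in>{u. length u = 0}. \<integral>\<^sup>+w. weight UNIV u w *
          (path_prod (\<lambda>_. 1) u w * ennreal (exp (- real A))) \<partial>M)"
        unfolding E_def
      proof (rule ville_weight)
        fix x :: real
        have "Qop UNIV (\<lambda>_. ennreal (exp (- real A))) x \<le> ennreal (exp (- real A))"
          using Qop_le_nn_integral[of UNIV "\<lambda>_. ennreal (exp (- real A))" x]
            nn_integral_critical_const[of "ennreal (exp (- real A))"] by simp
        then show "1 * Qop UNIV (\<lambda>_. ennreal (exp (- real A))) x \<le> ennreal (exp (- real A))" by simp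
      qed auto
      then show ?thesis by (simp add: weight_Nil emeasure_space_1)
    qed
    show "(\<lambda>A. exp (- real A)) \<longlonglongrightarrow> 0" by real_asymp
  qed
  then show ?thesis
  proof (rule AE_mp, intro AE_I2 impI)
    fix w assume w: "w \<in> space M" and "\<exists>A. w \<notin> E A"
    then obtain A where A: "w \<notin> E A" by blast
    have "- real A \<le> V u w" for u
    proof -
      have "weight UNIV u w * ennreal (exp (- real A)) < 1"
        using A w by (simp add: E_def not_le)
      then have "exp (- V u w) * exp (- real A) < 1"
        by (simp add: weight_def ennreal_mult[symmetric])
      then have "exp (- V u w - real A) < exp 0"
        by (simp add: exp_diff exp_minus field_simps)
      then show ?thesis by (simp only: exp_less_cancel_iff)
    qed
    then show "\<exists>A::nat. \<forall>u. alive {- real A..} u w" by (auto simp: alive_def)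
  qed
qed

text \<open>The level of the barrier is random; restricting it to integers leaves countably many
  exceptional null sets.\<close>

lemma AE_barrier_imp:
  assumes "\<And>A. 0 \<le> A \<Longrightarrow> AE w in M. P A w"
  shows "AE w in M. \<exists>A\<ge>0. (\<forall>u. alive {- A..} u w) \<and> P A w"
proof -
  have "AE w in M. \<forall>A::nat. P (real A) w"
    using assms by (simp add: AE_all_countable)
  with AE_barrier show ?thesis
    by eventually_elim (metis of_nat_0_le_iff)
qed

text \<open>Ville's inequality is started at level \<open>2 ^ k\<close>, where the total mean weight
  is the survival probability, of order \<open>2 powr (- k / 5)\<close>. Half of this exponent is
  spent on the threshold and half is left for Borel-Cantelli.\<close>

lemma AE_low_particles_alive:
  assumes A: "0 \<le> A"
  shows "AE w in M. \<forall>\<^sub>F k in sequentially. \<forall>u. 2 ^ k \<le> length u \<longrightarrow> alive {- A..} u w \<longrightarrow>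
    exp (- V u w) < 2 powr (- real k / 10)"
proof -
  let ?B = "{- A..}"
  from survival_le[OF A] obtain K where K: "K > 0"
    "\<And>n. n \<ge> 1 \<Longrightarrow> survival A n \<le> ennreal (K * real n powr (- 1 / 5))" by blast
  define E where "E k = {w\<in>space M. \<exists>u. 2 ^ k \<le> length u \<and>
     1 \<le> weight ?B u w * (path_prod (\<lambda>_. 1) u w * ennreal (2 powr (real k / 10)))}" for k :: nat
  have E [measurable]: "E k \<in> sets M" for k unfolding E_def by (rule sets_weight_event) auto
  have le: "emeasure M (E k) \<le> ennreal (K * 2 powr (- real k / 10))" for k
  proof -
    have "emeasure M (E k) \<le> (\<Sum>u\<in>{u. length u = 2 ^ k}. \<integral>\<^sup>+w. weight ?B u w *
        (path_prod (\<lambda>_. 1) u w * ennreal (2 powr (real k / 10))) \<partial>M)"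
      unfolding E_def
    proof (rule ville_weight)
      fix x :: real
      show "1 * Qop ?B (\<lambda>_. ennreal (2 powr (real k / 10))) x \<le> ennreal (2 powr (real k / 10))"
        using Qop_le_nn_integral[of ?B "\<lambda>_. ennreal (2 powr (real k / 10))" x]
          nn_integral_critical_const[of "ennreal (2 powr (real k / 10))"] by simp
    qed auto
    also have "\<dots> = level_mean ?B (2 ^ k) (\<lambda>_. ennreal (2 powr (real k / 10)) * 1)"
      by (simp add: level_mean_def)
    also have "\<dots> = ennreal (2 powr (real k / 10)) * survival A (2 ^ k)"
      unfolding survival_def by (rule level_mean_cmult) auto
    also have "\<dots> \<le> ennreal (2 powr (real k / 10)) * ennreal (K * real (2 ^ k) powr (- 1 / 5))"
      by (intro mult_left_mono K(2)) auto
    also have "\<dots> = ennreal (K * 2 powr (- real k / 10))"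
    proof -
      have "real (2 ^ k) powr (- 1 / 5) = 2 powr (- real k / 5)"
        by (simp add: powr_realpow[symmetric] powr_powr)
      then have "2 powr (real k / 10) * (K * real (2 ^ k) powr (- 1 / 5)) = K * 2 powr (real k / 10 - real k / 5)"
        by (simp add: powr_add[symmetric] mult.left_commute)
      also have "real k / 10 - real k / 5 = - real k / 10" by simp
      finally show ?thesis using K(1) by (subst ennreal_mult[symmetric]) auto
    qed
    finally show ?thesis .
  qed
  have "AE w in M. \<forall>\<^sub>F k in sequentially. w \<in> space M - E k"
  proof (rule borel_cantelli_AE1)
    show "emeasure M (E k) < \<infinity>" for k by (simp add: emeasure_eq_measure)
    have s: "summable (\<lambda>k. K * 2 powr (- real k / 10))"
    proof -
      have "2 powr (- real k / 10) = (2 powr (- 1 / 10)) ^ k" for k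
        by (simp add: powr_power)
      then show ?thesis
        using powr_less_mono[of "- 1 / 10" 0 2] by (simp add: summable_mult summable_geometric)
    qed
    show "summable (\<lambda>k. measure M (E k))"
      using le K(1) by (intro summable_comparison_test'[OF s, of 0]) (simp add: emeasure_eq_measure)
  qed measurable
  then show ?thesis
  proof (rule AE_mp, intro AE_I2 impI)
    fix w assume w: "w \<in> space M" and ev: "\<forall>\<^sub>F k in sequentially. w \<in> space M - E k"
    from ev show "\<forall>\<^sub>F k in sequentially. \<forall>u. 2 ^ k \<le> length u \<longrightarrow> alive ?B u w \<longrightarrow>
      exp (- V u w) < 2 powr (- real k / 10)"
    proof (rule eventually_mono, intro allI impI)
      fix k and u :: "bool list"
      assume k: "w \<in> space M - E k" "2 ^ k \<le> length u" "alive ?B u w"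
      then have "weight ?B u w * ennreal (2 powr (real k / 10)) < 1"
        using w by (simp add: E_def not_le) (metis not_le)
      then have "exp (- V u w) * 2 powr (real k / 10) < 1"
        using k by (simp add: weight_def ennreal_mult[symmetric])
      then show "exp (- V u w) < 2 powr (- real k / 10)"
        by (simp add: powr_minus field_simps)
    qed
  qed
qed

lemma AE_low_particles:
  "AE w in M. \<forall>\<^sub>F k in sequentially. \<forall>u. 2 ^ k \<le> length u \<longrightarrow>
    exp (- V u w) < 2 powr (- real k / 10)"
proof -
  have "AE w in M. \<exists>A\<ge>0. (\<forall>u. alive {- A..} u w) \<and>
      (\<forall>\<^sub>F k in sequentially. \<forall>u. 2 ^ k \<le> length u \<longrightarrow> alive {- A..} u w \<longrightarrow>
    exp (- V u w) < 2 powr (- real k / 10))"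
    by (rule AE_barrier_imp) (rule AE_low_particles_alive)
  then show ?thesis by eventually_elim auto
qed

text \<open>Since \<open>Qop_lyap\<close> leaves a surplus \<open>drift eps * exp (- eps x)\<close>, the Lyapunov supermartingale may be
  multiplied by the exponential of the additive functional \<open>\<Sum> exp (- eps V)\<close> along the path.\<close>

lemma AE_additive_functional:
  assumes A: "0 \<le> A" and eps: "0 < eps"
  shows "AE w in M. \<exists>Y. \<forall>u. alive {- A..} u w \<longrightarrow>
    drift eps / cap eps A * (\<Sum>j<length u. exp (- eps * V (take j u) w)) \<le> V u w + Y"
proof -
  let ?B = "{- A..}" and ?l = "drift eps / cap eps A"
  let ?r = "\<lambda>x. ennreal (exp (?l * exp (- eps * x)))"
  have C: "0 < cap eps A" and d: "0 < drift eps" using cap_pos drift_pos eps by auto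
  \<comment> \<open>The scale \<open>1 / Suc k\<close> places the threshold at \<open>Suc k\<close>,
    so Ville's bound \<open>cap eps A / Suc k\<close> tends to 0.\<close>
  let ?f = "\<lambda>(k::nat) x. ennreal (1 / Suc k) * ennreal (lyap eps A x)"
  define E where "E k = {w\<in>space M. \<exists>u. 0 \<le> length u \<and>
     1 \<le> weight ?B u w * (path_prod ?r u w * ?f k (V u w))}" for k :: nat
  have "AE w in M. \<exists>k. w \<notin> E k"
  proof (rule AE_exists_not_in)
    show "E k \<in> sets M" for k unfolding E_def by (rule sets_weight_event) auto
    show "emeasure M (E k) \<le> ennreal (cap eps A / Suc k)" for k
    proof -
      have "emeasure M (E k) \<le> (\<Sum>u\<in>{u. length u = 0}. \<integral>\<^sup>+w. weight ?B u w *
          (path_prod ?r u w * ?f k (V u w)) \<partial>M)"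
        unfolding E_def
      proof (rule ville_weight)
        fix x assume "x \<in> ?B"
        then have x: "- A \<le> x" by simp
        let ?e = "exp (- eps * x)" and ?Q = "Qop ?B (\<lambda>z. ennreal (lyap eps A z)) x"
        have "?Q + ennreal (drift eps * ?e) \<le> ennreal (lyap eps A x)" by (rule Qop_lyap[OF eps x])
        then have "?Q \<le> ennreal (lyap eps A x) - ennreal (drift eps * ?e)"
          by (metis ennreal_le_minus_iff)
        also have "\<dots> = ennreal (lyap eps A x - drift eps * ?e)"
          using d by (intro ennreal_minus) simp
        \<comment> \<open>\<open>1 - y <= exp (- y)\<close> turns the additive surplus into a
          multiplicative one; since \<open>lyap\<close> is at most \<open>cap\<close>, the rate
          \<open>drift eps / cap eps A\<close> is affordable.\<close>
        also have "\<dots> \<le> ennreal (lyap eps A x * exp (- ?l * ?e))"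
        proof (rule ennreal_leI)
          have "lyap eps A x * (?l * ?e) \<le> cap eps A * (?l * ?e)"
            using lyap_le[OF eps] C d by (intro mult_right_mono) auto
          also have "\<dots> = drift eps * ?e" using C by simp
          finally have "lyap eps A x - drift eps * ?e \<le> lyap eps A x * (1 + - ?l * ?e)"
            by (simp add: algebra_simps)
          also have "\<dots> \<le> lyap eps A x * exp (- ?l * ?e)"
            by (intro mult_left_mono exp_ge_add_one_self lyap_nonneg)
          finally show "lyap eps A x - drift eps * ?e \<le> lyap eps A x * exp (- ?l * ?e)" .
        qed
        finally have Q: "?Q \<le> ennreal (lyap eps A x * exp (- ?l * ?e))" .
        have "?r x * ?Q \<le> ?r x * ennreal (lyap eps A x * exp (- ?l * ?e))"
          by (rule mult_left_mono[OF Q]) simp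
        also have "\<dots> = ennreal (lyap eps A x)"
          using lyap_nonneg[of eps A x]
          by (subst ennreal_mult[symmetric]) (auto simp: mult.left_commute exp_add[symmetric])
        finally have rQ: "?r x * ?Q \<le> ennreal (lyap eps A x)" .
        have "Qop ?B (?f k) x = ennreal (1 / Suc k) * ?Q"
          unfolding Qop_def
          by (subst nn_integral_cmult[symmetric]) (auto intro!: nn_integral_cong simp: mult_ac)
        then have "?r x * Qop ?B (?f k) x = ennreal (1 / Suc k) * (?r x * ?Q)"
          by (simp only: mult.left_commute)
        also have "\<dots> \<le> ?f k x" by (rule mult_left_mono[OF rQ]) simp
        finally show "?r x * Qop ?B (?f k) x \<le> ?f k x" .
      qed auto
      also have "\<dots> \<le> ennreal (1 / Suc k) * ennreal (cap eps A)"
        using A lyap_le[OF eps, of A 0]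
        by (auto simp: weight_Nil emeasure_space_1 path_prod_def intro!: mult_left_mono ennreal_leI)
      also have "\<dots> = ennreal (cap eps A / Suc k)"
        using C by (subst ennreal_mult[symmetric]) auto
      finally show ?thesis .
    qed
    show "(\<lambda>k. cap eps A / Suc k) \<longlonglongrightarrow> 0" by real_asymp
  qed
  then show ?thesis
  proof (rule AE_mp, intro AE_I2 impI)
    fix w assume w: "w \<in> space M" and "\<exists>k. w \<notin> E k"
    then obtain k where k: "w \<notin> E k" by blast
    let ?G = "\<lambda>u. \<Sum>j<length u. exp (- eps * V (take j u) w)"
    have "?l * ?G u \<le> V u w + ln (2 * Suc k / cap eps A)" if al: "alive ?B u w" for u
    proof -
      have "path_prod ?r u w = ennreal (exp (?l * ?G u))"
        unfolding path_prod_def by (simp add: prod_ennreal sum_distrib_left exp_sum)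
      moreover have "weight ?B u w * (path_prod ?r u w * ?f k (V u w)) < 1"
        using k w by (simp add: E_def not_le)
      ultimately have "exp (- V u w) * (exp (?l * ?G u) * (1 / Suc k * lyap eps A (V u w))) < 1"
        using al lyap_nonneg[of eps A "V u w"]
        by (simp add: weight_def ennreal_mult[symmetric] del: of_nat_Suc)
      moreover have "exp (- V u w) * (exp (?l * ?G u) * (1 / Suc k * (cap eps A / 2))) \<le>
          exp (- V u w) * (exp (?l * ?G u) * (1 / Suc k * lyap eps A (V u w)))"
        using lyap_bounds(2)[OF eps, of A "V u w"] alive_V[OF al] by (intro mult_left_mono) auto
      ultimately have "exp (- V u w) * (exp (?l * ?G u) * (1 / Suc k * (cap eps A / 2))) < 1" by linarith
      moreover have "x * v < 2 * n / c" if "v * (x * (1 / n * (c / 2))) < 1" "0 < n" "0 < c"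
        for x v n c :: real using that by (simp add: field_simps)
      ultimately have "exp (?l * ?G u) * exp (- V u w) < 2 * real (Suc k) / cap eps A"
        using C by (metis of_nat_0_less_iff zero_less_Suc)
      then have "exp (?l * ?G u - V u w) < 2 * Suc k / cap eps A"
        by (simp add: exp_diff exp_minus divide_inverse)
      also have "\<dots> = exp (ln (2 * Suc k / cap eps A))"
        using C by (intro exp_ln[symmetric]) simp
      finally have "?l * ?G u - V u w < ln (2 * Suc k / cap eps A)" by (simp only: exp_less_cancel_iff)
      then show ?thesis by linarith
    qed
    then show "\<exists>Y. \<forall>u. alive ?B u w \<longrightarrow> ?l * ?G u \<le> V u w + Y" by blast
  qed
qed

text \<open>Applied to every prefix, the additive functional bounds \<open>V\<close> from below by a
  multiple of the accumulated sum of \<open>exp (- eps * V)\<close>. Writing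
  \<open>exp (- g * V)\<close> as \<open>exp (- eps * V)\<close> times
  \<open>exp (- (g - eps) * V)\<close>, the second factor decays exponentially in the accumulated
  sum of the first, and the series telescopes.\<close>

lemma AE_path_sum_bounded:
  assumes eps: "0 < eps" "eps < g"
  shows "AE w in M. \<exists>K. \<forall>u. (\<Sum>j\<le>length u. exp (- g * V (take j u) w)) \<le> K"
proof -
  have "AE w in M. \<exists>A\<ge>0. (\<forall>u. alive {- A..} u w) \<and> (\<exists>Y. \<forall>u. alive {- A..} u w \<longrightarrow>
      drift eps / cap eps A * (\<Sum>j<length u. exp (- eps * V (take j u) w)) \<le> V u w + Y)"
    by (rule AE_barrier_imp) (rule AE_additive_functional[OF _ eps(1)])
  then show ?thesis
  proof eventually_elim
    case (elim w)
    then obtain A Y where A: "0 \<le> A" and al: "\<And>u. alive {- A..} u w" and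
      Y: "\<And>u. drift eps / cap eps A * (\<Sum>j<length u. exp (- eps * V (take j u) w)) \<le> V u w + Y"
      by blast
    define l where "l = drift eps / cap eps A"
    define c where "c = (g - eps) * l"
    have l: "0 < l" using drift_pos cap_pos eps by (simp add: l_def)
    have c: "0 < c" using l eps by (simp add: c_def)
    have "(\<Sum>j\<le>length u. exp (- g * V (take j u) w)) \<le>
        exp ((g - eps) * Y) * (exp (c * exp (eps * A)) / c)" for u
    proof -
      define x where "x j = exp (- eps * V (take j u) w)" for j
      have xb: "0 \<le> x j \<and> x j \<le> exp (eps * A)" for j
        using alive_V[OF al, of "take j u"] eps mult_left_mono[of "- A" "V (take j u) w" eps]
        by (simp add: x_def)
      have "exp (- g * V (take j u) w) \<le> exp ((g - eps) * Y) * (x j * exp (- c * (\<Sum>i<j. x i)))"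
        if "j \<le> length u" for j
      proof -
        have "(\<Sum>i<length (take j u). exp (- eps * V (take i (take j u)) w)) = (\<Sum>i<j. x i)"
          unfolding x_def using that by (intro sum.cong) (auto simp: min_def)
        with Y[of "take j u"] have "l * (\<Sum>i<j. x i) \<le> V (take j u) w + Y" by (simp add: l_def)
        then have "(g - eps) * (l * (\<Sum>i<j. x i)) \<le> (g - eps) * (V (take j u) w + Y)"
          using eps by (intro mult_left_mono) auto
        then have "- g * V (take j u) w \<le> (g - eps) * Y + (- eps * V (take j u) w + - c * (\<Sum>i<j. x i))"
          by (simp add: c_def algebra_simps)
        then show ?thesis unfolding x_def by (simp only: exp_add[symmetric] exp_le_cancel_iff)
      qed
      then have "(\<Sum>j\<le>length u. exp (- g * V (take j u) w)) \<le>
          (\<Sum>j\<le>length u. exp ((g - eps) * Y) * (x j * exp (- c * (\<Sum>i<j. x i))))"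
        by (intro sum_mono) simp
      also have "\<dots> = exp ((g - eps) * Y) * (\<Sum>j\<le>length u. x j * exp (- c * (\<Sum>i<j. x i)))"
        by (simp add: sum_distrib_left)
      also have "\<dots> \<le> exp ((g - eps) * Y) * (exp (c * exp (eps * A)) / c)"
        using telescoping_exp_sum[OF c, of "length u" x] xb by (intro mult_left_mono) auto
      finally show ?thesis .
    qed
    then show ?case by blast
  qed
qed

end

subsection \<open>A maximal inequality for finite families of martingales\<close>

context prob_space
begin

lemma integrable_mult_square:
  fixes f g :: "'a \<Rightarrow> real"
  assumes [measurable]: "f \<in> borel_measurable M" "g \<in> borel_measurable M"
    and "integrable M (\<lambda>x. (f x)\<^sup>2)" "integrable M (\<lambda>x. (g x)\<^sup>2)"
  shows "integrable M (\<lambda>x. f x * g x)"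
proof (rule Bochner_Integration.integrable_bound)
  show "integrable M (\<lambda>x. (f x)\<^sup>2 + (g x)\<^sup>2)" using assms by simp
  have "\<bar>f x * g x\<bar> \<le> (f x)\<^sup>2 + (g x)\<^sup>2" for x
  proof -
    have "2 * (\<bar>f x\<bar> * \<bar>g x\<bar>) \<le> \<bar>f x\<bar>\<^sup>2 + \<bar>g x\<bar>\<^sup>2" using sum_squares_bound[of "\<bar>f x\<bar>" "\<bar>g x\<bar>"] by simp
    moreover have "0 \<le> \<bar>f x\<bar> * \<bar>g x\<bar>" by simp
    ultimately have "\<bar>f x\<bar> * \<bar>g x\<bar> \<le> \<bar>f x\<bar>\<^sup>2 + \<bar>g x\<bar>\<^sup>2" by linarith
    then show ?thesis by (simp add: abs_mult)
  qed
  then show "AE x in M. norm (f x * g x) \<le> norm ((f x)\<^sup>2 + (g x)\<^sup>2)" by simp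
qed measurable

lemma integrable_of_square:
  fixes f :: "'a \<Rightarrow> real"
  assumes "f \<in> borel_measurable M" "integrable M (\<lambda>x. (f x)\<^sup>2)"
  shows "integrable M f"
  using integrable_mult_square[of f "\<lambda>_. 1"] assms by simp

lemma running_max:
  fixes R S :: "nat \<Rightarrow> 'a \<Rightarrow> real"
  assumes [measurable]: "\<And>i. R i \<in> borel_measurable M"
    and nonneg: "\<And>i w. 0 \<le> R i w"
    and sq: "\<And>i. i \<le> N \<Longrightarrow> integrable M (\<lambda>w. (R i w)\<^sup>2)"
    and S0: "S 0 = R 0" and S_Suc: "\<And>i w. S (Suc i) w = max (S i w) (R (Suc i) w)"
  shows "S i \<in> borel_measurable M" "0 \<le> S i w" "i \<le> N \<Longrightarrow> integrable M (\<lambda>w. (S i w)\<^sup>2)"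
proof -
  have S [measurable]: "S i \<in> borel_measurable M" for i
  proof (induction i)
    case (Suc i)
    have "S (Suc i) = (\<lambda>w. max (S i w) (R (Suc i) w))" using S_Suc by auto
    with Suc show ?case by simp
  qed (simp add: S0)
  then show "S i \<in> borel_measurable M" .
  show "0 \<le> S i w"
    by (induction i) (auto simp: S0 S_Suc nonneg le_max_iff_disj)
  show "i \<le> N \<Longrightarrow> integrable M (\<lambda>w. (S i w)\<^sup>2)"
  proof (induction i)
    case (Suc i)
    show ?case
    proof (rule Bochner_Integration.integrable_bound)
      show "integrable M (\<lambda>w. (S i w)\<^sup>2 + (R (Suc i) w)\<^sup>2)" using Suc sq by simp
      show "AE w in M. norm ((S (Suc i) w)\<^sup>2) \<le> norm ((S i w)\<^sup>2 + (R (Suc i) w)\<^sup>2)"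
        by (auto simp: S_Suc max_def)
    qed measurable
  qed (simp add: S0 sq)
qed

text \<open>The submartingale property enters only tested against the running maximum. The mean of
  \<open>2 * S * R - S\<^sup>2\<close> does not decrease: while \<open>S\<close> stands still this
  is \<open>sub\<close>, and at a new maximum the gain is a square. At time \<open>N\<close>,
  completing the square in \<open>S / 2 - R\<close> gives the constant 4.\<close>

lemma doob_L2_max:
  fixes R S :: "nat \<Rightarrow> 'a \<Rightarrow> real"
  assumes R [measurable]: "\<And>i. R i \<in> borel_measurable M"
    and nonneg: "\<And>i w. 0 \<le> R i w"
    and sq: "\<And>i. i \<le> N \<Longrightarrow> integrable M (\<lambda>w. (R i w)\<^sup>2)"
    and S0: "S 0 = R 0" and S_Suc: "\<And>i w. S (Suc i) w = max (S i w) (R (Suc i) w)"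
    and sub: "\<And>i. i < N \<Longrightarrow> (\<integral>w. S i w * R i w \<partial>M) \<le> (\<integral>w. S i w * R (Suc i) w \<partial>M)"
  shows "(\<integral>w. (S N w)\<^sup>2 \<partial>M) \<le> 4 * (\<integral>w. (R N w)\<^sup>2 \<partial>M)"
proof -
  have [measurable]: "S i \<in> borel_measurable M" for i
    by (rule running_max(1)[where R=R and N=N]) (use nonneg sq S0 S_Suc in auto)
  have Ssq: "integrable M (\<lambda>w. (S i w)\<^sup>2)" if "i \<le> N" for i
    by (rule running_max(3)[where R=R and N=N]) (use that nonneg sq S0 S_Suc in auto)
  have iS: "integrable M (\<lambda>w. (S N w)\<^sup>2)" by (rule Ssq) simp
  have SR: "integrable M (\<lambda>w. S i w * R j w)" if "i \<le> N" "j \<le> N" for i j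
    using integrable_mult_square Ssq sq that by simp
  have key: "i \<le> N \<Longrightarrow> 0 \<le> (\<integral>w. 2 * (S i w * R i w) - (S i w)\<^sup>2 \<partial>M)" for i
  proof (induction i)
    case 0
    then show ?case by (simp add: S0 power2_eq_square)
  next
    case (Suc i)
    have "(\<integral>w. 2 * (S i w * R i w) - (S i w)\<^sup>2 \<partial>M) = 2 * (\<integral>w. S i w * R i w \<partial>M) - (\<integral>w. (S i w)\<^sup>2 \<partial>M)"
      using SR Ssq Suc.prems by simp
    also have "\<dots> \<le> 2 * (\<integral>w. S i w * R (Suc i) w \<partial>M) - (\<integral>w. (S i w)\<^sup>2 \<partial>M)"
      using sub[of i] Suc.prems by simp
    also have "\<dots> = (\<integral>w. 2 * (S i w * R (Suc i) w) - (S i w)\<^sup>2 \<partial>M)"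
      using SR Ssq Suc.prems by simp
    also have "\<dots> \<le> (\<integral>w. 2 * (S (Suc i) w * R (Suc i) w) - (S (Suc i) w)\<^sup>2 \<partial>M)"
    proof (rule integral_mono)
      fix w
      show "2 * (S i w * R (Suc i) w) - (S i w)\<^sup>2 \<le> 2 * (S (Suc i) w * R (Suc i) w) - (S (Suc i) w)\<^sup>2"
      proof (cases "R (Suc i) w \<le> S i w")
        case True then show ?thesis by (simp add: S_Suc max_def)
      next
        case False
        then have "S (Suc i) w = R (Suc i) w" by (simp add: S_Suc)
        moreover have "0 \<le> (S i w - R (Suc i) w)\<^sup>2" by simp
        ultimately show ?thesis by (simp add: power2_eq_square algebra_simps)
      qed
    qed (use SR Ssq Suc.prems in auto)
    finally show ?case using Suc by simp
  qed
  have "(\<integral>w. (S N w)\<^sup>2 / 2 \<partial>M) \<le> (\<integral>w. 2 * (R N w)\<^sup>2 - (2 * (S N w * R N w) - (S N w)\<^sup>2) \<partial>M)"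
  proof (rule integral_mono)
    fix w
    have "0 \<le> (S N w / 2 - R N w)\<^sup>2" by simp
    then show "(S N w)\<^sup>2 / 2 \<le> 2 * (R N w)\<^sup>2 - (2 * (S N w * R N w) - (S N w)\<^sup>2)"
      by (simp add: power2_eq_square algebra_simps)
  qed (use iS SR sq in auto)
  also have "\<dots> = 2 * (\<integral>w. (R N w)\<^sup>2 \<partial>M) - (\<integral>w. 2 * (S N w * R N w) - (S N w)\<^sup>2 \<partial>M)"
    using SR sq iS by simp
  finally show "(\<integral>w. (S N w)\<^sup>2 \<partial>M) \<le> 4 * (\<integral>w. (R N w)\<^sup>2 \<partial>M)"
    using key[of N] by simp
qed

text \<open>\<open>cnj (sgn a)\<close> is a subgradient of the modulus at \<open>a\<close>; this and
  the next lemma replace the conditional Jensen inequality.\<close>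

lemma Re_cnj_sgn_le: "Re (cnj (sgn a) * b) \<le> cmod b"
proof -
  have "Re (cnj (sgn a) * b) \<le> cmod (cnj (sgn a) * b)" by (rule complex_Re_le_cmod)
  also have "\<dots> \<le> 1 * cmod b"
    unfolding norm_mult by (intro mult_right_mono) (auto simp: norm_sgn)
  finally show ?thesis by simp
qed

lemma Re_cnj_sgn_self: "Re (cnj (sgn a) * a) = cmod a"
proof (cases "a = 0")
  case False
  have "cnj (sgn a) * a = (a * cnj a) / complex_of_real (cmod a)"
    by (simp add: sgn_eq mult.commute)
  also have "\<dots> = complex_of_real (cmod a)"
    using False by (simp add: complex_norm_square[symmetric] power2_eq_square)
  finally show ?thesis by simp
qed simp

text \<open>The maximum over the index set is again a submartingale: average the increments with the weights
  \<open>q\<close> carried by the set of maximizers, ties being shared equally.\<close>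

lemma doob_L2_max_family:
  fixes P :: "nat \<Rightarrow> 'i \<Rightarrow> 'a \<Rightarrow> complex" and F :: "nat \<Rightarrow> 'a measure"
  assumes I: "finite I" "I \<noteq> {}"
    and F: "\<And>i (f :: 'a \<Rightarrow> complex). f \<in> borel_measurable (F i) \<Longrightarrow> f \<in> borel_measurable M"
    and P: "\<And>i j z. j \<le> i \<Longrightarrow> P j z \<in> borel_measurable (F i)"
    and sq: "\<And>i z. i \<le> N \<Longrightarrow> z \<in> I \<Longrightarrow> integrable M (\<lambda>w. (cmod (P i z w))\<^sup>2)"
    and orth: "\<And>i z Y. \<lbrakk>i < N; z \<in> I; Y \<in> borel_measurable (F i); integrable M Y\<rbrakk> \<Longrightarrow>
      integrable M (\<lambda>w. Y w * (P (Suc i) z w - P i z w)) \<and>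
      (\<integral>w. Y w * (P (Suc i) z w - P i z w) \<partial>M) = 0"
  defines "R \<equiv> \<lambda>i w. Max ((\<lambda>z. cmod (P i z w)) ` I)"
  shows "integrable M (\<lambda>w. (Max ((\<lambda>i. R i w) ` {..N}))\<^sup>2)"
    "(\<integral>w. (Max ((\<lambda>i. R i w) ` {..N}))\<^sup>2 \<partial>M) \<le> 4 * (\<integral>w. (R N w)\<^sup>2 \<partial>M)"
proof -
  define S where "S i w = Max ((\<lambda>j. R j w) ` {..i})" for i w
  have PM [measurable]: "P i z \<in> borel_measurable M" for i z by (rule F[OF P[OF order_refl]])
  have R_meas: "R j \<in> borel_measurable (F i)" if "j \<le> i" for i j
    unfolding R_def using P[OF that] by (intro borel_measurable_Max I) auto
  have S_meas: "S i \<in> borel_measurable (F i)" for i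
    unfolding S_def using R_meas by (intro borel_measurable_Max) auto
  have [measurable]: "R i \<in> borel_measurable M" for i
    unfolding R_def by (intro borel_measurable_Max I) auto
  have SM [measurable]: "S i \<in> borel_measurable M" for i
    unfolding S_def by (intro borel_measurable_Max) auto
  have R_ge: "cmod (P i z w) \<le> R i w" if "z \<in> I" for i z w
    unfolding R_def using I that by (intro Max_ge) auto
  have R_ex: "\<exists>z\<in>I. R i w = cmod (P i z w)" for i w
  proof -
    have "R i w \<in> (\<lambda>z. cmod (P i z w)) ` I" unfolding R_def using I by (intro Max_in) auto
    then show ?thesis by auto
  qed
  have R_nonneg: "0 \<le> R i w" for i w using R_ex[of i w] by auto
  have R_sq: "integrable M (\<lambda>w. (R i w)\<^sup>2)" if "i \<le> N" for i
  proof (rule Bochner_Integration.integrable_bound)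
    show "integrable M (\<lambda>w. \<Sum>z\<in>I. (cmod (P i z w))\<^sup>2)" using sq that by auto
    have "(R i w)\<^sup>2 \<le> (\<Sum>z\<in>I. (cmod (P i z w))\<^sup>2)" for w
    proof -
      obtain z where z: "z \<in> I" "R i w = cmod (P i z w)" using R_ex by blast
      have "(cmod (P i z w))\<^sup>2 \<le> (\<Sum>z\<in>I. (cmod (P i z w))\<^sup>2)"
        by (rule member_le_sum) (use z I in auto)
      with z show ?thesis by simp
    qed
    then show "AE w in M. norm ((R i w)\<^sup>2) \<le> norm (\<Sum>z\<in>I. (cmod (P i z w))\<^sup>2)"
      by (simp add: sum_nonneg)
  qed measurable
  have S0: "S 0 = R 0" by (rule ext) (simp add: S_def)
  have S_Suc: "S (Suc i) w = max (S i w) (R (Suc i) w)" for i w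
    unfolding S_def atMost_Suc by (simp add: Max_insert max.commute)
  have S_ge: "R j w \<le> S i w" if "j \<le> i" for i j w
    unfolding S_def using that by (intro Max_ge) auto
  have S_nonneg: "0 \<le> S i w" for i w using S_ge[of i i w] R_nonneg[of i w] by linarith
  have S_sq: "i \<le> N \<Longrightarrow> integrable M (\<lambda>w. (S i w)\<^sup>2)" for i
    by (rule running_max(3)[where R=R and N=N]) (use R_nonneg R_sq S0 S_Suc in auto)
  have sub: "(\<integral>w. S i w * R i w \<partial>M) \<le> (\<integral>w. S i w * R (Suc i) w \<partial>M)" if i: "i < N" for i
  proof -
    define c where "c w = (\<Sum>z\<in>I. if cmod (P i z w) = R i w then 1 else 0 :: real)" for w
    define q where "q z w = (if cmod (P i z w) = R i w then 1 / c w else 0)" for z w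
    define D where "D z w = P (Suc i) z w - P i z w" for z w
    \<comment> \<open>The test variable combines the running maximum, the weight of the maximizer
      \<open>z\<close> and the subgradient of the modulus at \<open>P i z\<close>; it belongs to the
      past and is bounded by \<open>S i\<close>.\<close>
    define Y where "Y z w = complex_of_real (S i w * q z w) * cnj (sgn (P i z w))" for z w
    have c1: "1 \<le> c w" for w
    proof -
      obtain z where z: "z \<in> I" "R i w = cmod (P i z w)" using R_ex by blast
      have "(if cmod (P i z w) = R i w then 1 else 0 :: real) \<le> c w"
        unfolding c_def by (rule member_le_sum) (use z I in auto)
      with z show ?thesis by simp
    qed
    have q: "0 \<le> q z w" "q z w \<le> 1" for z w using c1[of w] by (auto simp: q_def)
    have sum_q: "(\<Sum>z\<in>I. q z w) = 1" for w
    proof -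
      have "(\<Sum>z\<in>I. q z w) = (\<Sum>z\<in>I. (if cmod (P i z w) = R i w then 1 else 0) / c w)"
        unfolding q_def by (intro sum.cong) auto
      also have "\<dots> = c w / c w" by (simp only: sum_divide_distrib[symmetric] c_def)
      finally show ?thesis using c1[of w] by simp
    qed
    have [measurable]: "P i z \<in> borel_measurable (F i)" "R i \<in> borel_measurable (F i)"
      "S i \<in> borel_measurable (F i)" for z
      using P R_meas S_meas by auto
    have [measurable]: "c \<in> borel_measurable (F i)" unfolding c_def by measurable
    have [measurable]: "(\<lambda>w. sgn (P i z w)) \<in> borel_measurable (F i)" for z
      unfolding sgn_div_norm by measurable
    have q_meas: "q z \<in> borel_measurable (F i)" for z
      unfolding q_def by measurable
    have "cnj \<in> borel_measurable borel"
      by (intro borel_measurable_continuous_onI continuous_intros)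
    then have cnj_meas: "(\<lambda>w. cnj (sgn (P i z w))) \<in> borel_measurable (F i)" for z
      using measurable_compose[of "\<lambda>w. sgn (P i z w)" "F i" borel cnj borel] by simp
    have Y_meas: "Y z \<in> borel_measurable (F i)" for z
    proof -
      have Sq: "(\<lambda>w. S i w * q z w) \<in> borel_measurable (F i)"
        by (intro borel_measurable_times S_meas q_meas)
      have "complex_of_real \<in> borel_measurable borel"
        by (intro borel_measurable_continuous_onI continuous_intros)
      from measurable_compose[OF Sq this] cnj_meas show ?thesis
        unfolding Y_def by (rule borel_measurable_times)
    qed
    have S_int: "integrable M (S i)" using integrable_of_square[OF SM S_sq, of i] i by simp
    have Y_int: "integrable M (Y z)" for z
    proof (rule Bochner_Integration.integrable_bound[OF S_int])
      show "Y z \<in> borel_measurable M" by (rule F[OF Y_meas])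
      have "cmod (Y z w) \<le> S i w" for w
      proof -
        have "cmod (Y z w) = S i w * q z w * cmod (sgn (P i z w))"
          using S_nonneg q by (simp add: Y_def norm_mult abs_mult)
        also have "\<dots> \<le> S i w * 1 * 1"
          using S_nonneg q by (intro mult_mono) (auto simp: norm_sgn)
        finally show ?thesis by simp
      qed
      then show "AE w in M. norm (Y z w) \<le> norm (S i w)" using S_nonneg by simp
    qed
    have o: "integrable M (\<lambda>w. Y z w * D z w)" "(\<integral>w. Y z w * D z w \<partial>M) = 0" if "z \<in> I" for z
      using orth[OF i that Y_meas Y_int] unfolding D_def by auto
    have oR: "integrable M (\<lambda>w. Re (Y z w * D z w))" "(\<integral>w. Re (Y z w * D z w) \<partial>M) = 0" if "z \<in> I" for z
    proof -
      show "integrable M (\<lambda>w. Re (Y z w * D z w))" by (rule integrable_Re[OF o(1)[OF that]])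
      show "(\<integral>w. Re (Y z w * D z w) \<partial>M) = 0"
        unfolding integral_Re[OF o(1)[OF that]] o(2)[OF that] by simp
    qed
    have SR: "integrable M (\<lambda>w. S i w * R j w)" if "j \<le> N" for j
      using integrable_mult_square S_sq R_sq that i by simp
    have "(\<integral>w. S i w * R i w \<partial>M) = (\<integral>w. S i w * R i w \<partial>M) + (\<Sum>z\<in>I. \<integral>w. Re (Y z w * D z w) \<partial>M)"
      using oR by simp
    also have "\<dots> = (\<integral>w. S i w * R i w + (\<Sum>z\<in>I. Re (Y z w * D z w)) \<partial>M)"
      using SR[of i] i oR(1) by (subst Bochner_Integration.integral_add) (auto simp: Bochner_Integration.integral_sum)
    also have "\<dots> \<le> (\<integral>w. S i w * R (Suc i) w \<partial>M)"
    proof (rule integral_mono)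
      fix w
      have "q z w * (R i w + Re (cnj (sgn (P i z w)) * D z w)) \<le> q z w * R (Suc i) w"
        if z: "z \<in> I" for z
      proof (cases "cmod (P i z w) = R i w")
        case True
        have "R i w + Re (cnj (sgn (P i z w)) * D z w) = Re (cnj (sgn (P i z w)) * P (Suc i) z w)"
          unfolding True[symmetric] D_def Re_cnj_sgn_self[symmetric] by (simp add: algebra_simps)
        also have "\<dots> \<le> R (Suc i) w"
          using Re_cnj_sgn_le R_ge[OF z] by (rule order_trans)
        finally show ?thesis using q by (intro mult_left_mono)
      qed (simp add: q_def)
      then have "(\<Sum>z\<in>I. q z w * (R i w + Re (cnj (sgn (P i z w)) * D z w))) \<le> (\<Sum>z\<in>I. q z w * R (Suc i) w)"
        by (rule sum_mono)
      then have "R i w + (\<Sum>z\<in>I. q z w * Re (cnj (sgn (P i z w)) * D z w)) \<le> R (Suc i) w"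
        by (simp only: distrib_left sum.distrib sum_distrib_right[symmetric] sum_q mult_1)
      then have "S i w * (R i w + (\<Sum>z\<in>I. q z w * Re (cnj (sgn (P i z w)) * D z w))) \<le> S i w * R (Suc i) w"
        by (rule mult_left_mono) (rule S_nonneg)
      moreover have "Re (Y z w * D z w) = S i w * (q z w * Re (cnj (sgn (P i z w)) * D z w))" for z
      proof -
        have "Re (complex_of_real r * x) = r * Re x" for r x by simp
        then show ?thesis unfolding Y_def by (simp only: mult.assoc)
      qed
      ultimately show "S i w * R i w + (\<Sum>z\<in>I. Re (Y z w * D z w)) \<le> S i w * R (Suc i) w"
        by (simp add: distrib_left sum_distrib_left)
    next
      show "integrable M (\<lambda>w. S i w * R i w + (\<Sum>z\<in>I. Re (Y z w * D z w)))"
        using SR[of i] i oR(1) by auto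
    qed (use SR[of "Suc i"] i in auto)
    finally show ?thesis .
  qed
  show "integrable M (\<lambda>w. (Max ((\<lambda>i. R i w) ` {..N}))\<^sup>2)"
    using S_sq[of N] by (simp add: S_def)
  show "(\<integral>w. (Max ((\<lambda>i. R i w) ` {..N}))\<^sup>2 \<partial>M) \<le> 4 * (\<integral>w. (R N w)\<^sup>2 \<partial>M)"
    using doob_L2_max[of R N S, OF _ R_nonneg R_sq S0 S_Suc sub] by (simp add: S_def)
qed

end

subsection \<open>The complex weights\<close>

definition phase :: "real \<Rightarrow> complex \<Rightarrow> complex" where
  "phase g x = exp (complex_of_real (- g * Re x) +
     \<i> * complex_of_real ((1 - g) * sqrt (2 * ln 2) * Im x))"

lemma phase_add: "phase g (x + y) = phase g x * phase g y"
  unfolding phase_def exp_add[symmetric]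
  by (rule arg_cong[of _ _ exp]) (simp add: algebra_simps)

lemma cmod_phase: "cmod (phase g x) = exp (- g * Re x)"
  by (simp add: phase_def)

lemma borel_measurable_phase [measurable]: "phase g \<in> borel_measurable borel"
  unfolding phase_def[abs_def] by (intro borel_measurable_continuous_onI continuous_intros)

lemma has_bochner_integral_normal_exp:
  assumes "0 < s"
  shows "integrable lborel (\<lambda>y. normal_density m s y * exp (- c * y))"
    "(\<integral>y. normal_density m s y * exp (- c * y) \<partial>lborel) = exp (c\<^sup>2 * s\<^sup>2 / 2 - c * m)"
  using assms by (simp_all only: normal_density_exp_tilt[OF assms])
    (simp_all add: integral_normal_density)

context cascade
begin

lemma expectation_exp_Re:
  assumes "u \<noteq> []"
  shows "integrable M (\<lambda>w. exp (- c * Re (Theta u w)))"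
    "(\<integral>w. exp (- c * Re (Theta u w)) \<partial>M) = exp (c\<^sup>2 * ln 2 - 2 * c * ln 2)"
proof -
  note i = has_bochner_integral_normal_exp[of "sqrt (2 * ln 2)" "2 * ln 2" c]
  show "integrable M (\<lambda>w. exp (- c * Re (Theta u w)))"
    using distributed_integrable[OF distributed_Re[OF assms], of "\<lambda>x. exp (- c * x)"] i(1) by simp
  show "(\<integral>w. exp (- c * Re (Theta u w)) \<partial>M) = exp (c\<^sup>2 * ln 2 - 2 * c * ln 2)"
    using distributed_integral[OF distributed_Re[OF assms], of "\<lambda>x. exp (- c * x)"] i(2) by simp
qed

lemma expectation_iexp_Im:
  assumes "u \<noteq> []"
  shows "(\<integral>w. iexp (t * Im (Theta u w)) \<partial>M) = complex_of_real (exp (- t\<^sup>2 / 2))"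
proof -
  have [measurable]: "(\<lambda>w. Im (Theta u w)) \<in> borel_measurable M"
    using measurable_Theta[OF assms] by measurable
  have "(\<integral>w. iexp (t * Im (Theta u w)) \<partial>M) = (\<integral>x. iexp (t * x) \<partial>distr M lborel (\<lambda>w. Im (Theta u w)))"
    by (subst integral_distr) auto
  also have "\<dots> = char std_normal_distribution t"
    using distributed_distr_eq_density[OF distributed_Im[OF assms]] by (simp add: char_def)
  finally show ?thesis by (simp add: char_std_normal_distribution)
qed

text \<open>The relation \<open>beta = 1 - gamma\<close> acts here: in units of \<open>ln 2\<close>
  the exponent is \<open>g\<^sup>2 - 2 * g\<close> from the real part and
  \<open>- (1 - g)\<^sup>2\<close> from the imaginary part, and these add up to -1 for every
  \<open>g\<close>.\<close>

lemma expectation_phase: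
  assumes u: "u \<noteq> []"
  shows "integrable M (\<lambda>w. phase g (Theta u w))" "(\<integral>w. phase g (Theta u w) \<partial>M) = 1 / 2"
proof -
  let ?t = "(1 - g) * sqrt (2 * ln 2)"
  let ?X = "\<lambda>w. complex_of_real (exp (- g * Re (Theta u w)))"
  let ?Y = "\<lambda>w. iexp (?t * Im (Theta u w))"
  have "indep_var borel ((\<lambda>x. complex_of_real (exp (- g * x))) \<circ> (\<lambda>w. Re (Theta u w)))
      borel ((\<lambda>x. iexp (?t * x)) \<circ> (\<lambda>w. Im (Theta u w)))"
    by (rule indep_var_compose[OF indep_Re_Im[OF u]])
      (auto intro!: borel_measurable_continuous_onI continuous_intros)
  then have ind: "indep_var borel ?X borel ?Y" by (simp add: comp_def)
  have X: "integrable M ?X" using expectation_exp_Re(1)[OF u, of g] by simp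
  have Y: "integrable M ?Y"
  proof (rule Bochner_Integration.integrable_bound)
    show "integrable M (\<lambda>_. 1 :: real)" by simp
  qed (use indep_var_rv2[OF ind] in auto)
  have e: "phase g (Theta u w) = ?X w * ?Y w" for w
    unfolding phase_def exp_add exp_of_real by (simp add: mult.assoc)
  show "integrable M (\<lambda>w. phase g (Theta u w))"
    unfolding e by (rule indep_var_integrable[OF ind X Y])
  have "(\<integral>w. phase g (Theta u w) \<partial>M) = (\<integral>w. ?X w \<partial>M) * (\<integral>w. ?Y w \<partial>M)"
    unfolding e by (rule indep_var_lebesgue_integral[OF ind X Y])
  also have "\<dots> = complex_of_real (exp (g\<^sup>2 * ln 2 - 2 * g * ln 2)) * complex_of_real (exp (- ?t\<^sup>2 / 2))"
    using expectation_iexp_Im[OF u, of ?t] expectation_exp_Re(2)[OF u, of g] by simp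
  also have "\<dots> = complex_of_real (exp (- ln 2))"
  proof -
    have t: "- ?t\<^sup>2 / 2 = - ((1 - g)\<^sup>2 * ln 2)" by (simp add: power_mult_distrib)
    have "g\<^sup>2 * ln 2 - 2 * g * ln 2 + - ?t\<^sup>2 / 2 = - ln 2"
      unfolding t by (simp add: power2_eq_square algebra_simps)
    then show ?thesis by (simp only: of_real_mult[symmetric] exp_add[symmetric])
  qed
  finally show "(\<integral>w. phase g (Theta u w) \<partial>M) = 1 / 2" by (simp add: exp_minus)
qed

text \<open>An upper bound for the variance, coming from
  \<open>(a + 1 / 2)\<^sup>2 <= 2 * a\<^sup>2 + 1 / 2\<close>.\<close>

definition phase_var :: "real \<Rightarrow> real" where
  "phase_var g = 2 * exp ((2 * g)\<^sup>2 * ln 2 - 2 * (2 * g) * ln 2) + 1 / 2"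

lemma expectation_phase_square:
  assumes u: "u \<noteq> []"
  shows "integrable M (\<lambda>w. (cmod (phase g (Theta u w) - 1 / 2))\<^sup>2)"
    "(\<integral>w. (cmod (phase g (Theta u w) - 1 / 2))\<^sup>2 \<partial>M) \<le> phase_var g"
proof -
  let ?Z = "\<lambda>w. (cmod (phase g (Theta u w) - 1 / 2))\<^sup>2"
  let ?W = "\<lambda>w. 2 * exp (- (2 * g) * Re (Theta u w)) + 1 / 2"
  have [measurable]: "Theta u \<in> borel_measurable M" by (rule measurable_Theta[OF u])
  have W: "integrable M ?W" using expectation_exp_Re(1)[OF u, of "2 * g"] by simp
  have ZW: "?Z w \<le> ?W w" for w
  proof -
    let ?a = "cmod (phase g (Theta u w))"
    have "cmod (phase g (Theta u w) - 1 / 2) \<le> ?a + cmod (1 / 2)" by (rule norm_triangle_ineq4)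
    then have "?Z w \<le> (?a + 1 / 2)\<^sup>2" by (intro power_mono) auto
    also have "\<dots> \<le> 2 * ?a\<^sup>2 + 1 / 2"
    proof -
      have "0 \<le> (?a - 1 / 2)\<^sup>2" by simp
      then show ?thesis by (simp add: power2_eq_square algebra_simps)
    qed
    also have "?a\<^sup>2 = exp (- (2 * g) * Re (Theta u w))"
      by (simp add: cmod_phase power2_eq_square exp_add[symmetric])
    finally show ?thesis .
  qed
  show Z: "integrable M ?Z"
    by (rule Bochner_Integration.integrable_bound[OF W], measurable)
      (use ZW in \<open>auto intro!: AE_I2 order_trans[OF _ abs_ge_self]\<close>)
  have "(\<integral>w. ?Z w \<partial>M) \<le> (\<integral>w. ?W w \<partial>M)" by (rule integral_mono[OF Z W ZW])
  also have "\<dots> = phase_var g"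
    using expectation_exp_Re[OF u, of "2 * g"] by (simp add: phase_var_def prob_space)
  finally show "(\<integral>w. ?Z w \<partial>M) \<le> phase_var g" .
qed

abbreviation mass :: "real \<Rightarrow> bool list \<Rightarrow> 'a \<Rightarrow> complex" where
  "mass g u w \<equiv> phase g (theta Theta u w)"

lemma cmod_mass: "cmod (mass g u w) = exp (- g * V u w)"
  by (simp add: cmod_phase Vw_def)

text \<open>Only the parent is tested against the barrier. The last factor then stays independent of
  the killing and centred, so truncation preserves the martingale property.\<close>

definition incr :: "real \<Rightarrow> real \<Rightarrow> bool list \<Rightarrow> 'a \<Rightarrow> complex" where
  "incr g A v w = (if alive {- A..} (butlast v) w then mass g (butlast v) w else 0) *
     (phase g (Theta v w) - 1 / 2)"

abbreviation incr_var :: "real \<Rightarrow> real \<Rightarrow> bool list \<Rightarrow> real" where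
  "incr_var g A v \<equiv> \<integral>w. (cmod (incr g A v w))\<^sup>2 \<partial>M"

lemma incr_alive:
  assumes "v \<noteq> []" "alive {- A..} (butlast v) w"
  shows "incr g A v w = mass g v w - mass g (butlast v) w / 2"
proof -
  have "theta Theta v w = theta Theta (butlast v) w + Theta v w"
    using theta_snoc[of Theta "butlast v" "last v" w] assms by simp
  then show ?thesis using assms by (simp add: incr_def phase_add right_diff_distrib)
qed

lemma measurable_killed_mass_hist:
  assumes "\<And>l. l \<in> {1..length u} \<Longrightarrow> take l u \<in> H"
  shows "(\<lambda>w. if alive {- A..} u w then mass g u w else 0) \<in> borel_measurable (hist H)"
proof -
  have [measurable]: "theta Theta u \<in> borel_measurable (hist H)" "Measurable.pred (hist H) (alive {- A..} u)"
    using measurable_theta_hist[OF assms] measurable_alive_hist[OF assms] by auto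
  show ?thesis by measurable
qed

lemma killed_mass_bounded:
  assumes "0 \<le> g"
  shows "cmod (if alive {- A..} u w then mass g u w else 0) \<le> exp (g * A)"
  using assms mult_left_mono[of "- A" "V u w" g] alive_V[of "{- A..}" u w] by (auto simp: cmod_mass)

lemma measurable_incr_hist:
  assumes "v \<in> H" "\<And>l. l \<in> {1..<length v} \<Longrightarrow> take l v \<in> H"
  shows "incr g A v \<in> borel_measurable (hist H)"
proof -
  have "take l (butlast v) \<in> H" if "l \<in> {1..length (butlast v)}" for l
    using assms(2)[of l] that by (auto simp: butlast_conv_take)
  note [measurable] = measurable_killed_mass_hist[OF this] measurable_Theta_hist[OF assms(1)]
  show ?thesis unfolding incr_def[abs_def] by measurable
qed

lemma measurable_incr_upto:
  "v \<noteq> [] \<Longrightarrow> length v \<le> n \<Longrightarrow> incr g A v \<in> borel_measurable (hist_upto n)"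
  by (rule measurable_incr_hist) (auto simp: words_upto_def)

lemma measurable_incr: "v \<noteq> [] \<Longrightarrow> incr g A v \<in> borel_measurable M"
  by (rule measurable_from_hist[OF words_upto_nonempty measurable_incr_upto[OF _ order_refl]])

text \<open>Any history that contains the proper ancestors of \<open>v\<close> but not
  \<open>v\<close> will do: full levels for the martingale in \<open>m\<close>, lexicographic
  segments for the one in space. Killing bounds the parent's mass, which gives
  integrability.\<close>

lemma incr_orthogonal:
  assumes g: "0 \<le> g" and H: "H \<subseteq> {u. u \<noteq> []}" and v: "v \<notin> H" "v \<noteq> []"
    and anc: "\<And>l. l \<in> {1..<length v} \<Longrightarrow> take l v \<in> H"
    and Y: "Y \<in> borel_measurable (hist H)" "integrable M Y"
  shows "integrable M (\<lambda>w. Y w * incr g A v w)" "(\<integral>w. Y w * incr g A v w \<partial>M) = 0"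
proof -
  let ?k = "\<lambda>w. if alive {- A..} (butlast v) w then mass g (butlast v) w else 0"
  let ?w = "\<lambda>x. phase g x - 1 / 2"
  have "take l (butlast v) \<in> H" if "l \<in> {1..length (butlast v)}" for l
    using anc[of l] that by (auto simp: butlast_conv_take)
  note k [measurable] = measurable_killed_mass_hist[OF this]
  note Y(1) [measurable]
  have m: "(\<lambda>w. Y w * ?k w) \<in> borel_measurable (hist H)" by measurable
  have i: "integrable M (\<lambda>w. Y w * ?k w)"
  proof (rule Bochner_Integration.integrable_bound)
    show "integrable M (\<lambda>w. Y w * complex_of_real (exp (g * A)))" using Y(2) by simp
    show "(\<lambda>w. Y w * ?k w) \<in> borel_measurable M" by (rule measurable_from_hist[OF H m])
    show "AE w in M. norm (Y w * ?k w) \<le> norm (Y w * complex_of_real (exp (g * A)))"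
      using killed_mass_bounded[OF g] by (intro AE_I2) (simp only: norm_mult, intro mult_left_mono, auto)
  qed
  have w: "?w \<in> borel_measurable borel" by measurable
  have iw: "integrable M (\<lambda>w. ?w (Theta v w))" using expectation_phase(1)[OF v(2), of g] by simp
  have ew: "(\<integral>w. ?w (Theta v w) \<partial>M) = 0"
    using expectation_phase[OF v(2), of g] by (simp add: prob_space)
  have e: "Y w * incr g A v w = (Y w * ?k w) * ?w (Theta v w)" for w
    by (simp add: incr_def)
  show "integrable M (\<lambda>w. Y w * incr g A v w)" "(\<integral>w. Y w * incr g A v w \<partial>M) = 0"
    unfolding e using integral_indep_Theta_mean_zero[OF H v m i w iw ew] by auto
qed

lemma incr_square:
  assumes g: "0 \<le> g" and v: "v \<noteq> []"
  shows "integrable M (\<lambda>w. (cmod (incr g A v w))\<^sup>2)"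
    "ennreal (incr_var g A v) \<le> ennreal (phase_var g) *
      (\<integral>\<^sup>+w. weight {- A..} (butlast v) w * ennreal (exp (- (2 * g - 1) * V (butlast v) w)) \<partial>M)"
proof -
  let ?u = "butlast v"
  let ?k = "\<lambda>w. if alive {- A..} ?u w then mass g ?u w else 0"
  let ?X = "\<lambda>w. (cmod (?k w))\<^sup>2" and ?w = "\<lambda>x. (cmod (phase g x - 1 / 2))\<^sup>2"
  let ?H = "words_upto (length v - 1)"
  have k [measurable]: "?k \<in> borel_measurable (hist ?H)"
  proof (rule measurable_killed_mass_hist)
    show "take l ?u \<in> ?H" if "l \<in> {1..length ?u}" for l
      using that by (cases v rule: rev_cases) (auto simp: words_upto_def)
  qed
  have X: "?X \<in> borel_measurable (hist ?H)" by measurable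
  have kM [measurable]: "?k \<in> borel_measurable M" by (rule measurable_from_hist[OF words_upto_nonempty k])
  have ind: "indep_var borel ?X borel (\<lambda>w. ?w (Theta v w))"
  proof (rule indep_var_hist_Theta[OF words_upto_nonempty _ v X])
    show "v \<notin> ?H" using v by (cases v) (auto simp: words_upto_def)
  qed measurable
  have Xi: "integrable M ?X"
  proof (rule Bochner_Integration.integrable_bound)
    show "integrable M (\<lambda>_. (exp (g * A))\<^sup>2)" by simp
    show "AE w in M. norm (?X w) \<le> norm ((exp (g * A))\<^sup>2)"
    proof (intro AE_I2)
      fix w
      have "?X w \<le> (exp (g * A))\<^sup>2"
        by (intro power_mono killed_mass_bounded[OF g] norm_ge_zero)
      then show "norm (?X w) \<le> norm ((exp (g * A))\<^sup>2)" by simp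
    qed
  qed measurable
  note w = expectation_phase_square[OF v, of g]
  have e: "(cmod (incr g A v w))\<^sup>2 = ?X w * ?w (Theta v w)" for w
    by (simp add: incr_def norm_mult power_mult_distrib)
  show "integrable M (\<lambda>w. (cmod (incr g A v w))\<^sup>2)"
    unfolding e by (rule indep_var_integrable[OF ind Xi w(1)])
  have "(incr_var g A v) = (\<integral>w. ?X w \<partial>M) * (\<integral>w. ?w (Theta v w) \<partial>M)"
    unfolding e by (rule indep_var_lebesgue_integral[OF ind Xi w(1)])
  also have "\<dots> \<le> (\<integral>w. ?X w \<partial>M) * phase_var g"
    by (rule mult_left_mono[OF w(2)]) (rule integral_nonneg_AE, simp)
  finally have "ennreal (incr_var g A v) \<le> ennreal (phase_var g) * ennreal (\<integral>w. ?X w \<partial>M)"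
    by (subst ennreal_mult[symmetric]) (auto simp: mult.commute phase_var_def intro!: ennreal_leI)
  also have "ennreal (\<integral>w. ?X w \<partial>M) = (\<integral>\<^sup>+w. ennreal (?X w) \<partial>M)"
    by (rule nn_integral_eq_integral[symmetric, OF Xi]) simp
  also have "\<dots> = (\<integral>\<^sup>+w. weight {- A..} ?u w * ennreal (exp (- (2 * g - 1) * V ?u w)) \<partial>M)"
  proof (rule nn_integral_cong)
    fix w
    have "(exp (- g * V ?u w))\<^sup>2 = exp (- V ?u w) * exp (- (2 * g - 1) * V ?u w)"
      unfolding power2_eq_square exp_add[symmetric] by (rule arg_cong[of _ _ exp]) (simp add: algebra_simps)
    then show "ennreal (?X w) = weight {- A..} ?u w * ennreal (exp (- (2 * g - 1) * V ?u w))"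
      by (simp only: weight_def cmod_mass if_distrib[of cmod])
        (simp add: ennreal_mult[symmetric])
  qed
  finally show "ennreal (incr_var g A v) \<le> ennreal (phase_var g) *
      (\<integral>\<^sup>+w. weight {- A..} ?u w * ennreal (exp (- (2 * g - 1) * V ?u w)) \<partial>M)" .
qed

end

subsection \<open>Partial sums of the martingale in lexicographic order\<close>

definition words_between :: "nat \<Rightarrow> nat \<Rightarrow> bool list set" where
  "words_between n m = {v. n < length v \<and> length v \<le> m}"

lemma finite_words_between [simp]: "finite (words_between n m)"
proof (rule finite_subset)
  show "words_between n m \<subseteq> {v. set v \<subseteq> UNIV \<and> length v \<le> m}" by (auto simp: words_between_def)
qed (rule finite_lists_length_le, simp)

lemma sum_words_between_Suc:
  "sum f (words_between n (n + Suc j)) = sum f (words_between n (n + j)) + sum f {v. length v = Suc (n + j)}"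
proof -
  have "words_between n (n + Suc j) = words_between n (n + j) \<union> {v. length v = Suc (n + j)}"
    "words_between n (n + j) \<inter> {v. length v = Suc (n + j)} = {}"
    by (auto simp: words_between_def)
  then show ?thesis by (simp only: sum.union_disjoint finite_words_between finite_words)
qed

lemma take_less_self:
  fixes v :: "bool list"
  assumes "l < length v"
  shows "take l v < v"
proof (cases "drop l v")
  case Nil
  with assms show ?thesis by simp
next
  case (Cons b z)
  then have "(take l v, take l v @ drop l v) \<in> lexord {(x, y). x < y}"
    by (intro lexord_append_rightI) auto
  then show ?thesis by (simp add: list_less_def)
qed

text \<open>Initial segments of the order are prefixes of the sorted list, so a maximum over
  positions \<open>z\<close> becomes a maximum over exploration times.\<close>

lemma ex_take_sorted_eq:
  fixes L :: "'b::linorder list"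
  assumes "sorted L"
  shows "\<exists>i\<le>length L. set (take i L) = {v\<in>set L. v \<le> z}"
  using assms
proof (induction L)
  case Nil
  then show ?case by simp
next
  case (Cons x xs)
  show ?case
  proof (cases "x \<le> z")
    case True
    from Cons obtain i where "i \<le> length xs" "set (take i xs) = {v\<in>set xs. v \<le> z}" by auto
    with True show ?thesis by (intro exI[of _ "Suc i"]) auto
  next
    case False
    with Cons.prems show ?thesis by (intro exI[of _ 0]) auto
  qed
qed

lemma cmod_add_square: "(cmod (a + b))\<^sup>2 = (cmod a)\<^sup>2 + (cmod b)\<^sup>2 + 2 * Re (cnj a * b)"
  by (simp only: cmod_power2) (simp add: power2_eq_square algebra_simps)

lemma (in prob_space) integrable_cmod_square_sum:
  fixes f :: "'i \<Rightarrow> 'a \<Rightarrow> complex"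
  assumes "finite V"
    and "\<And>v. v \<in> V \<Longrightarrow> f v \<in> borel_measurable M"
    and "\<And>v. v \<in> V \<Longrightarrow> integrable M (\<lambda>w. (cmod (f v w))\<^sup>2)"
  shows "integrable M (\<lambda>w. (cmod (\<Sum>v\<in>V. f v w))\<^sup>2)"
  using assms
proof (induction V rule: finite_induct)
  case empty
  then show ?case by simp
next
  case (insert x V)
  have m [measurable]: "f x \<in> borel_measurable M" "(\<lambda>w. \<Sum>v\<in>V. f v w) \<in> borel_measurable M"
    using insert.prems(1) by auto
  show ?case
  proof (rule Bochner_Integration.integrable_bound)
    show "integrable M (\<lambda>w. 2 * (cmod (f x w))\<^sup>2 + 2 * (cmod (\<Sum>v\<in>V. f v w))\<^sup>2)"
      using insert by auto
    have "(cmod (a + b))\<^sup>2 \<le> 2 * (cmod a)\<^sup>2 + 2 * (cmod b)\<^sup>2" for a b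
    proof -
      have "(cmod (a + b))\<^sup>2 \<le> (cmod a + cmod b)\<^sup>2" by (intro power_mono norm_triangle_ineq) simp
      also have "\<dots> \<le> 2 * (cmod a)\<^sup>2 + 2 * (cmod b)\<^sup>2"
        using sum_squares_bound[of "cmod a" "cmod b"] by (simp add: power2_sum)
      finally show ?thesis .
    qed
    then show "AE w in M. norm ((cmod (\<Sum>v\<in>insert x V. f v w))\<^sup>2) \<le>
        norm (2 * (cmod (f x w))\<^sup>2 + 2 * (cmod (\<Sum>v\<in>V. f v w))\<^sup>2)"
      using insert by simp
    show "(\<lambda>w. (cmod (\<Sum>v\<in>insert x V. f v w))\<^sup>2) \<in> borel_measurable M"
      using insert by simp
  qed
qed

section \<open>Maxima of the partial sums over space and over dyadic blocks of levels\<close>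

context cascade
begin

text \<open>The order puts the prefixes of \<open>z\<close> below \<open>z\<close>: they are counted
  with full weight, together with the words to the left.\<close>

definition psum :: "real \<Rightarrow> real \<Rightarrow> nat \<Rightarrow> nat \<Rightarrow> bool list \<Rightarrow> 'a \<Rightarrow> complex" where
  "psum g A n m z w = (\<Sum>v | v \<in> words_between n m \<and> v \<le> z. incr g A v w)"

lemma measurable_psum_upto:
  assumes "m \<le> k"
  shows "psum g A n m z \<in> borel_measurable (hist_upto k)"
  unfolding psum_def
proof (intro borel_measurable_sum)
  fix v assume "v \<in> {v \<in> words_between n m. v \<le> z}"
  then show "incr g A v \<in> borel_measurable (hist_upto k)"
    using assms by (intro measurable_incr_upto) (auto simp: words_between_def)
qed

lemma measurable_psum [measurable]: "psum g A n m z \<in> borel_measurable M"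
  by (rule measurable_from_hist[OF words_upto_nonempty measurable_psum_upto[OF order_refl]])

lemma psum_square_integrable:
  "0 \<le> g \<Longrightarrow> integrable M (\<lambda>w. (cmod (psum g A n m z w))\<^sup>2)"
  unfolding psum_def
proof (rule integrable_cmod_square_sum)
  fix v assume "v \<in> {v \<in> words_between n m. v \<le> z}"
  then have "v \<noteq> []" by (auto simp: words_between_def)
  then show "incr g A v \<in> borel_measurable M"
    "0 \<le> g \<Longrightarrow> integrable M (\<lambda>w. (cmod (incr g A v w))\<^sup>2)"
    using measurable_incr incr_square(1) by auto
qed simp

text \<open>Exploring the vertices of depth in \<open>(n, N]\<close> in lexicographic order reveals every vertex after its
  ancestors, so the partial sums over initial segments form a martingale.\<close>

lemma lex_partial_sums:
  fixes g A :: real and n N :: nat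
  assumes g: "0 \<le> g"
  defines "L \<equiv> sorted_list_of_set (words_between n N)"
  defines "X \<equiv> \<lambda>i w. \<Sum>v\<in>set (take i L). incr g A v w"
  shows "integrable M (\<lambda>w. (Max ((\<lambda>i. cmod (X i w)) ` {..length L}))\<^sup>2)"
    "(\<integral>w. (Max ((\<lambda>i. cmod (X i w)) ` {..length L}))\<^sup>2 \<partial>M) \<le>
      4 * (\<Sum>v\<in>words_between n N. incr_var g A v)"
proof -
  let ?W = "words_between n N"
  have L: "sorted L" "distinct L" "set L = ?W" by (auto simp: L_def)
  \<comment> \<open>All levels up to \<open>n\<close> are known from the start, so the ancestors
    above the listed words are never missing.\<close>
  define H where "H i = words_upto n \<union> set (take i L)" for i
  have H_ne: "H i \<subseteq> {u. u \<noteq> []}" for i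
    using L(3) set_take_subset[of i L] by (fastforce simp: H_def words_upto_def words_between_def)
  have anc: "take l (L ! j) \<in> H j" if j: "j < length L" and l: "l \<in> {1..<length (L ! j)}" for j l
  proof (cases "l \<le> n")
    case True
    with l show ?thesis by (auto simp: H_def words_upto_def)
  next
    case False
    let ?p = "take l (L ! j)"
    have "L ! j \<in> ?W" using j L(3) nth_mem by blast
    with False l have "?p \<in> set L" unfolding L(3) by (auto simp: words_between_def)
    then obtain k where k: "k < length L" "L ! k = ?p" by (auto simp: in_set_conv_nth)
    have "?p < L ! j" by (rule take_less_self) (use l in auto)
    then have "k < j"
      using sorted_nth_mono[OF L(1), of j k] k by (metis leD not_le_imp_less)
    with k have "?p \<in> set (take j L)" by (auto simp: in_set_conv_nth intro!: exI[of _ k])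
    then show ?thesis by (simp add: H_def)
  qed
  have H_mono: "H i \<subseteq> H j" if "i \<le> j" for i j
    using set_take_subset_set_take[OF that, of L] by (auto simp: H_def)
  have new: "L ! j \<notin> H j" "L ! j \<noteq> []" if "j < length L" for j
  proof -
    have w: "L ! j \<in> ?W" using that L(3) nth_mem by blast
    then show "L ! j \<noteq> []" by (auto simp: words_between_def)
    have "L ! j \<notin> set (take j L)"
      using that L(2) by (auto simp: in_set_conv_nth nth_eq_iff_index_eq)
    with w show "L ! j \<notin> H j" by (auto simp: H_def words_upto_def words_between_def)
  qed
  have X_Suc: "X (Suc i) w = X i w + incr g A (L ! i) w" if "i < length L" for i w
  proof -
    have "L ! i \<notin> set (take i L)" using new(1)[OF that] by (simp add: H_def)
    then show ?thesis using that by (simp add: X_def take_Suc_conv_app_nth)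
  qed
  have X_meas: "X j \<in> borel_measurable (hist (H i))" if "j \<le> i" for i j
    unfolding X_def
  proof (intro borel_measurable_sum)
    fix v assume "v \<in> set (take j L)"
    then obtain k where k: "k < j" "k < length L" "v = L ! k" by (auto simp: in_set_conv_nth)
    have "L ! k \<in> H (Suc k)" using k by (simp add: H_def take_Suc_conv_app_nth)
    moreover have "H (Suc k) \<subseteq> H i" "H k \<subseteq> H i" using k that by (auto intro!: H_mono)
    ultimately show "incr g A v \<in> borel_measurable (hist (H i))"
      unfolding k(3) using anc[OF k(2)] by (intro measurable_incr_hist) auto
  qed
  have XM [measurable]: "X i \<in> borel_measurable M" for i
    by (rule measurable_from_hist[OF H_ne X_meas[OF order_refl]])
  have X_sq: "integrable M (\<lambda>w. (cmod (X i w))\<^sup>2)" for i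
    unfolding X_def
  proof (rule integrable_cmod_square_sum)
    fix v assume "v \<in> set (take i L)"
    then have "v \<noteq> []" using L(3) set_take_subset[of i L] by (auto simp: words_between_def)
    then show "incr g A v \<in> borel_measurable M" "integrable M (\<lambda>w. (cmod (incr g A v w))\<^sup>2)"
      using measurable_incr incr_square(1)[OF g] by auto
  qed simp
  note orth = incr_orthogonal[OF g H_ne new anc]
  have o: "integrable M (\<lambda>w. Y w * (X (Suc i) w - X i w)) \<and> (\<integral>w. Y w * (X (Suc i) w - X i w) \<partial>M) = 0"
    if "i < length L" "Y \<in> borel_measurable (hist (H i))" "integrable M Y" for i and Y :: "'a \<Rightarrow> complex"
    using orth[OF that(1) that(1) that(1) _ that(2,3)] by (simp add: X_Suc[OF that(1)])
  \<comment> \<open>A single martingale is treated as a family over the one-point index set.\<close>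
  note doob = doob_L2_max_family[where P="\<lambda>i _. X i" and F="\<lambda>i. hist (H i)" and I="{()}" and N="length L"]
  have "integrable M (\<lambda>w. (Max ((\<lambda>i. Max ((\<lambda>z. cmod (X i w)) ` {()})) ` {..length L}))\<^sup>2)"
    by (rule doob(1)) (rule o measurable_from_hist[OF H_ne] X_meas X_sq | simp)+
  moreover have "(\<integral>w. (Max ((\<lambda>i. Max ((\<lambda>z. cmod (X i w)) ` {()})) ` {..length L}))\<^sup>2 \<partial>M) \<le>
      4 * (\<integral>w. (Max ((\<lambda>z. cmod (X (length L) w)) ` {()}))\<^sup>2 \<partial>M)"
    by (rule doob(2)) (rule o measurable_from_hist[OF H_ne] X_meas X_sq | simp)+
  \<comment> \<open>Pythagoras: the new increment is orthogonal to the sum of the previous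
    ones.\<close>
  moreover have norm: "i \<le> length L \<Longrightarrow>
      (\<integral>w. (cmod (X i w))\<^sup>2 \<partial>M) = (\<Sum>v\<in>set (take i L). incr_var g A v)" for i
  proof (induction i)
    case 0
    then show ?case by (simp add: X_def)
  next
    case (Suc i)
    then have i: "i < length L" by simp
    let ?d = "incr g A (L ! i)"
    have "integrable M (X i)"
      using integrable_of_square[of "\<lambda>w. cmod (X i w)"] X_sq[of i] XM[of i]
      by (simp add: integrable_norm_iff)
    then have cX: "integrable M (\<lambda>w. cnj (X i w))" by simp
    have "cnj \<in> borel_measurable borel"
      by (intro borel_measurable_continuous_onI continuous_intros)
    then have cXm: "(\<lambda>w. cnj (X i w)) \<in> borel_measurable (hist (H i))"
      using measurable_compose[OF X_meas[OF order_refl]] by blast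
    have o: "integrable M (\<lambda>w. cnj (X i w) * ?d w)" "(\<integral>w. cnj (X i w) * ?d w \<partial>M) = 0"
      using orth[OF i i i _ cXm cX] by auto
    have oR: "integrable M (\<lambda>w. Re (cnj (X i w) * ?d w))" "(\<integral>w. Re (cnj (X i w) * ?d w) \<partial>M) = 0"
    proof -
      show "integrable M (\<lambda>w. Re (cnj (X i w) * ?d w))" by (rule integrable_Re[OF o(1)])
      show "(\<integral>w. Re (cnj (X i w) * ?d w) \<partial>M) = 0" unfolding integral_Re[OF o(1)] o(2) by simp
    qed
    have "(\<integral>w. (cmod (X (Suc i) w))\<^sup>2 \<partial>M) =
        (\<integral>w. (cmod (X i w))\<^sup>2 + (cmod (?d w))\<^sup>2 + 2 * Re (cnj (X i w) * ?d w) \<partial>M)"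
      by (simp only: X_Suc[OF i] cmod_add_square)
    also have "\<dots> = (\<integral>w. (cmod (X i w))\<^sup>2 \<partial>M) + (\<integral>w. (cmod (?d w))\<^sup>2 \<partial>M) +
        2 * (\<integral>w. Re (cnj (X i w) * ?d w) \<partial>M)"
      using X_sq[of i] incr_square(1)[OF g new(2)[OF i], of A] oR(1)
      by (simp only: Bochner_Integration.integral_add Bochner_Integration.integrable_add
          integral_mult_right_zero integrable_mult_right)
    also have "\<dots> = (\<Sum>v\<in>set (take (Suc i) L). incr_var g A v)"
    proof -
      have "L ! i \<notin> set (take i L)" using new(1)[OF i] by (simp add: H_def)
      then show ?thesis using Suc i oR(2) by (simp add: take_Suc_conv_app_nth)
    qed
    finally show ?case .
  qed
  moreover have "(\<integral>w. (cmod (X (length L) w))\<^sup>2 \<partial>M) =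
      (\<Sum>v\<in>?W. incr_var g A v)" using norm[of "length L"] by (simp add: L(3))
  ultimately show "integrable M (\<lambda>w. (Max ((\<lambda>i. cmod (X i w)) ` {..length L}))\<^sup>2)"
    "(\<integral>w. (Max ((\<lambda>i. cmod (X i w)) ` {..length L}))\<^sup>2 \<partial>M) \<le>
      4 * (\<Sum>v\<in>?W. incr_var g A v)"
    by auto
qed

lemma psum_spatial_max:
  assumes g: "0 \<le> g" and Z: "finite Z" "Z \<noteq> {}"
  shows "(\<integral>w. (Max ((\<lambda>z. cmod (psum g A n N z w)) ` Z))\<^sup>2 \<partial>M) \<le>
      4 * (\<Sum>v\<in>words_between n N. incr_var g A v)"
proof -
  let ?L = "sorted_list_of_set (words_between n N)"
  let ?X = "\<lambda>i w. \<Sum>v\<in>set (take i ?L). incr g A v w"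
  note lex = lex_partial_sums[OF g, where n=n and N=N and A=A]
  have le: "Max ((\<lambda>z. cmod (psum g A n N z w)) ` Z) \<le> Max ((\<lambda>i. cmod (?X i w)) ` {..length ?L})" for w
  proof (rule Max.boundedI)
    fix a assume "a \<in> (\<lambda>z. cmod (psum g A n N z w)) ` Z"
    then obtain z where a: "a = cmod (psum g A n N z w)" by auto
    obtain i where i: "i \<le> length ?L" "set (take i ?L) = {v\<in>set ?L. v \<le> z}"
      using ex_take_sorted_eq[of ?L z] by auto
    then have "a = cmod (?X i w)" by (simp add: a psum_def)
    with i(1) show "a \<le> Max ((\<lambda>i. cmod (?X i w)) ` {..length ?L})" by (intro Max_ge) auto
  qed (use Z in auto)
  have "0 \<le> Max ((\<lambda>z. cmod (psum g A n N z w)) ` Z)" for w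
    using Z by (subst Max_ge_iff) auto
  then have "(\<integral>w. (Max ((\<lambda>z. cmod (psum g A n N z w)) ` Z))\<^sup>2 \<partial>M) \<le>
      (\<integral>w. (Max ((\<lambda>i. cmod (?X i w)) ` {..length ?L}))\<^sup>2 \<partial>M)"
    using le lex(1) by (intro integral_mono_AE') (auto intro!: power_mono)
  with lex(2) show ?thesis by linarith
qed

text \<open>\<open>z\<close> has the final length \<open>n + j\<close> at every intermediate level,
  so the index set stays fixed in time, as the maximal inequality for families requires.\<close>

definition block_max :: "real \<Rightarrow> real \<Rightarrow> nat \<Rightarrow> nat \<Rightarrow> 'a \<Rightarrow> real" where
  "block_max g A n j w = Max ((\<lambda>i. Max ((\<lambda>z. cmod (psum g A n (n + i) z w)) ` {z. length z = n + j})) ` {..j})"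

lemma words_nonempty: "{z::bool list. length z = n} \<noteq> {}"
  using length_replicate[of n True] by blast

lemma cmod_psum_le_block_max:
  "i \<le> j \<Longrightarrow> length z = n + j \<Longrightarrow> cmod (psum g A n (n + i) z w) \<le> block_max g A n j w"
  unfolding block_max_def
  by (rule order_trans[of _ "Max ((\<lambda>z. cmod (psum g A n (n + i) z w)) ` {z. length z = n + j})"])
    (auto intro!: Max_ge)

lemma measurable_block_max [measurable]: "block_max g A n j \<in> borel_measurable M"
  unfolding block_max_def by (intro borel_measurable_Max) (auto simp: words_nonempty)

text \<open>The constant 16 is a factor 4 for the maximum over levels times a factor 4 for the
  lexicographic exploration of space.\<close>

lemma block_max_square:
  assumes g: "0 \<le> g"
  shows "integrable M (\<lambda>w. (block_max g A n j w)\<^sup>2)"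
    "(\<integral>w. (block_max g A n j w)\<^sup>2 \<partial>M) \<le>
      16 * (\<Sum>v\<in>words_between n (n + j). incr_var g A v)"
proof -
  let ?Z = "{z::bool list. length z = n + j}"
  have o: "integrable M (\<lambda>w. Y w * (psum g A n (n + Suc i) z w - psum g A n (n + i) z w)) \<and>
      (\<integral>w. Y w * (psum g A n (n + Suc i) z w - psum g A n (n + i) z w) \<partial>M) = 0"
    if Y: "Y \<in> borel_measurable (hist_upto (n + i))" "integrable M Y"
    for i z and Y :: "'a \<Rightarrow> complex"
  proof -
    let ?S = "{v. length v = Suc (n + i) \<and> v \<le> z}"
    have fin: "finite ?S" by (rule finite_subset[of _ "{v::bool list. length v = Suc (n + i)}"]) auto
    have diff: "psum g A n (n + Suc i) z w - psum g A n (n + i) z w = (\<Sum>v\<in>?S. incr g A v w)" for w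
    proof -
      have "{v. v \<in> words_between n (n + Suc i) \<and> v \<le> z} = {v. v \<in> words_between n (n + i) \<and> v \<le> z} \<union> ?S"
        by (auto simp: words_between_def)
      moreover have "finite {v. v \<in> words_between n (n + i) \<and> v \<le> z}"
        by (rule finite_subset[OF _ finite_words_between]) auto
      moreover have "{v. v \<in> words_between n (n + i) \<and> v \<le> z} \<inter> ?S = {}"
        by (auto simp: words_between_def)
      ultimately have "psum g A n (n + Suc i) z w = psum g A n (n + i) z w + (\<Sum>v\<in>?S. incr g A v w)"
        unfolding psum_def using fin by (simp only: sum.union_disjoint)
      then show ?thesis by simp
    qed
    have o: "integrable M (\<lambda>w. Y w * incr g A v w)" "(\<integral>w. Y w * incr g A v w \<partial>M) = 0" if "v \<in> ?S" for v
    proof -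
      from that have "v \<noteq> []" by auto
      with that show "integrable M (\<lambda>w. Y w * incr g A v w)" "(\<integral>w. Y w * incr g A v w \<partial>M) = 0"
        using incr_orthogonal[OF g words_upto_nonempty _ _ _ Y, of v A] by (auto simp: words_upto_def)
    qed
    then show ?thesis
      unfolding diff sum_distrib_left
      by (intro conjI Bochner_Integration.integrable_sum o(1)) (simp_all add: Bochner_Integration.integral_sum o)
  qed
  note doob = doob_L2_max_family[where P="\<lambda>i z. psum g A n (n + i) z" and F="\<lambda>i. hist_upto (n + i)"
      and I="?Z" and N=j]
  have "integrable M (\<lambda>w. (block_max g A n j w)\<^sup>2)"
    unfolding block_max_def
    by (rule doob(1)) (rule o measurable_from_hist[OF words_upto_nonempty] measurable_psum_upto
        psum_square_integrable[OF g] words_nonempty finite_words | simp)+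
  moreover have "(\<integral>w. (block_max g A n j w)\<^sup>2 \<partial>M) \<le>
      4 * (\<integral>w. (Max ((\<lambda>z. cmod (psum g A n (n + j) z w)) ` ?Z))\<^sup>2 \<partial>M)"
    unfolding block_max_def
    by (rule doob(2)) (rule o measurable_from_hist[OF words_upto_nonempty] measurable_psum_upto
        psum_square_integrable[OF g] words_nonempty finite_words | simp)+
  moreover note psum_spatial_max[OF g, of ?Z A n "n + j"] words_nonempty[of "n + j"]
  ultimately show "integrable M (\<lambda>w. (block_max g A n j w)\<^sup>2)"
    "(\<integral>w. (block_max g A n j w)\<^sup>2 \<partial>M) \<le>
      16 * (\<Sum>v\<in>words_between n (n + j). incr_var g A v)"
    by auto
qed

text \<open>The variance of an increment is expressed at the parent. Words of depth in
  \<open>(n, n + j]\<close> have parents at levels \<open>n\<close> to \<open>n + j - 1\<close>,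
  each counted for two children.\<close>

lemma sum_incr_square:
  assumes g: "0 \<le> g"
  shows "ennreal (\<Sum>v\<in>words_between n (n + j). incr_var g A v) \<le>
    ennreal (2 * phase_var g) *
      (\<Sum>k\<in>{n..<n + j}. level_mean {- A..} k (\<lambda>x. ennreal (exp (- (2 * g - 1) * x))))"
proof (induction j)
  case 0
  have "words_between n n = {}" by (auto simp: words_between_def)
  then show ?case by simp
next
  case (Suc j)
  let ?E = "\<lambda>v. incr_var g A v"
  let ?l = "\<lambda>u. \<integral>\<^sup>+w. weight {- A..} u w * ennreal (exp (- (2 * g - 1) * V u w)) \<partial>M"
  have nn: "0 \<le> ?E v" for v by (rule integral_nonneg_AE) simp
  have "ennreal (\<Sum>v\<in>{v. length v = Suc (n + j)}. ?E v) = (\<Sum>v\<in>{v. length v = Suc (n + j)}. ennreal (?E v))"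
    using nn by simp
  also have "\<dots> \<le> (\<Sum>v\<in>{v. length v = Suc (n + j)}. ennreal (phase_var g) * ?l (butlast v))"
  proof (rule sum_mono)
    fix v :: "bool list" assume "v \<in> {v. length v = Suc (n + j)}"
    then have "v \<noteq> []" by auto
    then show "ennreal (?E v) \<le> ennreal (phase_var g) * ?l (butlast v)" by (rule incr_square(2)[OF g])
  qed
  also have "\<dots> = (\<Sum>u\<in>{u. length u = n + j}. 2 * (ennreal (phase_var g) * ?l u))"
    unfolding sum_words_Suc by (simp only: butlast_snoc sum_constant card_UNIV_bool of_nat_numeral)
  also have "\<dots> = ennreal (2 * phase_var g) * level_mean {- A..} (n + j) (\<lambda>x. ennreal (exp (- (2 * g - 1) * x)))"
  proof -
    have "ennreal (2 * phase_var g) = ennreal 2 * ennreal (phase_var g)"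
      by (rule ennreal_mult) (auto simp: phase_var_def)
    then show ?thesis by (simp add: level_mean_def sum_distrib_left mult.assoc)
  qed
  finally have new: "ennreal (\<Sum>v\<in>{v. length v = Suc (n + j)}. ?E v) \<le>
      ennreal (2 * phase_var g) * level_mean {- A..} (n + j) (\<lambda>x. ennreal (exp (- (2 * g - 1) * x)))" .
  have "ennreal (\<Sum>v\<in>words_between n (n + Suc j). ?E v) =
      ennreal (\<Sum>v\<in>words_between n (n + j). ?E v) + ennreal (\<Sum>v\<in>{v. length v = Suc (n + j)}. ?E v)"
    using nn by (simp add: sum_words_between_Suc sum_nonneg del: add_Suc_right)
  then show ?case using add_mono[OF Suc.IH new] by (simp add: distrib_left)
qed

lemma block_max_second_moment:
  assumes A: "0 \<le> A" and g: "1 / 2 < g"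
  shows "\<exists>K>0. \<forall>n\<ge>1. \<forall>j. (\<integral>w. (block_max g A n j w)\<^sup>2 \<partial>M) \<le> K * real n powr (- 1 / 5)"
proof -
  have g0: "0 \<le> g" using g by simp
  have pv: "0 < phase_var g" by (simp add: phase_var_def add_pos_pos)
  from level_mean_tail_le[OF A, of "2 * g - 1"] g obtain K where K: "K > 0"
    "\<And>n m. n \<ge> 1 \<Longrightarrow> (\<Sum>k\<in>{n..<m}. level_mean {- A..} k (\<lambda>x. ennreal (exp (- (2 * g - 1) * x)))) \<le>
      ennreal (K * real n powr (- 1 / 5))" by auto
  have "(\<integral>w. (block_max g A n j w)\<^sup>2 \<partial>M) \<le> (16 * (2 * phase_var g * K)) * real n powr (- 1 / 5)"
    if n: "n \<ge> 1" for n j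
  proof -
    let ?E = "\<Sum>v\<in>words_between n (n + j). incr_var g A v"
    have "ennreal ?E \<le> ennreal (2 * phase_var g) * ennreal (K * real n powr (- 1 / 5))"
      by (rule order_trans[OF sum_incr_square[OF g0]]) (intro mult_left_mono K(2) n, simp)
    also have "\<dots> = ennreal (2 * phase_var g * (K * real n powr (- 1 / 5)))"
      using K(1) pv by (subst ennreal_mult[symmetric]) auto
    finally have "?E \<le> 2 * phase_var g * (K * real n powr (- 1 / 5))"
      using K(1) pv by (simp add: ennreal_le_iff)
    with block_max_square(2)[OF g0, of A n j] show ?thesis by simp
  qed
  then show ?thesis using K(1) pv by (intro exI[of _ "16 * (2 * phase_var g * K)"]) auto
qed

text \<open>Chebyshev: the second moment is of order \<open>2 powr (- k / 5)\<close> and the squared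
  threshold is \<open>2 powr (- k / 10)\<close>, which leaves a summable
  \<open>2 powr (- k / 10)\<close>.\<close>

lemma AE_block_max:
  assumes A: "0 \<le> A" and g: "1 / 2 < g"
  shows "AE w in M. \<forall>\<^sub>F k in sequentially. block_max g A (2 ^ k) (2 ^ k) w < 2 powr (- real k / 20)"
proof -
  obtain K where K: "K > 0"
    "\<And>n j. n \<ge> 1 \<Longrightarrow> (\<integral>w. (block_max g A n j w)\<^sup>2 \<partial>M) \<le> K * real n powr (- 1 / 5)"
    using block_max_second_moment[OF A g] by blast
  define E where "E k = {w\<in>space M. 2 powr (- real k / 20) \<le> \<bar>block_max g A (2 ^ k) (2 ^ k) w\<bar>}" for k :: nat
  have E [measurable]: "E k \<in> sets M" for k unfolding E_def by measurable
  have le: "measure M (E k) \<le> K * (2 powr (- 1 / 10)) ^ k" for k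
  proof -
    have "measure M (E k) \<le> (\<integral>w. (block_max g A (2 ^ k) (2 ^ k) w)\<^sup>2 \<partial>M) / (2 powr (- real k / 20))\<^sup>2"
      unfolding E_def using block_max_square(1)[of g A "2 ^ k" "2 ^ k"] g
      by (intro second_moment_method) auto
    also have "\<dots> \<le> K * real (2 ^ k) powr (- 1 / 5) / (2 powr (- real k / 20))\<^sup>2"
      by (intro divide_right_mono K(2)) auto
    also have "\<dots> = K * (2 powr (- real k / 5) / 2 powr (- real k / 10))"
      by (simp add: powr_realpow[symmetric] powr_powr powr_power)
    also have "2 powr (- real k / 5) / 2 powr (- real k / 10) = 2 powr (- real k / 5 - - real k / 10)"
      by (rule powr_diff[symmetric])
    also have "\<dots> = 2 powr (real k * (- 1 / 10))" by (rule arg_cong[of _ _ "(powr) 2"]) simp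
    also have "\<dots> = (2 powr (- 1 / 10)) ^ k" by (rule powr_power[symmetric]) simp
    finally show ?thesis .
  qed
  have "AE w in M. \<forall>\<^sub>F k in sequentially. w \<in> space M - E k"
  proof (rule borel_cantelli_AE1)
    show "emeasure M (E k) < \<infinity>" for k by (simp add: emeasure_eq_measure)
    have s: "summable (\<lambda>k. K * (2 powr (- 1 / 10)) ^ k)"
      using powr_less_mono[of "- 1 / 10" 0 2] by (simp add: summable_mult summable_geometric)
    show "summable (\<lambda>k. measure M (E k))"
      using le by (intro summable_comparison_test'[OF s, of 0]) simp
  qed measurable
  then show ?thesis
  proof (rule AE_mp, intro AE_I2 impI)
    fix w assume "w \<in> space M" and ev: "\<forall>\<^sub>F k in sequentially. w \<in> space M - E k"
    from ev show "\<forall>\<^sub>F k in sequentially. block_max g A (2 ^ k) (2 ^ k) w < 2 powr (- real k / 20)"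
      by (rule eventually_mono) (auto simp: E_def)
  qed
qed

end

subsection \<open>Dyadic geometry\<close>

text \<open>The fraction of the dyadic interval of \<open>v\<close> lying to the left of
  \<open>t\<close>, that is, the distribution function of the uniform law on that interval.\<close>

definition hat :: "bool list \<Rightarrow> real \<Rightarrow> real" where
  "hat v t = max 0 (min 1 (2 ^ length v * (t - tz v)))"

lemma hat_bounds: "0 \<le> hat v t" "hat v t \<le> 1"
  by (auto simp: hat_def)

lemma tz_Nil [simp]: "tz [] = 0"
  by (simp add: tz_def)

lemma tz_snoc: "tz (u @ [b]) = tz u + (if b then 1 else 0) / 2 ^ (length u + 1)"
  by (simp add: tz_def nth_append cong: if_cong)

lemma tz_Cons: "tz (b # v) = (if b then 1 else 0) / 2 + tz v / 2"
  by (simp add: tz_def sum.lessThan_Suc_shift sum_divide_distrib del: sum.lessThan_Suc)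

lemma tz_nonneg: "0 \<le> tz v"
  by (simp add: tz_def sum_nonneg)

lemma tz_le: "tz v + 1 / 2 ^ length v \<le> 1"
  by (induction v) (auto simp: tz_Cons)

text \<open>At the first letter where they differ \<open>v\<close> goes left and \<open>z\<close>
  goes right; the whole interval of \<open>v\<close> then ends before that of \<open>z\<close>
  begins.\<close>

lemma less_imp_prefix_or_left:
  fixes v z :: "bool list"
  assumes "v < z"
  shows "v = take (length v) z \<or> tz v + 1 / 2 ^ length v \<le> tz z"
  using assms
proof (induction v arbitrary: z)
  case Nil
  then show ?case by simp
next
  case (Cons a v)
  then obtain b z' where z: "z = b # z'" by (cases z) auto
  show ?case
  proof (cases "a = b")
    case True
    with Cons z have "v < z'" by simp
    from Cons.IH[OF this] show ?thesis using True by (auto simp: z tz_Cons)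
  next
    case False
    with Cons.prems z have "\<not> a" "b" by auto
    then show ?thesis using tz_le[of v] tz_nonneg[of z'] by (simp add: z tz_Cons)
  qed
qed

lemma hat_eq_1: "tz v + 1 / 2 ^ length v \<le> t \<Longrightarrow> hat v t = 1"
  by (simp add: hat_def field_simps)

lemma hat_eq_0:
  assumes "t \<le> tz v"
  shows "hat v t = 0"
proof -
  have "2 ^ length v * (t - tz v) \<le> 0" using assms by (simp add: mult_nonneg_nonpos)
  then show ?thesis unfolding hat_def by linarith
qed

text \<open>A word that is not an ancestor of \<open>z\<close>, and not longer than
  \<open>z\<close>, has its interval entirely on one side of \<open>t\<close>, and the order tells
  which side.\<close>

lemma hat_eq_lex:
  assumes z: "tz z \<le> t" "t \<le> tz z + 1 / 2 ^ length z"
    and v: "length v \<le> length z" "v \<noteq> take (length v) z"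
  shows "hat v t = (if v \<le> z then 1 else 0)"
proof (cases "v < z")
  case True
  with less_imp_prefix_or_left[OF True] v z have "hat v t = 1" by (intro hat_eq_1) auto
  with True show ?thesis by simp
next
  case False
  then have "z < v" using v by (cases "z = v") auto
  moreover have "z \<noteq> take (length z) v"
  proof
    assume e: "z = take (length z) v"
    then have "length z = min (length v) (length z)" by (metis length_take min.commute)
    with v(1) have "length z = length v" by simp
    with e v(2) show False by simp
  qed
  ultimately have "hat v t = 0"
    using less_imp_prefix_or_left[of z v] z by (intro hat_eq_0) auto
  with \<open>z < v\<close> show ?thesis by simp
qed

text \<open>The children's intervals are the two halves of the parent's. Giving each child half the
  parent's mass therefore reproduces the parent's contribution, which is what makes the
  \<open>incr\<close> sums telescope.\<close>

lemma hat_children: "hat (u @ [False]) t + hat (u @ [True]) t = 2 * hat u t"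
proof -
  let ?y = "2 ^ length u * (t - tz u)"
  have h0: "hat (u @ [False]) t = max 0 (min 1 (2 * ?y))"
    by (simp add: hat_def tz_snoc mult.assoc)
  have h1: "hat (u @ [True]) t = max 0 (min 1 (2 * ?y - 1))"
  proof -
    have "2 ^ (length u + 1) * (t - (tz u + 1 / 2 ^ (length u + 1))) = 2 * ?y - 1"
      by (simp add: right_diff_distrib distrib_left)
    then show ?thesis by (simp add: hat_def tz_snoc)
  qed
  have id: "max 0 (min 1 (2 * y)) + max 0 (min 1 (2 * y - 1)) = 2 * max 0 (min 1 y)" for y :: real
  proof -
    consider "y \<le> 0" | "0 < y" "2 * y \<le> 1" | "1 < 2 * y" "y \<le> 1" | "1 < y" by linarith
    then show ?thesis by cases (simp_all add: max_def min_def)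
  qed
  show ?thesis unfolding h0 h1 id hat_def[of u] ..
qed

lemma hat_lipschitz: "\<bar>hat v t - hat v s\<bar> \<le> 2 ^ length v * \<bar>t - s\<bar>"
proof -
  have "\<bar>max 0 (min 1 a) - max 0 (min 1 b)\<bar> \<le> \<bar>a - b\<bar>" for a b :: real
    by linarith
  from this[of "2 ^ length v * (t - tz v)" "2 ^ length v * (s - tz v)"]
  show ?thesis by (simp add: hat_def right_diff_distrib[symmetric] abs_mult)
qed

lemma ex_dyadic_interval:
  assumes "0 \<le> t" "t \<le> 1"
  shows "\<exists>z. length z = N \<and> tz z \<le> t \<and> t \<le> tz z + 1 / 2 ^ N"
  using assms
proof (induction N arbitrary: t)
  case 0
  then show ?case by (intro exI[of _ "[]"]) simp
next
  case (Suc N)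
  show ?case
  proof (cases "t \<le> 1 / 2")
    case True
    with Suc.prems Suc.IH[of "2 * t"] obtain z where "length z = N" "tz z \<le> 2 * t" "2 * t \<le> tz z + 1 / 2 ^ N"
      by auto
    then show ?thesis by (intro exI[of _ "False # z"]) (simp add: tz_Cons field_simps)
  next
    case False
    with Suc.prems Suc.IH[of "2 * t - 1"] obtain z where "length z = N" "tz z \<le> 2 * t - 1" "2 * t - 1 \<le> tz z + 1 / 2 ^ N"
      by auto
    then show ?thesis by (intro exI[of _ "True # z"]) (simp add: tz_Cons field_simps)
  qed
qed

lemma has_integral_dyadic_step:
  fixes k :: complex
  assumes "0 \<le> t"
  shows "((\<lambda>x. k * (if x \<in> {tz z <.. tz z + 1 / 2 ^ length z} then 1 else 0) * 2 ^ length z)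
    has_integral k * complex_of_real (hat z t)) {0..t}"
proof -
  let ?a = "tz z" and ?n = "length z"
  let ?c = "min (?a + 1 / 2 ^ ?n) t"
  let ?K = "k * 2 ^ ?n"
  show ?thesis
  proof (cases "?a \<le> ?c")
    case True
    have "((\<lambda>x. ?K) has_integral (?c - ?a) *\<^sub>R ?K) {?a..?c}"
      using has_integral_const_real[of ?K ?a ?c] True by simp
    then have "((\<lambda>x. if x \<in> {?a..?c} then ?K else 0) has_integral (?c - ?a) *\<^sub>R ?K) {0..t}"
      using tz_nonneg[of z] by (subst has_integral_restrict) auto
    then have "((\<lambda>x. k * (if x \<in> {?a <.. ?a + 1 / 2 ^ ?n} then 1 else 0) * 2 ^ ?n) has_integral (?c - ?a) *\<^sub>R ?K) {0..t}"
      \<comment> \<open>The half-open and the closed interval differ only at the left endpoint,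
        which integration ignores.\<close>
      by (rule has_integral_spike_finite[rotated 2, where S="{?a}"]) auto
    moreover have "(?c - ?a) *\<^sub>R ?K = k * complex_of_real (hat z t)"
    proof -
      have "hat z t = 2 ^ ?n * (?c - ?a)"
      proof (cases "?a + 1 / 2 ^ ?n \<le> t")
        case True
        then show ?thesis using hat_eq_1[OF True] by (simp add: min_def)
      next
        case False
        with True have "?a \<le> t" by (simp add: min_def)
        with False have "2 ^ ?n * (t - ?a) \<le> 1" "0 \<le> 2 ^ ?n * (t - ?a)"
          by (auto simp: field_simps)
        with False show ?thesis by (simp add: hat_def min_def)
      qed
      then show ?thesis by (simp add: scaleR_conv_of_real mult_ac)
    qed
    ultimately show ?thesis by simp
  next
    case False
    then have t: "t < ?a" by (simp add: min_def split: if_splits)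
    then have "hat z t = 0" by (intro hat_eq_0) simp
    moreover have "((\<lambda>x. k * (if x \<in> {?a <.. ?a + 1 / 2 ^ ?n} then 1 else 0) * 2 ^ ?n) has_integral 0) {0..t}"
      by (rule has_integral_is_0) (use t in auto)
    ultimately show ?thesis by simp
  qed
qed

lemma sum_hat_children:
  fixes e :: "bool list \<Rightarrow> complex"
  shows "(\<Sum>v\<in>{v. length v = Suc m}. (e v - e (butlast v) / 2) * complex_of_real (hat v t)) =
    (\<Sum>v\<in>{v. length v = Suc m}. e v * complex_of_real (hat v t)) -
    (\<Sum>u\<in>{u. length u = m}. e u * complex_of_real (hat u t))"
proof -
  have "(\<Sum>b\<in>UNIV. e u / 2 * complex_of_real (hat (u @ [b]) t)) = e u * complex_of_real (hat u t)" for u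
  proof -
    have "(\<Sum>b\<in>UNIV. e u / 2 * complex_of_real (hat (u @ [b]) t)) =
        e u / 2 * complex_of_real (hat (u @ [False]) t + hat (u @ [True]) t)"
      by (simp add: UNIV_bool algebra_simps)
    then show ?thesis unfolding hat_children by simp
  qed
  then have "(\<Sum>v\<in>{v. length v = Suc m}. e (butlast v) / 2 * complex_of_real (hat v t)) =
      (\<Sum>u\<in>{u. length u = m}. e u * complex_of_real (hat u t))"
    unfolding sum_words_Suc by (simp only: butlast_snoc)
  then show ?thesis by (simp only: left_diff_distrib sum_subtractf)
qed

subsection \<open>From increments along dyadic blocks to the modulus of continuity\<close>

text \<open>Chaining through the powers of two between \<open>2 ^ k\<close> and \<open>m\<close>.
  The complete blocks sum to a geometric series and the last, incomplete block is bounded by the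
  same quantity; hence the factor 2.\<close>

lemma dyadic_blocks_tail:
  fixes F :: "nat \<Rightarrow> real \<Rightarrow> complex"
  assumes r: "0 < r" "r < 1" and C: "0 \<le> C"
    and blk: "\<And>k m t. \<lbrakk>K \<le> k; 2 ^ k \<le> m; m \<le> 2 ^ Suc k; t \<in> T\<rbrakk> \<Longrightarrow>
      cmod (F m t - F (2 ^ k) t) \<le> C * r ^ k"
    and k: "K \<le> k" and m: "2 ^ k \<le> m" and t: "t \<in> T"
  shows "cmod (F m t - F (2 ^ k) t) \<le> 2 * C / (1 - r) * r ^ k"
proof -
  have chain: "cmod (F (2 ^ (k + j)) t - F (2 ^ k) t) \<le> (\<Sum>i<j. C * r ^ (k + i))" for j
  proof (induction j)
    case 0
    then show ?case by simp
  next
    case (Suc j)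
    have "cmod (F (2 ^ (k + Suc j)) t - F (2 ^ k) t) \<le>
        cmod (F (2 ^ (k + Suc j)) t - F (2 ^ (k + j)) t) + cmod (F (2 ^ (k + j)) t - F (2 ^ k) t)"
      using norm_triangle_ineq[of "F (2 ^ (k + Suc j)) t - F (2 ^ (k + j)) t" "F (2 ^ (k + j)) t - F (2 ^ k) t"]
      by simp
    also have "\<dots> \<le> C * r ^ (k + j) + (\<Sum>i<j. C * r ^ (k + i))"
      using blk[of "k + j" "2 ^ (k + Suc j)" t] k t Suc by (intro add_mono) auto
    finally show ?case by simp
  qed
  have geo: "(\<Sum>i<j. C * r ^ (k + i)) \<le> C / (1 - r) * r ^ k" for j
  proof -
    have "(\<Sum>i<j. C * r ^ (k + i)) = C * r ^ k * (\<Sum>i<j. r ^ i)"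
      by (simp add: power_add sum_distrib_left mult_ac)
    also have "(\<Sum>i<j. r ^ i) = (1 - r ^ j) / (1 - r)"
      using r by (simp add: sum_gp_strict)
    also have "C * r ^ k * ((1 - r ^ j) / (1 - r)) \<le> C * r ^ k * (1 / (1 - r))"
      using r C by (intro mult_left_mono divide_right_mono) auto
    finally show ?thesis by (simp add: mult_ac)
  qed
  have m1: "1 \<le> m" using m by (metis one_le_numeral one_le_power order_trans)
  obtain l where l: "2 ^ l \<le> m" "m < 2 ^ (l + 1)" using ex_power_ivl1[of 2 m] m1 by auto
  have "k < l + 1"
    using m l(2) by (metis le_less_trans one_less_numeral_iff power_less_imp_less_exp semiring_norm(76))
  then obtain j where j: "l = k + j" using le_iff_add by (metis less_Suc_eq_le add.commute plus_1_eq_Suc)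
  have "cmod (F m t - F (2 ^ k) t) \<le> cmod (F m t - F (2 ^ l) t) + cmod (F (2 ^ l) t - F (2 ^ k) t)"
    using norm_triangle_ineq[of "F m t - F (2 ^ l) t" "F (2 ^ l) t - F (2 ^ k) t"] by simp
  also have "\<dots> \<le> C * r ^ l + C / (1 - r) * r ^ k"
  proof (intro add_mono)
    show "cmod (F m t - F (2 ^ l) t) \<le> C * r ^ l" using blk[of l m t] l k t j by auto
    show "cmod (F (2 ^ l) t - F (2 ^ k) t) \<le> C / (1 - r) * r ^ k"
      using chain[of j] geo[of j] unfolding j by (rule order_trans)
  qed
  also have "C * r ^ l \<le> C / (1 - r) * r ^ k"
  proof -
    have "r ^ l \<le> r ^ k" using r j by (intro power_decreasing) auto
    moreover have "C \<le> C / (1 - r)" using r C by (simp add: field_simps)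
    ultimately show ?thesis using r C by (intro mult_mono) auto
  qed
  finally show ?thesis by simp
qed

text \<open>\<open>y <= exp y\<close> at \<open>y = L / (2 * x)\<close>, raised to the power
  \<open>x\<close>.\<close>

lemma exp_half_le_powr:
  fixes L x :: real
  assumes "0 < L" "0 < x"
  shows "exp (- L / 2) \<le> (2 * x) powr x * L powr (- x)"
proof -
  have "L / (2 * x) \<le> exp (L / (2 * x))"
    using exp_ge_add_one_self[of "L / (2 * x)"] by linarith
  then have "L \<le> 2 * x * exp (L / (2 * x))" using assms by (simp add: field_simps)
  then have "L powr x \<le> (2 * x * exp (L / (2 * x))) powr x" using assms by (intro powr_mono2) auto
  also have "\<dots> = (2 * x) powr x * exp (L / 2)"
    using assms by (simp add: powr_mult exp_powr_real)
  finally have le: "L powr x \<le> (2 * x) powr x * exp (L / 2)" .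
  have "exp (- L / 2) = L powr x * (L powr (- x) * exp (- L / 2))"
    using assms by (simp add: mult.assoc[symmetric] powr_add[symmetric])
  also have "\<dots> \<le> (2 * x) powr x * exp (L / 2) * (L powr (- x) * exp (- L / 2))"
    using le by (rule mult_right_mono) simp
  also have "\<dots> = (2 * x) powr x * L powr (- x) * (exp (L / 2) * exp (- L / 2))"
    by (simp only: mult_ac)
  also have "exp (L / 2) * exp (- L / 2) = 1" by (simp add: exp_add[symmetric])
  finally show ?thesis by simp
qed

text \<open>Replacing the limit by level \<open>2 ^ k\<close> costs a multiple of
  \<open>(2 ^ k) powr (- xi)\<close>, and the Lipschitz bound then costs
  \<open>4 ^ (2 ^ k) * d\<close>. With \<open>2 ^ k\<close> a small multiple of
  \<open>ln (1 + 1 / d)\<close> the second cost is of order \<open>sqrt d\<close> and the first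
  gives the logarithmic modulus.\<close>

lemma uniform_limit_log_modulus:
  fixes F :: "nat \<Rightarrow> real \<Rightarrow> complex"
  assumes \<xi>: "0 < \<xi>" and C: "0 \<le> C" and B: "0 \<le> B"
    and blk: "\<And>k m t. \<lbrakk>K \<le> k; 2 ^ k \<le> m; m \<le> 2 ^ Suc k; t \<in> {0..1}\<rbrakk> \<Longrightarrow>
      cmod (F m t - F (2 ^ k) t) \<le> C * (2 powr (- \<xi>)) ^ k"
    and lip: "\<And>n s t. \<lbrakk>s \<in> {0..1}; t \<in> {0..1}\<rbrakk> \<Longrightarrow> cmod (F n t - F n s) \<le> B * 4 ^ n * \<bar>t - s\<bar>"
  shows "\<exists>G. continuous_on {0..1} G \<and> uniform_limit {0..1} F G sequentially"
    "uniform_limit {0..1} F G sequentially \<Longrightarrow>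
      \<exists>C'>0. \<forall>s\<in>{0..1}. \<forall>t\<in>{0..1}. s \<noteq> t \<longrightarrow> cmod (G t - G s) \<le> C' * ln (1 + 1 / \<bar>t - s\<bar>) powr (- \<xi>)"
proof -
  let ?r = "2 powr (- \<xi>)"
  have r: "0 < ?r" "?r < 1" using powr_less_mono[of "- \<xi>" 0 2] \<xi> by auto
  define D where "D = 2 * C / (1 - ?r)"
  have D: "0 \<le> D" using C r by (simp add: D_def)
  have tail: "cmod (F m t - F (2 ^ k) t) \<le> D * ?r ^ k" if "K \<le> k" "2 ^ k \<le> m" "t \<in> {0..1}" for k m t
    unfolding D_def by (rule dyadic_blocks_tail[OF r C blk]) (use that in auto)
  have cont: "continuous_on {0..1} (F n)" for n
  proof (rule lipschitz_on_continuous_on)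
    show "(B * 4 ^ n)-lipschitz_on {0..1} (F n)"
      using lip[of _ _ n] B by (intro lipschitz_onI) (auto simp: dist_norm)
  qed
  have limD: "continuous_on {0..1} G" if "uniform_limit {0..1} F G sequentially" for G
    by (rule uniform_limit_theorem[OF _ that]) (auto simp: cont)
  have "uniformly_Cauchy_on {0..1} F"
  proof (rule uniformly_Cauchy_onI)
    fix e :: real assume e: "0 < e"
    have "(\<lambda>k. 2 * D * ?r ^ k) \<longlonglongrightarrow> 2 * D * 0"
      using r by (intro tendsto_mult tendsto_const LIMSEQ_power_zero) auto
    then have "\<forall>\<^sub>F k in sequentially. 2 * D * ?r ^ k < e" using e by (intro order_tendstoD) auto
    with eventually_ge_at_top[of K] have "\<forall>\<^sub>F k in sequentially. 2 * D * ?r ^ k < e \<and> K \<le> k" by eventually_elim auto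
    then obtain k where k: "2 * D * ?r ^ k < e" "K \<le> k" by (auto simp: eventually_sequentially)
    have "dist (F m t) (F n t) < e" if "t \<in> {0..1}" "2 ^ k \<le> m" "2 ^ k \<le> n" for t m n
    proof -
      have "dist (F m t) (F n t) \<le> dist (F m t) (F (2 ^ k) t) + dist (F n t) (F (2 ^ k) t)"
        by (rule dist_triangle2)
      also have "\<dots> \<le> D * ?r ^ k + D * ?r ^ k"
        using tail[OF k(2) that(2,1)] tail[OF k(2) that(3,1)] by (intro add_mono) (auto simp: dist_norm)
      finally show ?thesis using k(1) by simp
    qed
    then show "\<exists>M. \<forall>x\<in>{0..1}. \<forall>m\<ge>M. \<forall>n\<ge>M. dist (F m x) (F n x) < e" by blast
  qed
  then obtain G0 where "uniform_limit {0..1} F G0 sequentially"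
    using Cauchy_uniformly_convergent by (auto simp: uniformly_convergent_on_def)
  with limD show "\<exists>G. continuous_on {0..1} G \<and> uniform_limit {0..1} F G sequentially" by blast
  assume G: "uniform_limit {0..1} F G sequentially"
  have Gtail: "cmod (G t - F (2 ^ k) t) \<le> D * ?r ^ k" if "K \<le> k" "t \<in> {0..1}" for k t
  proof (rule tendsto_upperbound)
    show "(\<lambda>m. cmod (F m t - F (2 ^ k) t)) \<longlonglongrightarrow> cmod (G t - F (2 ^ k) t)"
      using tendsto_uniform_limitI[OF G that(2)] by (intro tendsto_intros)
    show "\<forall>\<^sub>F m in sequentially. cmod (F m t - F (2 ^ k) t) \<le> D * ?r ^ k"
      using eventually_ge_at_top[of "2 ^ k"] by eventually_elim (rule tail[OF that(1) _ that(2)])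
  qed simp
  have "compact (G ` {0..1})" using limD[OF G] by (rule compact_continuous_image) simp
  then obtain b where b: "b > 0" "\<And>t. t \<in> {0..1} \<Longrightarrow> cmod (G t) \<le> b"
    using compact_imp_bounded[of "G ` {0..1}"] by (auto simp: bounded_pos)
  \<comment> \<open>The threshold at which \<open>x\<close> below reaches \<open>2 ^ K\<close>, so
    that the block estimates apply; for smaller \<open>L\<close> the boundedness of \<open>G\<close>
    suffices.\<close>
  define L0 where "L0 = 2 * ln 4 * (2::real) ^ K"
  \<comment> \<open>One term for the pairs with \<open>L < L0\<close>, one for the two approximation
    errors, one for the Lipschitz bound.\<close>
  define C' where "C' = 2 * b * L0 powr \<xi> + 2 * D * (4 * ln 4) powr \<xi> + B * (2 * (2 * \<xi>) powr \<xi>)"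
  have L0: "0 < L0" by (simp add: L0_def)
  have C': "0 < C'" unfolding C'_def using b L0 D B by (intro add_pos_nonneg) auto
  have "cmod (G t - G s) \<le> C' * ln (1 + 1 / \<bar>t - s\<bar>) powr (- \<xi>)"
    if st: "s \<in> {0..1}" "t \<in> {0..1}" "s \<noteq> t" for s t
  proof -
    define d where "d = \<bar>t - s\<bar>"
    define L where "L = ln (1 + 1 / d)"
    have d: "0 < d" "d \<le> 1" using st by (auto simp: d_def)
    have eL: "exp L = 1 + 1 / d" using d by (simp add: L_def add_pos_pos)
    have L: "0 < L" unfolding L_def using d by (intro ln_gt_zero) simp
    show ?thesis
    proof (cases "L < L0")
      case True
      have "cmod (G t - G s) \<le> cmod (G t) + cmod (G s)" by (rule norm_triangle_ineq4)
      also have "\<dots> \<le> b + b" using b(2) st by (intro add_mono) auto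
      also have "\<dots> \<le> 2 * b * L0 powr \<xi> * L powr (- \<xi>)"
      proof -
        have "L powr \<xi> \<le> L0 powr \<xi>" using True L \<xi> by (intro powr_mono2) auto
        then have "L powr \<xi> * L powr (- \<xi>) \<le> L0 powr \<xi> * L powr (- \<xi>)" by (rule mult_right_mono) simp
        moreover have "L powr \<xi> * L powr (- \<xi>) = 1" using L by (simp add: powr_add[symmetric])
        ultimately have "2 * b * 1 \<le> 2 * b * (L0 powr \<xi> * L powr (- \<xi>))" using b by (intro mult_left_mono) auto
        then show ?thesis by (simp add: mult_ac)
      qed
      also have "\<dots> \<le> C' * L powr (- \<xi>)"
        using D B by (intro mult_right_mono) (auto simp: C'_def)
      finally show ?thesis by (simp add: L_def d_def)
    next
      case False
      \<comment> \<open>\<open>2 ^ k\<close> will be the largest power of two not above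
        \<open>x\<close>: then \<open>4 ^ (2 ^ k) <= exp (L / 2)\<close>, half of what
        \<open>d <= 2 * exp (- L)\<close> can absorb, while \<open>2 ^ k\<close> stays of order
        \<open>L\<close>.\<close>
      define x where "x = L / (2 * ln 4)"
      have xK: "2 ^ K \<le> x" using False by (simp add: x_def L0_def field_simps)
      then have x1: "1 \<le> x" using one_le_power[of "2::real" K] by linarith
      then have "1 \<le> nat \<lfloor>x\<rfloor>" by (simp add: le_nat_floor)
      then obtain k where k: "2 ^ k \<le> nat \<lfloor>x\<rfloor>" "nat \<lfloor>x\<rfloor> < 2 ^ (k + 1)" using ex_power_ivl1[of 2] by force
      have k1: "2 ^ k \<le> x"
        using k(1) x1 by (metis le_nat_floor le_floor_iff nat_le_real_less of_nat_floor of_nat_le_iff of_nat_numeral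
            of_nat_power order_trans zero_le_one)
      have k2: "x < 2 ^ (k + 1)"
        using k(2) x1 by (metis floor_less_iff nat_less_iff of_int_of_nat_eq of_nat_numeral of_nat_power
            order_trans zero_le_floor zero_le_one)
      have "(2::real) ^ K < 2 ^ (k + 1)" using xK k2 by linarith
      then have "K < k + 1" by (rule power_less_imp_less_exp[rotated]) simp
      then have kK: "K \<le> k" by simp
      have "cmod (G t - G s) \<le> cmod (G t - F (2 ^ k) t) + cmod (F (2 ^ k) t - F (2 ^ k) s) + cmod (G s - F (2 ^ k) s)"
        using norm_triangle_ineq[of "G t - F (2 ^ k) t + (F (2 ^ k) t - F (2 ^ k) s)" "F (2 ^ k) s - G s"]
          norm_triangle_ineq[of "G t - F (2 ^ k) t" "F (2 ^ k) t - F (2 ^ k) s"]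
        by (simp add: norm_minus_commute)
      also have "\<dots> \<le> D * ?r ^ k + B * 4 ^ (2 ^ k) * d + D * ?r ^ k"
        unfolding d_def using Gtail[OF kK] lip st by (intro add_mono) auto
      finally have main: "cmod (G t - G s) \<le> D * ?r ^ k + B * 4 ^ (2 ^ k) * d + D * ?r ^ k" .
      have e4: "4 ^ (2 ^ k) * d \<le> 2 * exp (- L / 2)"
      proof -
        have "(4::real) ^ (2 ^ k) = exp (ln 4 * 2 ^ k)"
          using exp_of_nat_mult[of "2 ^ k" "ln 4 :: real"] by (simp add: mult.commute)
        also have "\<dots> \<le> exp (L / 2)" using k1 by (simp add: x_def field_simps)
        finally have "4 ^ (2 ^ k) * d \<le> exp (L / 2) * d" using d by (intro mult_right_mono) auto
        also have "d \<le> 2 * exp (- L)"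
        proof -
          have "d * exp L \<le> 2" using d by (simp add: eL distrib_left)
          then show ?thesis by (simp add: exp_minus field_simps)
        qed
        then have "exp (L / 2) * d \<le> exp (L / 2) * (2 * exp (- L))" by (rule mult_left_mono) simp
        also have "\<dots> = 2 * exp (- L / 2)" by (simp add: exp_add[symmetric])
        finally show ?thesis .
      qed
      from e4 have "B * 4 ^ (2 ^ k) * d \<le> B * (2 * exp (- L / 2))" using B by (simp add: mult_left_mono mult.assoc)
      also have "\<dots> \<le> B * (2 * ((2 * \<xi>) powr \<xi> * L powr (- \<xi>)))"
        using exp_half_le_powr[OF L \<xi>] B by (intro mult_left_mono) auto
      finally have b1: "B * 4 ^ (2 ^ k) * d \<le> B * (2 * (2 * \<xi>) powr \<xi>) * L powr (- \<xi>)" by (simp add: mult_ac)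
      have "?r ^ k = (2 ^ k) powr (- \<xi>)"
        by (simp add: powr_power powr_realpow[symmetric] powr_powr mult.commute)
      also have "\<dots> \<le> (L / (4 * ln 4)) powr (- \<xi>)"
        using k2 L \<xi> by (intro powr_mono2') (auto simp: x_def field_simps)
      also have "\<dots> = (4 * ln 4) powr \<xi> * L powr (- \<xi>)"
        using L by (simp add: powr_divide powr_minus field_simps)
      finally have "D * ?r ^ k \<le> D * ((4 * ln 4) powr \<xi> * L powr (- \<xi>))" using D by (rule mult_left_mono)
      with b1 main have "cmod (G t - G s) \<le>
          (2 * D * (4 * ln 4) powr \<xi> + B * (2 * (2 * \<xi>) powr \<xi>)) * L powr (- \<xi>)"
        by (simp add: algebra_simps)
      also have "\<dots> \<le> C' * L powr (- \<xi>)"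
        using b L0 by (intro mult_right_mono) (auto simp: C'_def)
      finally show ?thesis by (simp add: L_def d_def)
    qed
  qed
  with C' show "\<exists>C'>0. \<forall>s\<in>{0..1}. \<forall>t\<in>{0..1}. s \<noteq> t \<longrightarrow>
      cmod (G t - G s) \<le> C' * ln (1 + 1 / \<bar>t - s\<bar>) powr (- \<xi>)" by blast
qed

subsection \<open>Convergence of the distribution functions\<close>

context cascade
begin

lemma Mn_eq_sum_hat:
  assumes "0 \<le> t"
  shows "Mn Theta g (1 - g) n w t =
    (\<Sum>z\<in>{z. length z = n}. mass g z w * complex_of_real (hat z t))"
proof -
  have "(Mn_density Theta g (1 - g) n w has_integral
      (\<Sum>z\<in>{z. length z = n}. mass g z w * complex_of_real (hat z t))) {0..t}"
    unfolding Mn_density_def[abs_def]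
  proof (rule has_integral_sum)
    fix z :: "bool list" assume "z \<in> {z. length z = n}"
    then show "((\<lambda>x. exp (complex_of_real (- g * Vw Theta z w) +
        \<i> * complex_of_real ((1 - g) * sqrt (2 * ln 2) * Xw Theta z w)) *
        (if x \<in> {tz z<..tz z + 1 / 2 ^ n} then 1 else 0) * 2 ^ n) has_integral
        mass g z w * complex_of_real (hat z t)) {0..t}"
      using has_integral_dyadic_step[OF assms, of "mass g z w" z]
      by (simp only: phase_def Vw_def Xw_def mem_Collect_eq)
  qed simp
  then show ?thesis unfolding Mn_def by (rule integral_unique)
qed

text \<open>On the event that no particle meets the barrier the killed increments are the true ones,
  so the killed martingale describes \<open>Mn\<close> itself.\<close>

lemma Mn_diff_eq_sum_incr:
  assumes al: "\<And>u. alive {- A..} u w" and "0 \<le> t"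
  shows "Mn Theta g (1 - g) (n + j) w t - Mn Theta g (1 - g) n w t =
    (\<Sum>v\<in>words_between n (n + j). incr g A v w * complex_of_real (hat v t))"
proof (induction j)
  case 0
  have "words_between n n = {}" by (auto simp: words_between_def)
  then show ?case by simp
next
  case (Suc j)
  let ?F = "\<lambda>m. Mn Theta g (1 - g) m w t"
  have "(\<Sum>v\<in>words_between n (n + Suc j). incr g A v w * complex_of_real (hat v t)) =
      (\<Sum>v\<in>words_between n (n + j). incr g A v w * complex_of_real (hat v t)) +
      (\<Sum>v\<in>{v. length v = Suc (n + j)}. incr g A v w * complex_of_real (hat v t))"
    by (rule sum_words_between_Suc)
  also have "(\<Sum>v\<in>{v. length v = Suc (n + j)}. incr g A v w * complex_of_real (hat v t)) =
      (\<Sum>v\<in>{v. length v = Suc (n + j)}. (mass g v w - mass g (butlast v) w / 2) * complex_of_real (hat v t))"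
  proof (rule sum.cong)
    fix v :: "bool list" assume "v \<in> {v. length v = Suc (n + j)}"
    then have "v \<noteq> []" by auto
    from incr_alive[OF this al] show "incr g A v w * complex_of_real (hat v t) =
        (mass g v w - mass g (butlast v) w / 2) * complex_of_real (hat v t)" by simp
  qed simp
  also have "\<dots> = ?F (Suc (n + j)) - ?F (n + j)"
    unfolding sum_hat_children[where e="\<lambda>v. mass g v w"] Mn_eq_sum_hat[OF assms(2)] ..
  finally have e: "(\<Sum>v\<in>words_between n (n + Suc j). incr g A v w * complex_of_real (hat v t)) =
      (\<Sum>v\<in>words_between n (n + j). incr g A v w * complex_of_real (hat v t)) + (?F (Suc (n + j)) - ?F (n + j))" .
  show ?case unfolding e Suc.IH[symmetric] by simp
qed

lemma cmod_incr_le: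
  assumes "v \<noteq> []" "alive {- A..} (butlast v) w"
  shows "cmod (incr g A v w) \<le> exp (- g * V v w) + exp (- g * V (butlast v) w)"
proof -
  have "cmod (incr g A v w) \<le> cmod (mass g v w) + cmod (mass g (butlast v) w / 2)"
    unfolding incr_alive[OF assms] by (rule norm_triangle_ineq4)
  moreover have "cmod (mass g (butlast v) w / 2) \<le> exp (- g * V (butlast v) w)"
    by (simp add: norm_divide cmod_mass)
  ultimately show ?thesis unfolding cmod_mass by linarith
qed

text \<open>Only the ancestors of the interval containing \<open>t\<close> distinguish \<open>hat\<close> from the indicator of the
  lexicographic initial segment.\<close>

lemma cmod_Mn_diff_le:
  assumes al: "\<And>u. alive {- A..} u w"
    and z: "tz z \<le> t" "t \<le> tz z + 1 / 2 ^ length z" "n + j \<le> length z" and "0 \<le> t"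
  shows "cmod (Mn Theta g (1 - g) (n + j) w t - Mn Theta g (1 - g) n w t) \<le>
    cmod (psum g A n (n + j) z w) + 2 * (\<Sum>k\<in>{n..n + j}. exp (- g * V (take k z) w))"
proof -
  let ?W = "words_between n (n + j)"
  let ?P = "(\<lambda>k. take k z) ` {n<..n + j}"
  let ?i = "\<lambda>v. incr g A v w"
  \<comment> \<open>The error of replacing the fractional weight by the lexicographic indicator:
    zero off the ancestors of \<open>z\<close>, and at most 1 in modulus on them.\<close>
  let ?c = "\<lambda>v. hat v t - (if v \<le> z then 1 else 0)"
  let ?e = "\<lambda>k. exp (- g * V (take k z) w)"
  have inj: "inj_on (\<lambda>k. take k z) {n<..n + j}"
  proof (rule inj_onI)
    fix k l assume "k \<in> {n<..n + j}" "l \<in> {n<..n + j}" "take k z = take l z"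
    then have "length (take k z) = length (take l z)" "k \<le> length z" "l \<le> length z" using z(3) by auto
    then show "k = l" by simp
  qed
  have PW: "?P \<subseteq> ?W" using z(3) by (auto simp: words_between_def)
  have "psum g A n (n + j) z w = (\<Sum>v\<in>?W. if v \<le> z then ?i v else 0)"
    unfolding psum_def by (simp add: sum.inter_filter)
  also have "\<dots> = (\<Sum>v\<in>?W. ?i v * complex_of_real (if v \<le> z then 1 else 0))"
    by (intro sum.cong) auto
  finally have "Mn Theta g (1 - g) (n + j) w t - Mn Theta g (1 - g) n w t - psum g A n (n + j) z w =
      (\<Sum>v\<in>?W. ?i v * complex_of_real (?c v))"
    unfolding Mn_diff_eq_sum_incr[OF al assms(5)] by (simp add: sum_subtractf right_diff_distrib)
  also have "\<dots> = (\<Sum>v\<in>?P. ?i v * complex_of_real (?c v))"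
  proof (rule sum.mono_neutral_right)
    show "\<forall>v\<in>?W - ?P. ?i v * complex_of_real (?c v) = 0"
    proof
      fix v assume v: "v \<in> ?W - ?P"
      then have "n < length v" "length v \<le> n + j" by (auto simp: words_between_def)
      moreover from this v have "v \<noteq> take (length v) z" by (metis DiffD2 greaterThanAtMost_iff imageI)
      ultimately have "?c v = 0" using hat_eq_lex[OF z(1,2), of v] z(3) by simp
      then show "?i v * complex_of_real (?c v) = 0" by simp
    qed
  qed (use PW in auto)
  also have "\<dots> = (\<Sum>k\<in>{n<..n + j}. ?i (take k z) * complex_of_real (?c (take k z)))"
    using sum.reindex[OF inj] by simp
  finally have eq: "Mn Theta g (1 - g) (n + j) w t - Mn Theta g (1 - g) n w t =
      psum g A n (n + j) z w + (\<Sum>k\<in>{n<..n + j}. ?i (take k z) * complex_of_real (?c (take k z)))"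
    by (simp add: algebra_simps)
  have "cmod (\<Sum>k\<in>{n<..n + j}. ?i (take k z) * complex_of_real (?c (take k z))) \<le>
      (\<Sum>k\<in>{n<..n + j}. ?e k + ?e (k - 1))"
  proof (rule sum_norm_le)
    fix k assume k: "k \<in> {n<..n + j}"
    then have ne: "take k z \<noteq> []" and bl: "butlast (take k z) = take (k - 1) z"
      using z(3) by (auto simp: butlast_take)
    have "\<bar>?c (take k z)\<bar> \<le> 1" using hat_bounds[of "take k z" t] by auto
    then have "cmod (?i (take k z) * complex_of_real (?c (take k z))) \<le> cmod (?i (take k z)) * 1"
      unfolding norm_mult norm_of_real by (rule mult_left_mono) simp
    also have "\<dots> \<le> ?e k + ?e (k - 1)" using cmod_incr_le[OF ne al, of g] unfolding bl by simp
    finally show "cmod (?i (take k z) * complex_of_real (?c (take k z))) \<le> ?e k + ?e (k - 1)" .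
  qed
  also have "\<dots> = (\<Sum>k\<in>{n<..n + j}. ?e k) + (\<Sum>k\<in>{n<..n + j}. ?e (k - 1))"
    by (rule sum.distrib)
  also have "(\<Sum>k\<in>{n<..n + j}. ?e (k - 1)) = (\<Sum>k\<in>{n..<n + j}. ?e k)"
    by (rule sum.reindex_bij_witness[of _ Suc "\<lambda>k. k - 1"]) auto
  \<comment> \<open>The words run over \<open>{n<..n + j}\<close> and their parents over
    \<open>{n..<n + j}\<close>; both ranges lie in \<open>{n..n + j}\<close>.\<close>
  also have "(\<Sum>k\<in>{n<..n + j}. ?e k) + (\<Sum>k\<in>{n..<n + j}. ?e k) \<le> 2 * (\<Sum>k\<in>{n..n + j}. ?e k)"
  proof -
    have "(\<Sum>k\<in>{n<..n + j}. ?e k) \<le> (\<Sum>k\<in>{n..n + j}. ?e k)" by (rule sum_mono2) auto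
    moreover have "(\<Sum>k\<in>{n..<n + j}. ?e k) \<le> (\<Sum>k\<in>{n..n + j}. ?e k)" by (rule sum_mono2) auto
    ultimately show ?thesis by linarith
  qed
  finally have "cmod (\<Sum>k\<in>{n<..n + j}. ?i (take k z) * complex_of_real (?c (take k z))) \<le>
      2 * (\<Sum>k\<in>{n..n + j}. ?e k)" .
  then show ?thesis
    unfolding eq by (intro order_trans[OF norm_triangle_ineq add_left_mono])
qed

text \<open>There are \<open>2 ^ n\<close> words, each with mass at most \<open>exp (g * A)\<close>
  above the barrier and a weight of slope at most \<open>2 ^ n\<close>.\<close>

lemma Mn_lipschitz:
  assumes al: "\<And>u. alive {- A..} u w" and g: "0 \<le> g" and "0 \<le> s" "0 \<le> t"
  shows "cmod (Mn Theta g (1 - g) n w t - Mn Theta g (1 - g) n w s) \<le> exp (g * A) * 4 ^ n * \<bar>t - s\<bar>"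
proof -
  let ?Z = "{z::bool list. length z = n}"
  have "Mn Theta g (1 - g) n w t - Mn Theta g (1 - g) n w s =
      (\<Sum>z\<in>?Z. mass g z w * complex_of_real (hat z t - hat z s))"
    using assms(3,4) by (simp add: Mn_eq_sum_hat sum_subtractf right_diff_distrib)
  also have "cmod \<dots> \<le> (\<Sum>z\<in>?Z. exp (g * A) * (2 ^ n * \<bar>t - s\<bar>))"
  proof (rule sum_norm_le)
    fix z :: "bool list" assume "z \<in> ?Z"
    then have "\<bar>hat z t - hat z s\<bar> \<le> 2 ^ n * \<bar>t - s\<bar>" using hat_lipschitz[of z t s] by simp
    moreover have "cmod (mass g z w) \<le> exp (g * A)" using killed_mass_bounded[OF g, of A z w] al by simp
    ultimately show "cmod (mass g z w * complex_of_real (hat z t - hat z s)) \<le> exp (g * A) * (2 ^ n * \<bar>t - s\<bar>)"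
      unfolding norm_mult norm_of_real by (intro mult_mono) auto
  qed
  also have "\<dots> = exp (g * A) * (2 ^ n * 2 ^ n) * \<bar>t - s\<bar>"
    using card_lists_length_eq[of "UNIV :: bool set" n] by simp
  also have "(2::real) ^ n * 2 ^ n = 4 ^ n" by (simp add: power_mult_distrib[symmetric])
  finally show ?thesis .
qed

text \<open>The choice of \<open>g'\<close> between \<open>2 g - 1\<close> and \<open>g\<close> splits \<open>exp (- g V)\<close> into a factor that is summable along
  every path and a small factor.\<close>

lemma AE_Mn_increments:
  assumes g: "1 / 2 < g" "g < 1"
  shows "AE w in M. \<exists>C\<ge>0. \<exists>B\<ge>0. \<exists>K.
    (\<forall>k m t. K \<le> k \<longrightarrow> 2 ^ k \<le> m \<longrightarrow> m \<le> 2 ^ Suc k \<longrightarrow> t \<in> {0..1} \<longrightarrow>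
      cmod (Mn Theta g (1 - g) m w t - Mn Theta g (1 - g) (2 ^ k) w t) \<le> C * (2 powr (- ((1 - g) / 20))) ^ k) \<and>
    (\<forall>n s t. s \<in> {0..1} \<longrightarrow> t \<in> {0..1} \<longrightarrow>
      cmod (Mn Theta g (1 - g) n w t - Mn Theta g (1 - g) n w s) \<le> B * 4 ^ n * \<bar>t - s\<bar>)"
proof -
  \<comment> \<open>The midpoint of the two bounds, which gives the exponent
    \<open>(1 - g) / 2\<close> to the small factor.\<close>
  define g' where "g' = (3 * g - 1) / 2"
  let ?\<xi> = "(1 - g) / 20"
  have g': "2 * g - 1 < g'" "g - g' = (1 - g) / 2" using g by (auto simp: g'_def field_simps)
  have "AE w in M. \<exists>A\<ge>0. (\<forall>u. alive {- A..} u w) \<and>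
      (\<forall>\<^sub>F k in sequentially. block_max g A (2 ^ k) (2 ^ k) w < 2 powr (- real k / 20))"
    by (rule AE_barrier_imp) (rule AE_block_max[OF _ g(1)])
  \<comment> \<open>The additive functional is taken with exponent \<open>2 * g - 1\<close>, which
    is positive and below \<open>g'\<close>.\<close>
  moreover have "AE w in M. \<exists>S. \<forall>u. (\<Sum>j\<le>length u. exp (- g' * V (take j u) w)) \<le> S"
    by (rule AE_path_sum_bounded[OF _ g'(1)]) (use g in simp)
  ultimately show ?thesis using AE_low_particles
  proof eventually_elim
    case (elim w)
    then obtain A S where A: "0 \<le> A" "\<And>u. alive {- A..} u w"
      and block: "\<forall>\<^sub>F k in sequentially. block_max g A (2 ^ k) (2 ^ k) w < 2 powr (- real k / 20)"
      and S: "\<And>u. (\<Sum>j\<le>length u. exp (- g' * V (take j u) w)) \<le> S" by blast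
    have "0 \<le> S" using S[of "[]"] by simp
    from eventually_conj[OF block elim(3)] obtain K where
      K1: "\<And>k. K \<le> k \<Longrightarrow> block_max g A (2 ^ k) (2 ^ k) w < 2 powr (- real k / 20)" and
      K2: "\<And>k u. K \<le> k \<Longrightarrow> 2 ^ k \<le> length u \<Longrightarrow> exp (- V u w) < 2 powr (- real k / 10)"
      unfolding eventually_sequentially by blast
    have "cmod (Mn Theta g (1 - g) m w t - Mn Theta g (1 - g) (2 ^ k) w t) \<le> (1 + 2 * S) * (2 powr (- ?\<xi>)) ^ k"
      if k: "K \<le> k" and m: "2 ^ k \<le> m" "m \<le> 2 ^ Suc k" and t: "t \<in> {0..1}" for k m t
    proof -
      have rk: "(2 powr (- ?\<xi>)) ^ k = 2 powr (- real k * ?\<xi>)" by (simp add: powr_power)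
      obtain j where j: "m = 2 ^ k + j" using m(1) le_iff_add by blast
      \<comment> \<open>A word as long as the last level of the block: one \<open>z\<close> serves
        every \<open>m\<close> in it, and it belongs to the index set of
        \<open>block_max\<close>.\<close>
      obtain z where z: "length z = 2 ^ k + 2 ^ k" "tz z \<le> t" "t \<le> tz z + 1 / 2 ^ length z"
        using ex_dyadic_interval[of t "2 ^ k + 2 ^ k"] t by auto
      have jk: "j \<le> 2 ^ k" using m j by simp
      have "(\<Sum>i\<in>{2 ^ k..2 ^ k + j}. exp (- g * V (take i z) w)) \<le>
          (\<Sum>i\<in>{2 ^ k..2 ^ k + j}. 2 powr (- real k * ?\<xi>) * exp (- g' * V (take i z) w))"
      proof (rule sum_mono)
        fix i assume i: "i \<in> {2 ^ k..2 ^ k + j}"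
        let ?v = "V (take i z) w"
        have "exp (- ?v) < 2 powr (- real k / 10)" using i jk z by (intro K2[OF k]) auto
        then have "exp (- ?v) powr (g - g') \<le> (2 powr (- real k / 10)) powr (g - g')"
          using g by (intro powr_mono2) (auto simp: g'(2))
        also have "\<dots> = 2 powr (- real k * ?\<xi>)" unfolding g'(2) by (simp add: powr_powr)
        finally have "exp (- ?v * (g - g')) \<le> 2 powr (- real k * ?\<xi>)" by (simp add: exp_powr_real)
        then have "exp (- ?v * (g - g')) * exp (- g' * ?v) \<le> 2 powr (- real k * ?\<xi>) * exp (- g' * ?v)"
          by (rule mult_right_mono) simp
        then show "exp (- g * ?v) \<le> 2 powr (- real k * ?\<xi>) * exp (- g' * ?v)"
          by (simp add: exp_add[symmetric] algebra_simps)
      qed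
      also have "\<dots> = 2 powr (- real k * ?\<xi>) * (\<Sum>i\<in>{2 ^ k..2 ^ k + j}. exp (- g' * V (take i z) w))"
        by (simp add: sum_distrib_left)
      also have "\<dots> \<le> 2 powr (- real k * ?\<xi>) * S"
      proof (rule mult_left_mono)
        have "(\<Sum>i\<in>{2 ^ k..2 ^ k + j}. exp (- g' * V (take i z) w)) \<le> (\<Sum>i\<le>length z. exp (- g' * V (take i z) w))"
          using jk z(1) by (intro sum_mono2) auto
        then show "(\<Sum>i\<in>{2 ^ k..2 ^ k + j}. exp (- g' * V (take i z) w)) \<le> S" using S[of z] by linarith
      qed simp
      finally have path: "(\<Sum>i\<in>{2 ^ k..2 ^ k + j}. exp (- g * V (take i z) w)) \<le> 2 powr (- real k * ?\<xi>) * S" .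
      have "cmod (psum g A (2 ^ k) (2 ^ k + j) z w) \<le> 2 powr (- real k / 20)"
        using cmod_psum_le_block_max[OF jk z(1), of g A w] K1[OF k] by linarith
      also have "\<dots> \<le> 2 powr (- real k * ?\<xi>)"
      proof (rule powr_mono)
        have "real k * (1 - g) \<le> real k * 1" using g by (intro mult_left_mono) auto
        then show "- real k / 20 \<le> - real k * ?\<xi>" by simp
      qed simp
      finally have "cmod (psum g A (2 ^ k) (2 ^ k + j) z w) \<le> 2 powr (- real k * ?\<xi>)" .
      moreover have "cmod (Mn Theta g (1 - g) m w t - Mn Theta g (1 - g) (2 ^ k) w t) \<le>
          cmod (psum g A (2 ^ k) (2 ^ k + j) z w) + 2 * (\<Sum>i\<in>{2 ^ k..2 ^ k + j}. exp (- g * V (take i z) w))"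
        unfolding j using t jk z(1) by (intro cmod_Mn_diff_le[OF A(2) z(2,3)]) auto
      ultimately show ?thesis unfolding rk using path by (simp add: algebra_simps)
    qed
    moreover have "cmod (Mn Theta g (1 - g) n w t - Mn Theta g (1 - g) n w s) \<le> exp (g * A) * 4 ^ n * \<bar>t - s\<bar>"
      if "s \<in> {0..1}" "t \<in> {0..1}" for n s t
      using Mn_lipschitz[OF A(2), of g s t n] that g by simp
    moreover have "0 \<le> 1 + 2 * S" "0 \<le> exp (g * A)" using \<open>0 \<le> S\<close> by auto
    ultimately show ?case by blast
  qed
qed

end

section \<open>Passage to the stated modulus of continuity\<close>

text \<open>For \<open>d <= 1\<close> the logarithm is at least \<open>ln 2\<close>, so the surplus
  power \<open>eps\<close> is absorbed by a constant.\<close>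

lemma powr_log_weaken:
  fixes d :: real
  assumes "0 < d" "d \<le> 1" "0 < eps"
  shows "ln (1 + 1 / d) powr (- \<xi>) \<le> ln 2 powr (- eps) / ln (1 + 1 / d) powr (\<xi> - eps)"
proof -
  let ?L = "ln (1 + 1 / d)"
  have "2 \<le> 1 + 1 / d" using assms by simp
  then have L: "ln 2 \<le> ?L" by (intro ln_mono) auto
  then have L0: "0 < ?L" using ln_gt_zero[of "2::real"] by linarith
  have "?L powr (- \<xi>) = ?L powr (- eps) * ?L powr (- (\<xi> - eps))" by (simp add: powr_add[symmetric])
  also have "\<dots> \<le> ln 2 powr (- eps) * ?L powr (- (\<xi> - eps))"
    using L assms by (intro mult_right_mono powr_mono2') auto
  also have "\<dots> = ln 2 powr (- eps) / ?L powr (\<xi> - eps)" by (simp only: powr_minus divide_inverse)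
  finally show ?thesis .
qed

theorem theorem1p2:
  fixes M :: "'a measure" and Theta :: "bool list \<Rightarrow> 'a \<Rightarrow> complex"
    and \<gamma> \<beta> :: real
  assumes "prob_space M"
    and indep: "prob_space.indep_vars M (\<lambda>_. borel) Theta {u. u \<noteq> []}"
    and distRe: "\<And>u. u \<noteq> [] \<Longrightarrow>
      distributed M lborel (\<lambda>\<omega>. Re (Theta u \<omega>)) (normal_density (2 * ln 2) (sqrt (2 * ln 2)))"
    and distIm: "\<And>u. u \<noteq> [] \<Longrightarrow>
      distributed M lborel (\<lambda>\<omega>. Im (Theta u \<omega>)) std_normal_density"
    and indepReIm: "\<And>u. u \<noteq> [] \<Longrightarrow>
      prob_space.indep_var M borel (\<lambda>\<omega>. Re (Theta u \<omega>)) borel (\<lambda>\<omega>. Im (Theta u \<omega>))"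
    and "1/2 < \<gamma>" and "\<gamma> < 1"
    and "\<beta> = 1 - \<gamma>"
  shows "(AE \<omega> in M. \<exists>F :: real \<Rightarrow> complex. continuous_on {0..1} F \<and>
            uniform_limit {0..1} (\<lambda>n t. Mn Theta \<gamma> \<beta> n \<omega> t) F sequentially)
      \<and> (\<exists>\<xi>>0. \<forall>\<epsilon>>0. AE \<omega> in M. \<forall>F :: real \<Rightarrow> complex.
            uniform_limit {0..1} (\<lambda>n t. Mn Theta \<gamma> \<beta> n \<omega> t) F sequentially \<longrightarrow>
            (\<exists>C>0. \<forall>s\<in>{0..1}. \<forall>t\<in>{0..1}. s \<noteq> t \<longrightarrow>
               cmod (F t - F s) \<le> C / (ln (1 + 1 / \<bar>t - s\<bar>)) powr (\<xi> - \<epsilon>)))"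
proof -
  interpret prob_space M by fact
  interpret cascade M Theta
    by unfold_locales (use indep distRe distIm indepReIm in auto)
  let ?\<xi> = "(1 - \<gamma>) / 20"
  let ?F = "\<lambda>\<omega> n t. Mn Theta \<gamma> \<beta> n \<omega> t"
  have \<xi>: "0 < ?\<xi>" using assms by simp
  \<comment> \<open>A single almost sure event, chosen before epsilon, carries both the convergence
    and the modulus with exponent \<open>?\<xi>\<close> itself.\<close>
  have AE: "AE \<omega> in M. (\<exists>G. continuous_on {0..1} G \<and> uniform_limit {0..1} (?F \<omega>) G sequentially) \<and>
      (\<forall>G. uniform_limit {0..1} (?F \<omega>) G sequentially \<longrightarrow>
        (\<exists>C>0. \<forall>s\<in>{0..1}. \<forall>t\<in>{0..1}. s \<noteq> t \<longrightarrow> cmod (G t - G s) \<le> C * ln (1 + 1 / \<bar>t - s\<bar>) powr (- ?\<xi>)))"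
    using AE_Mn_increments[OF assms(6,7)]
  proof eventually_elim
    case (elim \<omega>)
    then obtain C B K where C: "0 \<le> C" and B: "0 \<le> B"
      and blk: "\<And>k m t. K \<le> k \<Longrightarrow> 2 ^ k \<le> m \<Longrightarrow> m \<le> 2 ^ Suc k \<Longrightarrow> t \<in> {0..1} \<Longrightarrow>
        cmod (?F \<omega> m t - ?F \<omega> (2 ^ k) t) \<le> C * (2 powr (- ?\<xi>)) ^ k"
      and lip: "\<And>n s t. s \<in> {0..1} \<Longrightarrow> t \<in> {0..1} \<Longrightarrow>
        cmod (?F \<omega> n t - ?F \<omega> n s) \<le> B * 4 ^ n * \<bar>t - s\<bar>"
      unfolding assms(8) by blast
    show ?case
      using uniform_limit_log_modulus[OF \<xi> C B blk lip] by blast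
  qed
  show ?thesis
  proof (intro conjI exI[of _ ?\<xi>] allI impI \<xi>)
    show "AE \<omega> in M. \<exists>F. continuous_on {0..1} F \<and> uniform_limit {0..1} (?F \<omega>) F sequentially"
      using AE by eventually_elim blast
    fix \<epsilon> :: real assume \<epsilon>: "0 < \<epsilon>"
    show "AE \<omega> in M. \<forall>F. uniform_limit {0..1} (?F \<omega>) F sequentially \<longrightarrow>
        (\<exists>C>0. \<forall>s\<in>{0..1}. \<forall>t\<in>{0..1}. s \<noteq> t \<longrightarrow>
          cmod (F t - F s) \<le> C / (ln (1 + 1 / \<bar>t - s\<bar>)) powr (?\<xi> - \<epsilon>))"
      using AE
    proof eventually_elim
      case (elim \<omega>)
      show ?case
      proof (intro allI impI)
        fix G assume "uniform_limit {0..1} (?F \<omega>) G sequentially"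
        with elim obtain C where C: "C > 0" "\<And>s t. s \<in> {0..1} \<Longrightarrow> t \<in> {0..1} \<Longrightarrow> s \<noteq> t \<Longrightarrow>
            cmod (G t - G s) \<le> C * ln (1 + 1 / \<bar>t - s\<bar>) powr (- ?\<xi>)" by blast
        have "cmod (G t - G s) \<le> C * ln 2 powr (- \<epsilon>) / (ln (1 + 1 / \<bar>t - s\<bar>)) powr (?\<xi> - \<epsilon>)"
          if "s \<in> {0..1}" "t \<in> {0..1}" "s \<noteq> t" for s t
        proof -
          have "cmod (G t - G s) \<le> C * ln (1 + 1 / \<bar>t - s\<bar>) powr (- ?\<xi>)" by (rule C(2)[OF that])
          also have "\<dots> \<le> C * (ln 2 powr (- \<epsilon>) / ln (1 + 1 / \<bar>t - s\<bar>) powr (?\<xi> - \<epsilon>))"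
            using that C(1) by (intro mult_left_mono powr_log_weaken \<epsilon>) auto
          finally show ?thesis by simp
        qed
        moreover have "0 < C * ln 2 powr (- \<epsilon>)" using C(1) by simp
        ultimately show "\<exists>C>0. \<forall>s\<in>{0..1}. \<forall>t\<in>{0..1}. s \<noteq> t \<longrightarrow>
            cmod (G t - G s) \<le> C / (ln (1 + 1 / \<bar>t - s\<bar>)) powr (?\<xi> - \<epsilon>)" by blast
      qed
    qed
  qed
qed

end
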